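(* Let $H_1,\dots,H_Q$ be Hamiltonians and $w_1,\dots,w_Q$ weights (constant, or slowly varying in time in the sense given in the context) such that $\|H_i\|_\infty\le C$ for all $i$, $\sum_{i=1}^Q w_i=1$ and $w_i\ge 0$. Let $\epsilon_0>0$. If each elementary Hamiltonian $H_i$ can be applied during any time-step $\tau$ perfectly (i.e. $e^{-iH_i\tau}$ is implemented exactly) at gate-cost $\alpha+\beta C\tau$, then there exists a $\lambda$ such that the Markov-chain compiler with total transition rate $\lambda$ simulates $H=\sum_{i=1}^Q w_iH_i$ for a duration $T$ with an error smaller than $\epsilon_0$, with an expected number of gates $$\bar G\le \frac{4\alpha C^2T^2}{\epsilon_0}+(2\alpha+\beta)CT .$$
   Context: The $H_i$ are Hermitian operators on the finite-dimensional Hilbert space of a quantum system (typically $n$ qubits), and $\|\cdot\|_\infty$ is the operator norm. Markov-chain compiler with total transition rate $\lambda$: let $\lambda$ be constant and finite. Consider the continuous-time Markov chain on nodes $\{1,\dots,Q\}$ over the time interval $[0,T]$ with initial distribution $(w_i(0))_i$ and transition rates from node $i$ to node $j\ne i$ given by $A_{ij}=\dot w_j+\lambda w_j$ (which must be nonnegative); the chain is then at node $i$ with probability $w_i(t)$ at every time $t$. Sample a realization of this chain, recorded as a list of pairs $(k,\tau)$ of successive nodes and times spent in them, with total duration $T$. Apply, in this order, the unitaries $e^{-iH_k\tau}$ to the quantum system. Let $S_T$ be the resulting quantum channel, averaged over realizations of the chain. $\bar G$ is the expected number of gates used, the expectation being over realizations of the chain. Slowly varying weights: the $w_j$ are differentiable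 in $t$ and $-\dot w_j/w_j$ is bounded above by some constant, so that the rates $A_{ij}$ are nonnegative for all large enough $\lambda$ (automatic for constant weights). Exact channel: $E_T(\sigma)=U\sigma U^\dagger$ with $U=\mathcal T\exp\left(-i\int_0^T H\,dt\right)$, where $\mathcal T$ denotes time ordering. Error smaller than $\epsilon_0$ means $F(E_T,S_T)\ge 1-\epsilon_0$, where $F(E_T,S_T)$ is the minimum, over (pure) input states, of the fidelity between the outputs of the two channels for the same input; for a pure state $\psi=|\psi\rangle\langle\psi|$ and a state $\rho$, the fidelity is $F(\psi,\rho)=\langle\psi|\rho|\psi\rangle$.
   Formalization: Added: if α>0, 1+KT ≤ 4C²T²/ε₀+2CT, where −dw_j/dt ≤ K w_j (K=0 for constant weights). Without it the bound can be below the cost α of the one gate always used; for varying weights it is sufficient, not always necessary. Also α, β ≥ 0. *)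

theory Defs
  imports "HOL-Probability.Probability"
begin

section \<open>Operators on a finite-dimensional Hilbert space\<close>

definition dagger :: "complex^'n^'n \<Rightarrow> complex^'n^'n" where
  "dagger A = (\<chi> i j. cnj (A $ j $ i))"

definition hermitian :: "complex^'n^'n \<Rightarrow> bool" where
  "hermitian A \<longleftrightarrow> dagger A = A"

definition cscale :: "complex \<Rightarrow> complex^'n^'n \<Rightarrow> complex^'n^'n" where
  "cscale c A = (\<chi> i j. c * A $ i $ j)"

text \<open>The library's \<open>exp\<close> and \<open>^\<close> are not available for matrices: \<open>*\<close> on
  \<^typ>\<open>complex^'n^'n\<close> is the entrywise product.\<close>

primrec matpow :: "complex^'n^'n \<Rightarrow> nat \<Rightarrow> complex^'n^'n" where
  "matpow A 0 = mat 1"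
| "matpow A (Suc n) = A ** matpow A n"

definition mexp :: "complex^'n^'n \<Rightarrow> complex^'n^'n" where
  "mexp A = (\<Sum>n. (1 / fact n) *\<^sub>R matpow A n)"

text \<open>The time-ordered exponential \<open>\<T> exp (\<integral>\<^sub>0\<^sup>t A ds)\<close> as the sum of its Dyson
  series, later times standing to the left.\<close>

primrec dyson :: "(real \<Rightarrow> complex^'n^'n) \<Rightarrow> nat \<Rightarrow> real \<Rightarrow> complex^'n^'n" where
  "dyson A 0 = (\<lambda>t. mat 1)"
| "dyson A (Suc n) = (\<lambda>t. integral {0..t} (\<lambda>s. A s ** dyson A n s))"

definition time_ordered_exp :: "(real \<Rightarrow> complex^'n^'n) \<Rightarrow> real \<Rightarrow> complex^'n^'n" where
  "time_ordered_exp A t = (\<Sum>n. dyson A n t)"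

section \<open>Channels and fidelity\<close>

definition unitary_channel :: "complex^'n^'n \<Rightarrow> complex^'n^'n \<Rightarrow> complex^'n^'n" where
  "unitary_channel U \<sigma> = U ** \<sigma> ** dagger U"

definition cinner :: "complex^'n \<Rightarrow> complex^'n \<Rightarrow> complex" where
  "cinner x y = (\<Sum>i\<in>UNIV. cnj (x $ i) * y $ i)"

definition pure_state :: "complex^'n \<Rightarrow> complex^'n^'n" where
  "pure_state \<psi> = (\<chi> i j. \<psi> $ i * cnj (\<psi> $ j))"

definition fidelity :: "complex^'n \<Rightarrow> complex^'n^'n \<Rightarrow> real" where
  "fidelity \<phi> \<rho> = Re (cinner \<phi> (\<rho> *v \<phi>))"

text \<open>For \<open>E\<close> mapping pure states to pure states; the vector \<open>\<phi>\<close> representing the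
  output of \<open>E\<close> is unique up to a phase, which \<^const>\<open>fidelity\<close> does not see.\<close>

definition channel_fidelity ::
  "(complex^'n^'n \<Rightarrow> complex^'n^'n) \<Rightarrow> (complex^'n^'n \<Rightarrow> complex^'n^'n) \<Rightarrow> real" where
  "channel_fidelity E S =
     Inf {fidelity \<phi> (S (pure_state \<psi>)) | \<psi> \<phi>.
            norm \<psi> = 1 \<and> norm \<phi> = 1 \<and> E (pure_state \<psi>) = pure_state \<phi>}"

section \<open>Realizations of a time-inhomogeneous Markov jump chain\<close>

text \<open>\<open>A i j t\<close> is the rate of jumping from node \<open>i\<close> to node \<open>j \<noteq> i\<close> at time \<open>t\<close>; the
  diagonal of \<open>A\<close> is never used, so successive nodes of a realization are distinct.\<close>

definition exit_rate :: "('q::finite \<Rightarrow> 'q \<Rightarrow> real \<Rightarrow> real) \<Rightarrow> 'q \<Rightarrow> real \<Rightarrow> real" where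
  "exit_rate A i t = (\<Sum>j\<in>-{i}. A i j t)"

definition survival :: "('q::finite \<Rightarrow> 'q \<Rightarrow> real \<Rightarrow> real) \<Rightarrow> 'q \<Rightarrow> real \<Rightarrow> real \<Rightarrow> real" where
  "survival A i s t = exp (- integral {s..t} (exit_rate A i))"

text \<open>For the chain started at node \<open>i\<close> at time \<open>s\<close> and run until \<open>T\<close>, \<open>path_integral A T m i s f\<close>
  is the expectation of \<open>f\<close>, applied to the list of (node, time spent) pairs, on the event that
  there are exactly \<open>m\<close> jumps; the recursion conditions on the time \<open>t\<close> and target \<open>j\<close> of the first
  jump, which have joint density \<open>survival A i s t * A i j t\<close>.\<close>

primrec path_integral ::
  "('q::finite \<Rightarrow> 'q \<Rightarrow> real \<Rightarrow> real) \<Rightarrow> real \<Rightarrow> nat \<Rightarrow> 'q \<Rightarrow> real \<Rightarrow> (('q \<times> real) list \<Rightarrow> ennreal) \<Rightarrow> ennreal"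
where
  "path_integral A T 0 = (\<lambda>i s f. ennreal (survival A i s T) * f [(i, T - s)])"
| "path_integral A T (Suc m) = (\<lambda>i s f.
     \<integral>\<^sup>+ t. indicator {s..T} t * ennreal (survival A i s t) *
        (\<Sum>j\<in>-{i}. ennreal (A i j t) * path_integral A T m j t (\<lambda>l. f ((i, t - s) # l))) \<partial>lborel)"

text \<open>The law of the realization over \<open>[0, T]\<close> with initial distribution \<open>p\<close>, on the sigma-algebra
  generated by the lists with entries in prescribed measurable sets. It is a probability measure
  when the rates are nonnegative, bounded and measurable and \<open>p\<close> is a probability vector.\<close>

definition realization_law ::
  "('q::finite \<Rightarrow> real) \<Rightarrow> ('q \<Rightarrow> 'q \<Rightarrow> real \<Rightarrow> real) \<Rightarrow> real \<Rightarrow> ('q \<times> real) list measure" where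
  "realization_law p A T =
     measure_of UNIV {listset Bs | Bs. set Bs \<subseteq> sets (count_space UNIV \<Otimes>\<^sub>M borel)}
       (\<lambda>S. \<Sum>i\<in>UNIV. ennreal (p i) * (\<Sum>m. path_integral A T m i 0 (indicator S)))"

section \<open>The Markov-chain compiler\<close>

text \<open>\<open>dw j t\<close> stands for the time derivative of the weight \<open>w j t\<close>.\<close>

definition compiler_rate ::
  "('q \<Rightarrow> real \<Rightarrow> real) \<Rightarrow> ('q \<Rightarrow> real \<Rightarrow> real) \<Rightarrow> real \<Rightarrow> 'q \<Rightarrow> 'q \<Rightarrow> real \<Rightarrow> real" where
  "compiler_rate w dw lam i j t = dw j t + lam * w j t"

definition compiler_law ::
  "('q::finite \<Rightarrow> real \<Rightarrow> real) \<Rightarrow> ('q \<Rightarrow> real \<Rightarrow> real) \<Rightarrow> real \<Rightarrow> real \<Rightarrow> ('q \<times> real) list measure" where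
  "compiler_law w dw lam T = realization_law (\<lambda>i. w i 0) (compiler_rate w dw lam) T"

text \<open>The head of the list is applied first, hence stands rightmost.\<close>

primrec circuit :: "('q \<Rightarrow> complex^'n^'n) \<Rightarrow> ('q \<times> real) list \<Rightarrow> complex^'n^'n" where
  "circuit H [] = mat 1"
| "circuit H (p # l) = circuit H l ** mexp (cscale (- \<i> * of_real (snd p)) (H (fst p)))"

definition compiler_channel ::
  "('q::finite \<Rightarrow> complex^'n^'n) \<Rightarrow> ('q \<Rightarrow> real \<Rightarrow> real) \<Rightarrow> ('q \<Rightarrow> real \<Rightarrow> real) \<Rightarrow> real \<Rightarrow> real
     \<Rightarrow> complex^'n^'n \<Rightarrow> complex^'n^'n" where
  "compiler_channel H w dw lam T \<sigma> =
     (\<integral> l. unitary_channel (circuit H l) \<sigma> \<partial>compiler_law w dw lam T)"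

definition gate_count :: "real \<Rightarrow> real \<Rightarrow> real \<Rightarrow> ('q \<times> real) list \<Rightarrow> real" where
  "gate_count \<alpha> \<beta> C l = (\<Sum>(k, \<tau>)\<leftarrow>l. \<alpha> + \<beta> * C * \<tau>)"

text \<open>Extended nonnegative, so that an upper bound includes finiteness.\<close>

definition expected_gates ::
  "real \<Rightarrow> real \<Rightarrow> real \<Rightarrow> ('q::finite \<Rightarrow> real \<Rightarrow> real) \<Rightarrow> ('q \<Rightarrow> real \<Rightarrow> real) \<Rightarrow> real \<Rightarrow> real \<Rightarrow> ennreal" where
  "expected_gates \<alpha> \<beta> C w dw lam T =
     (\<integral>\<^sup>+ l. ennreal (gate_count \<alpha> \<beta> C l) \<partial>compiler_law w dw lam T)"

definition total_hamiltonian ::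
  "('q::finite \<Rightarrow> complex^'n^'n) \<Rightarrow> ('q \<Rightarrow> real \<Rightarrow> real) \<Rightarrow> real \<Rightarrow> complex^'n^'n" where
  "total_hamiltonian H w t = (\<Sum>i\<in>UNIV. w i t *\<^sub>R H i)"

definition exact_channel ::
  "('q::finite \<Rightarrow> complex^'n^'n) \<Rightarrow> ('q \<Rightarrow> real \<Rightarrow> real) \<Rightarrow> real \<Rightarrow> complex^'n^'n \<Rightarrow> complex^'n^'n" where
  "exact_channel H w T =
     unitary_channel (time_ordered_exp (\<lambda>t. cscale (- \<i>) (total_hamiltonian H w t)) T)"

end

theory Submission imports Defs begin

text \<open>Since the rate of jumping to a node \<open>j\<close> is \<open>a\<^sub>j = dw\<^sub>j + \<lambda> w\<^sub>j\<close>, whatever the current node, and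
  \<open>a\<^sub>j \<ge> 0\<close>, \<open>\<Sum>\<^sub>j a\<^sub>j = \<lambda>\<close>, the exit rate is at most \<open>\<lambda>\<close>, so at most \<open>1 + \<lambda>T\<close> gates are expected.

  For the error, fix an input \<open>\<psi>\<close> with exact evolution \<open>u\<close>, let \<open>\<phi> = u T\<close>, and let \<open>y\<^sub>i s\<close> be the
  adjoint of the averaged circuit of the chain started at node \<open>i\<close> at time \<open>s\<close>, applied to \<open>\<phi>\<close>. Then
  \<open>y\<^sub>i' = -\<i> H\<^sub>i y\<^sub>i + \<lambda> y\<^sub>i - \<Sum>\<^sub>j a\<^sub>j y\<^sub>j\<close>. The last term does not depend on \<open>i\<close>, so
  \<open>\<parallel>y\<^sub>i - y\<^sub>j\<parallel> \<le> 2C \<mu>(T - s)\<close>, where \<open>\<mu>' = 1 - \<lambda>\<mu>\<close> and \<open>\<mu>(0) = 0\<close>, while the mean \<open>\<Sum>\<^sub>i w\<^sub>i y\<^sub>i\<close> has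
  derivative \<open>\<Sum>\<^sub>i w\<^sub>i (-\<i> H\<^sub>i) y\<^sub>i\<close>, free of \<open>dw\<close>. Hence the overlap of the mean with \<open>u\<close> changes at
  rate at most \<open>2C\<^sup>2 \<mu>(T - s)\<close>, and at time \<open>0\<close> it is at least \<open>1 - 2C\<^sup>2 J(T)\<close> with \<open>J' = \<mu>\<close>,
  \<open>J(T) \<le> T\<^sup>2 / (1 + \<lambda>T)\<close>. That overlap is the expectation of \<open>Re z\<close>, \<open>z\<close> being the overlap of \<open>\<phi>\<close>
  with the output of one random circuit, and \<open>\<bar>z\<bar>\<^sup>2 \<ge> 2 Re z - 1\<close> bounds the infidelity by
  \<open>4C\<^sup>2T\<^sup>2 / (1 + \<lambda>T)\<close>. Choosing \<open>1 + \<lambda>T = 4C\<^sup>2T\<^sup>2/\<epsilon>\<^sub>0 + 2CT\<close> gives the theorem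
  when \<open>\<alpha> > 0\<close>; otherwise the cost is \<open>\<beta>CT\<close> whatever the chain does, and any large \<open>\<lambda>\<close> will do.\<close>

section \<open>The sigma-algebra on lists\<close>

text \<open>The sigma-algebra of \<open>realization_law\<close>, over a general \<open>M\<close>, so
  that measurability of functions of lists can be treated apart from any law.\<close>

definition list_algebra :: "'a measure \<Rightarrow> 'a list measure" where
  "list_algebra M = sigma UNIV {listset Bs | Bs. set Bs \<subseteq> sets M}"

lemma space_list_algebra [simp]: "space (list_algebra M) = UNIV"
  by (simp add: list_algebra_def)

lemma sets_list_algebra: "sets (list_algebra M) = sigma_sets UNIV {listset Bs | Bs. set Bs \<subseteq> sets M}"
  by (simp add: list_algebra_def)

lemma listset_in_sets [intro]: "set Bs \<subseteq> sets M \<Longrightarrow> listset Bs \<in> sets (list_algebra M)"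
  by (auto simp: sets_list_algebra)

lemma in_listset_iff: "l \<in> listset Bs \<longleftrightarrow> list_all2 (\<in>) l Bs"
  by (induction Bs arbitrary: l) (auto simp: set_Cons_def list_all2_Cons2)

lemma listset_Cons_iff: "a # l \<in> listset (B # Bs) \<longleftrightarrow> a \<in> B \<and> l \<in> listset Bs"
  by (simp add: in_listset_iff del: listset.simps)

lemma Nil_in_listset_iff: "[] \<in> listset Bs \<longleftrightarrow> Bs = []"
  by (simp add: in_listset_iff)

lemma in_listset_replicate_UNIV [simp]: "l \<in> listset (replicate n UNIV) \<longleftrightarrow> length l = n"
  by (auto simp: in_listset_iff list_all2_conv_all_nth)

lemma list_all2_snoc: "list_all2 P (xs @ [x]) (ys @ [y]) \<longleftrightarrow> list_all2 P xs ys \<and> P x y"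
  by (auto simp: list_all2_conv_all_nth nth_append less_Suc_eq)

lemma measurable_list_algebraI:
  assumes "\<And>Bs. set Bs \<subseteq> sets M \<Longrightarrow> f -` listset Bs \<inter> space N \<in> sets N"
  shows "f \<in> measurable N (list_algebra M)"
  unfolding list_algebra_def by (rule measurable_measure_of) (use assms in auto)

text \<open>A box of lists splits into a box for the prefix and a set for the last entry. Entries
  are added at the end because \<open>measurable_path_integral_pair\<close> carries the past of the
  path as a growing prefix.\<close>

lemma measurable_snoc:
  assumes f[measurable]: "f \<in> measurable N (list_algebra M)" and g[measurable]: "g \<in> measurable N M"
  shows "(\<lambda>x. f x @ [g x]) \<in> measurable N (list_algebra M)"
proof (rule measurable_list_algebraI)
  fix Bs assume Bs: "set Bs \<subseteq> sets M"
  show "(\<lambda>x. f x @ [g x]) -` listset Bs \<inter> space N \<in> sets N"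
  proof (cases Bs rule: rev_cases)
    case Nil
    then show ?thesis by (simp add: vimage_def)
  next
    case (snoc Cs C)
    have [measurable]: "listset Cs \<in> sets (list_algebra M)" "C \<in> sets M" using Bs snoc by auto
    have "(\<lambda>x. f x @ [g x]) -` listset Bs \<inter> space N = {x \<in> space N. f x \<in> listset Cs \<and> g x \<in> C}"
      unfolding snoc in_listset_iff vimage_def list_all2_snoc by auto
    then show ?thesis by simp
  qed
qed

lemma measurable_length [measurable]: "length \<in> measurable (list_algebra M) (count_space UNIV)"
  if "space M = UNIV" for M :: "'a measure"
proof (rule measurableI)
  fix A :: "nat set"
  have UM: "UNIV \<in> sets M" using sets.top[of M] that by simp
  have "length -` A \<inter> space (list_algebra M) = (\<Union>n\<in>A. listset (replicate n UNIV))"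
    by auto
  also have "\<dots> \<in> sets (list_algebra M)"
    by (intro sets.countable_UN'' listset_in_sets countableI_type) (use UM in auto)
  finally show "length -` A \<inter> space (list_algebra M) \<in> sets (list_algebra M)" .
qed simp

lemma measurable_tl [measurable]: "tl \<in> measurable (list_algebra M) (list_algebra M)"
  if "space M = UNIV" for M :: "'a measure"
proof (rule measurable_list_algebraI)
  fix Bs assume Bs: "set Bs \<subseteq> sets M"
  have UM: "UNIV \<in> sets M" using sets.top[of M] that by simp
  \<comment> \<open>Since \<open>tl [] = []\<close>, the empty list lies in the preimage exactly
    when \<open>Bs\<close> is empty.\<close>
  have "tl -` listset Bs \<inter> space (list_algebra M) = (if Bs = [] then {[]} else {}) \<union> listset (UNIV # Bs)"
  proof (intro set_eqI iffI)
    fix l assume "l \<in> tl -` listset Bs \<inter> space (list_algebra M)"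
    then show "l \<in> (if Bs = [] then {[]} else {}) \<union> listset (UNIV # Bs)"
      by (cases l) (auto simp: listset_Cons_iff Nil_in_listset_iff simp del: listset.simps(2))
  qed (auto simp: set_Cons_def split: if_splits)
  also have "\<dots> \<in> sets (list_algebra M)"
    using listset_in_sets[of "[]" M] listset_in_sets[of "UNIV # Bs" M] Bs UM
    by (intro sets.Un) (simp_all del: listset.simps(2))
  finally show "tl -` listset Bs \<inter> space (list_algebra M) \<in> sets (list_algebra M)" .
qed

lemma measurable_hd [measurable]:
  fixes M :: "'a measure"
  assumes "space M = UNIV"
  shows "hd \<in> measurable (list_algebra M) M"
proof (rule measurableI)
  fix A assume A: "A \<in> sets M"
  have UM: "UNIV \<in> sets M" using sets.top[of M] assms by simp
  \<comment> \<open>\<open>hd []\<close> is an unspecified value, hence the distinction whether it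
    lies in \<open>A\<close>.\<close>
  have "hd -` A \<inter> space (list_algebra M) =
    (if hd [] \<in> A then {[]} else {}) \<union> (\<Union>n. listset (A # replicate n UNIV))"
  proof (intro set_eqI iffI)
    fix l assume "l \<in> hd -` A \<inter> space (list_algebra M)"
    then show "l \<in> (if hd [] \<in> A then {[]} else {}) \<union> (\<Union>n. listset (A # replicate n UNIV))"
      by (cases l) (auto simp: listset_Cons_iff simp del: listset.simps(2))
  qed (auto simp: set_Cons_def split: if_splits)
  also have "\<dots> \<in> sets (list_algebra M)"
    using A UM listset_in_sets[of "[]" M]
    by (intro sets.Un sets.countable_UN'' listset_in_sets countableI_type) (auto simp: set_replicate_conv_if)
  finally show "hd -` A \<inter> space (list_algebra M) \<in> sets (list_algebra M)" .
qed (use assms in simp)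

text \<open>\<open>F\<close> is cut off to lists of length at most \<open>n\<close>. Each cut-off is
  measurable by induction through \<open>hd\<close> and \<open>tl\<close>, and on a given list the
  cut-offs are eventually equal to \<open>F\<close>.\<close>

lemma measurable_list_rec:
  fixes F :: "'a list \<Rightarrow> 'b::{metric_space, zero, second_countable_topology}"
  assumes M: "space M = UNIV"
    and F: "\<And>x l. F (x # l) = g (x, F l)"
    and g: "g \<in> measurable (M \<Otimes>\<^sub>M borel) borel"
  shows "F \<in> measurable (list_algebra M) borel"
proof -
  note [measurable] = g measurable_hd[OF M] measurable_tl[OF M] measurable_length[OF M]
  define G where "G n l = (if length l \<le> n then F l else 0)" for n l
  have G: "G n \<in> measurable (list_algebra M) borel" for n
  proof (induction n)
    case 0
    have "G 0 = (\<lambda>l. if length l = 0 then F [] else 0)" by (auto simp: G_def)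
    then show ?case by (simp only:) measurable
  next
    case (Suc n)
    note [measurable] = Suc
    have "G (Suc n) = (\<lambda>l. if length l = 0 then F [] else
        if length l \<le> Suc n then g (hd l, G n (tl l)) else 0)"
      by (rule ext) (case_tac l, auto simp: G_def F)
    then show ?case by (simp only:) measurable
  qed
  show ?thesis
  proof (rule borel_measurable_LIMSEQ_metric[OF G])
    fix l
    have "\<forall>\<^sub>F n in sequentially. G n l = F l"
      using eventually_ge_at_top[of "length l"] by eventually_elim (simp add: G_def)
    then show "(\<lambda>n. G n l) \<longlonglongrightarrow> F l" by (rule tendsto_eventually)
  qed
qed

section \<open>Integration over jump paths\<close>

abbreviation path_algebra :: "('q \<times> real) list measure" where
  "path_algebra \<equiv> list_algebra (count_space UNIV \<Otimes>\<^sub>M borel)"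

lemma space_node_time: "space (count_space UNIV \<Otimes>\<^sub>M borel) = (UNIV :: ('q \<times> real) set)"
  by (simp add: space_pair_measure)

lemma path_integral_mono:
  assumes "\<And>l. f l \<le> g l"
  shows "path_integral A T m i s f \<le> path_integral A T m i s g"
  using assms
proof (induction m arbitrary: i s f g)
  case 0
  then show ?case by (auto intro: mult_left_mono)
next
  case (Suc m)
  show ?case
    unfolding path_integral.simps
    by (intro nn_integral_mono mult_left_mono sum_mono Suc) auto
qed

lemma survival_cong:
  assumes "\<And>j t. j \<noteq> i \<Longrightarrow> 0 \<le> t \<Longrightarrow> t < T \<Longrightarrow> A i j t = B i j t" and "0 \<le> s" "t \<le> T"
  shows "survival A i s t = survival B i s t"
  unfolding survival_def
  by (intro arg_cong[where f=exp] arg_cong[where f=uminus] integral_spike[of "{T}"])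
     (use assms in \<open>auto simp: exit_rate_def intro!: sum.cong\<close>)

text \<open>The single instant \<open>T\<close> is a null set for the jump time, so agreement on the
  half-open interval suffices. For \<open>T = 0\<close> this asks nothing of the rates, which
  \<open>compiler_bounds\<close> relies on.\<close>

lemma path_integral_cong:
  assumes "\<And>i j t. j \<noteq> i \<Longrightarrow> 0 \<le> t \<Longrightarrow> t < T \<Longrightarrow> A i j t = B i j t" and "0 \<le> s"
  shows "path_integral A T m i s f = path_integral B T m i s f"
  using assms(2)
proof (induction m arbitrary: i s f)
  case 0
  then show ?case using survival_cong[of i T A B s T] assms(1) by simp
next
  case (Suc m)
  have *: "AE t in lborel. t \<noteq> T"
    by (rule AE_lborel_singleton)
  show ?case unfolding path_integral.simps
  proof (intro nn_integral_cong_AE, use * in eventually_elim)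
    fix t assume "t \<noteq> T"
    show "indicator {s..T} t * ennreal (survival A i s t) *
          (\<Sum>j\<in>- {i}. ennreal (A i j t) * path_integral A T m j t (\<lambda>l. f ((i, t - s) # l))) =
          indicator {s..T} t * ennreal (survival B i s t) *
          (\<Sum>j\<in>- {i}. ennreal (B i j t) * path_integral B T m j t (\<lambda>l. f ((i, t - s) # l)))"
    proof (cases "t \<in> {s..T}")
      case True
      then have t: "0 \<le> t" "t < T" using \<open>t \<noteq> T\<close> Suc.prems by auto
      have "survival A i s t = survival B i s t"
        using survival_cong[of i T A B s t] assms(1) Suc.prems t by auto
      moreover have "(\<Sum>j\<in>- {i}. ennreal (A i j t) * path_integral A T m j t (\<lambda>l. f ((i, t - s) # l)))
          = (\<Sum>j\<in>- {i}. ennreal (B i j t) * path_integral B T m j t (\<lambda>l. f ((i, t - s) # l)))"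
        by (intro sum.cong refl arg_cong2[where f="(*)"] Suc.IH t(1) arg_cong[where f=ennreal] assms(1)) (use t in auto)
      ultimately show ?thesis by simp
    qed simp
  qed
qed

text \<open>\<open>E i\<close> stands for an antiderivative of the exit rate of \<open>i\<close>.
  Through it the survival probability is built from functions of a single time, which gives joint
  measurability in \<open>s\<close> and \<open>t\<close>.\<close>

locale jump_rates =
  fixes A :: "'q::finite \<Rightarrow> 'q \<Rightarrow> real \<Rightarrow> real" and T :: real and E :: "'q \<Rightarrow> real \<Rightarrow> real"
  assumes rate_measurable [measurable]: "A i j \<in> borel_measurable borel"
    and exponent_measurable [measurable]: "E i \<in> borel_measurable borel"
    and survival_eq: "0 \<le> s \<Longrightarrow> s \<le> t \<Longrightarrow> t \<le> T \<Longrightarrow> survival A i s t = exp (E i s - E i t)"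
begin

text \<open>The recursion prepends \<open>(i, t - s)\<close>, which depends on the integration
  variable. Generalizing jointly over a prefix \<open>pre\<close> and the start time lets the
  induction absorb that entry. The indicator confines \<open>s\<close> to where
  \<open>survival_eq\<close> holds.\<close>

lemma measurable_path_integral_pair:
  assumes f: "f \<in> borel_measurable path_algebra"
  shows "(\<lambda>(pre, s). indicator {0..T} s * path_integral A T m i s (\<lambda>l. f (pre @ l)))
           \<in> borel_measurable (path_algebra \<Otimes>\<^sub>M borel)"
proof (induction m arbitrary: i)
  case 0
  note [measurable] = f
  have [measurable]: "(\<lambda>x. fst x @ [(i, T - snd x)]) \<in> measurable (path_algebra \<Otimes>\<^sub>M borel) path_algebra"
    by (rule measurable_snoc) measurable
  have "(\<lambda>(pre, s). indicator {0..T} s * path_integral A T 0 i s (\<lambda>l. f (pre @ l))) =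
    (\<lambda>x. indicator {0..T} (snd x) * (ennreal (exp (E i (snd x) - E i T)) * f (fst x @ [(i, T - snd x)])))"
    by (auto simp: survival_eq indicator_def)
  then show ?case by (simp only:) measurable
next
  case (Suc m)
  note [measurable] = f
  define G where "G j x = indicator {0..T} (snd x) * path_integral A T m j (snd x) (\<lambda>l. f (fst x @ l))" for j x
  have [measurable]: "G j \<in> borel_measurable (path_algebra \<Otimes>\<^sub>M borel)" for j
    unfolding G_def[abs_def] using Suc[of j] by (simp add: case_prod_beta)
  have [measurable]: "(\<lambda>x. fst (fst x) @ [(i, snd x - snd (fst x))])
      \<in> measurable ((path_algebra \<Otimes>\<^sub>M borel) \<Otimes>\<^sub>M lborel) path_algebra"
    by (rule measurable_snoc) measurable
  \<comment> \<open>The condition that \<open>t\<close> lies in \<open>{s..T}\<close> is split into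
    one on \<open>t - s\<close> and one on \<open>t\<close>, each measurable in the pair.\<close>
  have "(\<lambda>(pre, s). indicator {0..T} s * path_integral A T (Suc m) i s (\<lambda>l. f (pre @ l))) =
    (\<lambda>x. \<integral>\<^sup>+ t. indicator {0..T} (snd x) * (indicator {0..} (t - snd x) * indicator {..T} t *
        ennreal (exp (E i (snd x) - E i t)) *
        (\<Sum>j\<in>-{i}. ennreal (A i j t) * G j (fst x @ [(i, t - snd x)], t))) \<partial>lborel)"
  proof (rule ext, clarify)
    fix pre :: "('q \<times> real) list" and s :: real
    have "indicator {0..T} s * path_integral A T (Suc m) i s (\<lambda>l. f (pre @ l)) =
      (if s \<in> {0..T} then path_integral A T (Suc m) i s (\<lambda>l. f (pre @ l)) else 0)"
      by (simp add: indicator_def)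
    also have "\<dots> = (\<integral>\<^sup>+ t. indicator {0..T} s * (indicator {0..} (t - s) * indicator {..T} t *
        ennreal (exp (E i s - E i t)) *
        (\<Sum>j\<in>-{i}. ennreal (A i j t) * G j (pre @ [(i, t - s)], t))) \<partial>lborel)"
      by (auto intro!: nn_integral_cong sum.cong simp: G_def survival_eq indicator_def)
    finally show "indicator {0..T} s * path_integral A T (Suc m) i s (\<lambda>l. f (pre @ l)) =
      (\<integral>\<^sup>+ t. indicator {0..T} (snd (pre, s)) * (indicator {0..} (t - snd (pre, s)) * indicator {..T} t *
        ennreal (exp (E i (snd (pre, s)) - E i t)) *
        (\<Sum>j\<in>-{i}. ennreal (A i j t) * G j (fst (pre, s) @ [(i, t - snd (pre, s))], t))) \<partial>lborel)"
      by simp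
  qed
  moreover have "\<dots> \<in> borel_measurable (path_algebra \<Otimes>\<^sub>M borel)"
    by measurable
  ultimately show ?case by (simp only:)
qed

lemma measurable_path_integral_Cons:
  assumes "f \<in> borel_measurable path_algebra"
  shows "(\<lambda>t. indicator {0..T} t * path_integral A T m j t (\<lambda>l. f ((i, t - s) # l))) \<in> borel_measurable borel"
proof -
  have [measurable]: "(\<lambda>t. [] @ [(i, t - s)]) \<in> measurable borel path_algebra"
    by (rule measurable_snoc) measurable
  have "(\<lambda>t. ([(i, t - s)], t)) \<in> measurable borel (path_algebra \<Otimes>\<^sub>M borel)"
    by (rule measurable_Pair) (use \<open>(\<lambda>t. [] @ [(i, t - s)]) \<in> _\<close> in simp_all)
  from measurable_compose[OF this measurable_path_integral_pair[OF assms]]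
  show ?thesis by simp
qed

lemma path_integral_Suc_eq:
  assumes "s \<in> {0..T}"
  shows "path_integral A T (Suc m) i s f =
    (\<integral>\<^sup>+ t. indicator {s..T} t * ennreal (exp (E i s - E i t)) *
        (\<Sum>j\<in>-{i}. ennreal (A i j t) * (indicator {0..T} t * path_integral A T m j t (\<lambda>l. f ((i, t - s) # l)))) \<partial>lborel)"
  using assms by (auto intro!: nn_integral_cong sum.cong simp: survival_eq indicator_def)

lemma measurable_Cons_path:
  assumes [measurable]: "f \<in> borel_measurable path_algebra"
  shows "(\<lambda>l. f (p # l)) \<in> borel_measurable path_algebra"
proof -
  have "(#) p \<in> measurable path_algebra path_algebra"
  proof (rule measurable_list_algebraI)
    fix Bs :: "('a \<times> real) set list"
    assume "set Bs \<subseteq> sets (count_space UNIV \<Otimes>\<^sub>M borel)"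
    then show "(#) p -` listset Bs \<inter> space path_algebra \<in> sets path_algebra"
      by (cases Bs; cases "p \<in> hd Bs") (auto simp: vimage_def listset_Cons_iff simp del: listset.simps(2))
  qed
  from measurable_compose[OF this assms] show ?thesis .
qed

text \<open>This and the next two lemmas, each shown by induction on the number of jumps, supply
  additivity, homogeneity and monotone convergence for the induction over measurable functions in
  \<open>nn_integral_realization_law\<close>.\<close>

lemma path_integral_add:
  assumes "f \<in> borel_measurable path_algebra" "g \<in> borel_measurable path_algebra" "s \<in> {0..T}"
  shows "path_integral A T m i s (\<lambda>l. f l + g l) = path_integral A T m i s f + path_integral A T m i s g"
  using assms
proof (induction m arbitrary: i s f g)
  case 0
  then show ?case by (simp add: distrib_left)
next
  case (Suc m)
  note [measurable] = measurable_path_integral_Cons[OF Suc.prems(1)] measurable_path_integral_Cons[OF Suc.prems(2)]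
  have "indicator {0..T} t * path_integral A T m j t (\<lambda>l. f ((i, t - s) # l) + g ((i, t - s) # l)) =
    indicator {0..T} t * path_integral A T m j t (\<lambda>l. f ((i, t - s) # l)) +
    indicator {0..T} t * path_integral A T m j t (\<lambda>l. g ((i, t - s) # l))" for j t
    using Suc.IH[OF measurable_Cons_path[OF Suc.prems(1)] measurable_Cons_path[OF Suc.prems(2)]]
    by (auto simp: indicator_def)
  then show ?case
    unfolding path_integral_Suc_eq[OF Suc.prems(3)]
    by (subst nn_integral_add[symmetric], measurable)
       (auto intro!: nn_integral_cong simp: distrib_left sum.distrib)
qed

lemma path_integral_cmult:
  assumes "f \<in> borel_measurable path_algebra" "s \<in> {0..T}"
  shows "path_integral A T m i s (\<lambda>l. c * f l) = c * path_integral A T m i s f"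
  using assms
proof (induction m arbitrary: i s f)
  case 0
  then show ?case by (simp add: ac_simps)
next
  case (Suc m)
  note [measurable] = measurable_path_integral_Cons[OF Suc.prems(1)]
  have "indicator {0..T} t * path_integral A T m j t (\<lambda>l. c * f ((i, t - s) # l)) =
    c * (indicator {0..T} t * path_integral A T m j t (\<lambda>l. f ((i, t - s) # l)))" for j t
    using Suc.IH[OF measurable_Cons_path[OF Suc.prems(1)]]
    by (auto simp: indicator_def)
  then show ?case
    unfolding path_integral_Suc_eq[OF Suc.prems(2)]
    by (subst nn_integral_cmult[symmetric], measurable)
       (auto intro!: nn_integral_cong simp: sum_distrib_left ac_simps)
qed

lemma path_integral_SUP:
  assumes "\<And>n. f n \<in> borel_measurable path_algebra" "incseq f" "s \<in> {0..T}"
  shows "path_integral A T m i s (\<lambda>l. SUP n. f n l) = (SUP n. path_integral A T m i s (f n))"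
  using assms
proof (induction m arbitrary: i s f)
  case 0
  show ?case unfolding path_integral.simps by (rule SUP_mult_left_ennreal)
next
  case (Suc m)
  note [measurable] = measurable_path_integral_Cons[OF Suc.prems(1)]
  have le: "f n l \<le> f n' l" if "n \<le> n'" for n n' l
    using incseqD[OF Suc.prems(2) that] by (simp add: le_fun_def)
  have inc: "incseq (\<lambda>n l. f n (p # l))" for p
    by (intro monoI le_funI le)
  have "indicator {0..T} t * path_integral A T m j t (\<lambda>l. SUP n. f n ((i, t - s) # l)) =
    (SUP n. indicator {0..T} t * path_integral A T m j t (\<lambda>l. f n ((i, t - s) # l)))" for j t
    using Suc.IH[of "\<lambda>n l. f n ((i, t - s) # l)" t j, OF measurable_Cons_path[OF Suc.prems(1)] inc]
    by (auto simp: indicator_def)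
  then show ?case
    unfolding path_integral_Suc_eq[OF Suc.prems(3)]
    apply (subst nn_integral_monotone_convergence_SUP[symmetric])
    subgoal by (intro monoI le_funI mult_left_mono sum_mono path_integral_mono le) auto
    subgoal by measurable
    subgoal
      apply (intro nn_integral_cong)
      apply (simp only: SUP_mult_left_ennreal)
      apply (subst ennreal_SUP_sum[symmetric])
      subgoal by (intro monoI mult_left_mono path_integral_mono le) auto
      apply (simp only: SUP_mult_left_ennreal)
      done
    done
qed

end

section \<open>Path expectations and the law of the realization\<close>

lemma sets_realization_law: "sets (realization_law p A T) = sets path_algebra"
  by (simp add: realization_law_def sets_list_algebra)

lemma space_realization_law [simp]: "space (realization_law p A T) = UNIV"
  by (simp add: realization_law_def)

context jump_rates
begin

lemma path_integral_zero: "path_integral A T m i s (\<lambda>_. 0) = 0"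
  by (induction m arbitrary: i s) simp_all

text \<open>The contribution of paths with at most \<open>m\<close> jumps. Bounds are proved for it
  by induction on \<open>m\<close> and then passed to the limit, so nothing has to be known
  beforehand about the number of jumps.\<close>

definition partial_integral :: "nat \<Rightarrow> 'q \<Rightarrow> real \<Rightarrow> (('q \<times> real) list \<Rightarrow> ennreal) \<Rightarrow> ennreal" where
  "partial_integral m i s f = (\<Sum>k\<le>m. path_integral A T k i s f)"

lemma measurable_partial_integral_Cons:
  assumes "f \<in> borel_measurable path_algebra"
  shows "(\<lambda>t. indicator {0..T} t * partial_integral m j t (\<lambda>l. f ((i, t - s) # l))) \<in> borel_measurable borel"
proof -
  note [measurable] = measurable_path_integral_Cons[OF assms]
  show ?thesis unfolding partial_integral_def sum_distrib_left by measurable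
qed

lemma partial_integral_0: "partial_integral 0 i s f = ennreal (survival A i s T) * f [(i, T - s)]"
  by (simp add: partial_integral_def)

text \<open>Conditioning on the first jump: either none occurs before \<open>T\<close>, or at most
  \<open>m\<close> more follow it. The second case exchanges the sum over jump counts with the
  integral over the jump time.\<close>

lemma partial_integral_Suc:
  assumes f: "f \<in> borel_measurable path_algebra" and s: "s \<in> {0..T}"
  shows "partial_integral (Suc m) i s f = ennreal (survival A i s T) * f [(i, T - s)] +
    (\<integral>\<^sup>+ t. indicator {s..T} t * (ennreal (exp (E i s - E i t)) *
        (\<Sum>j\<in>-{i}. ennreal (A i j t) * partial_integral m j t (\<lambda>l. f ((i, t - s) # l)))) \<partial>lborel)"
proof -
  note [measurable] = measurable_path_integral_Cons[OF f]
  have "partial_integral (Suc m) i s f = path_integral A T 0 i s f + (\<Sum>k\<le>m. path_integral A T (Suc k) i s f)"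
    unfolding partial_integral_def by (rule sum.atMost_Suc_shift)
  also have "(\<Sum>k\<le>m. path_integral A T (Suc k) i s f) = (\<integral>\<^sup>+ t. (\<Sum>k\<le>m. indicator {s..T} t * ennreal (exp (E i s - E i t)) *
        (\<Sum>j\<in>-{i}. ennreal (A i j t) * (indicator {0..T} t * path_integral A T k j t (\<lambda>l. f ((i, t - s) # l))))) \<partial>lborel)"
    unfolding path_integral_Suc_eq[OF s] by (rule nn_integral_sum[symmetric]) measurable
  also have "\<dots> = (\<integral>\<^sup>+ t. indicator {s..T} t * (ennreal (exp (E i s - E i t)) *
        (\<Sum>j\<in>-{i}. ennreal (A i j t) * partial_integral m j t (\<lambda>l. f ((i, t - s) # l)))) \<partial>lborel)"
  proof (rule nn_integral_cong)
    fix t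
    show "(\<Sum>k\<le>m. indicator {s..T} t * ennreal (exp (E i s - E i t)) *
        (\<Sum>j\<in>-{i}. ennreal (A i j t) * (indicator {0..T} t * path_integral A T k j t (\<lambda>l. f ((i, t - s) # l))))) =
      indicator {s..T} t * (ennreal (exp (E i s - E i t)) *
        (\<Sum>j\<in>-{i}. ennreal (A i j t) * partial_integral m j t (\<lambda>l. f ((i, t - s) # l))))"
    proof (cases "t \<in> {s..T}")
      case True
      with s have "t \<in> {0..T}" by auto
      have "(\<Sum>k\<le>m. \<Sum>j\<in>-{i}. ennreal (A i j t) * path_integral A T k j t (\<lambda>l. f ((i, t - s) # l))) =
        (\<Sum>j\<in>-{i}. ennreal (A i j t) * partial_integral m j t (\<lambda>l. f ((i, t - s) # l)))"
        unfolding partial_integral_def sum_distrib_left by (rule sum.swap)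
      then show ?thesis
        using True \<open>t \<in> {0..T}\<close> by (simp add: sum_distrib_left[symmetric])
    qed simp
  qed
  finally show ?thesis by simp
qed

text \<open>This turns out to be the integral against \<open>realization_law\<close>, but it is
  needed first to show that the set function there is countably additive.\<close>

definition path_expectation :: "('q \<Rightarrow> real) \<Rightarrow> (('q \<times> real) list \<Rightarrow> ennreal) \<Rightarrow> ennreal" where
  "path_expectation p f = (\<Sum>i\<in>UNIV. ennreal (p i) * (\<Sum>m. path_integral A T m i 0 f))"

lemma path_expectation_le:
  assumes "\<And>i m. partial_integral m i 0 f \<le> c" "\<And>i. 0 \<le> p i" "(\<Sum>i\<in>UNIV. p i) = 1"
  shows "path_expectation p f \<le> c"
proof -
  have "path_expectation p f \<le> (\<Sum>i\<in>UNIV. ennreal (p i) * c)"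
    unfolding path_expectation_def
  proof (intro sum_mono mult_left_mono)
    fix i
    show "(\<Sum>m. path_integral A T m i 0 f) \<le> c"
      unfolding suminf_eq_SUP
    proof (rule SUP_least)
      fix n
      have "(\<Sum>k<n. path_integral A T k i 0 f) \<le> partial_integral n i 0 f"
        unfolding partial_integral_def by (intro sum_mono2) auto
      with assms(1)[of n i] show "(\<Sum>k<n. path_integral A T k i 0 f) \<le> c" by (rule order.trans[rotated])
    qed
  qed simp
  also have "\<dots> = ennreal (\<Sum>i\<in>UNIV. p i) * c"
    using assms(2) by (simp add: sum_distrib_right[symmetric] sum_ennreal)
  finally show ?thesis using assms(3) by simp
qed

text \<open>A lower bound on a truncated expectation can hold only up to the paths with more jumps;
  \<open>r m\<close> accounts for these and vanishes in the limit.\<close>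

lemma path_expectation_ge:
  assumes "\<And>i m. ennreal (c i) \<le> partial_integral m i 0 f + ennreal (r m)" "\<And>i. 0 \<le> p i" "\<And>i. 0 \<le> c i"
    "r \<longlonglongrightarrow> 0"
  shows "ennreal (\<Sum>i\<in>UNIV. p i * c i) \<le> path_expectation p f"
proof -
  have *: "ennreal (c i) \<le> (\<Sum>m. path_integral A T m i 0 f)" for i
  proof -
    have "ennreal (c i) \<le> (\<Sum>m. path_integral A T m i 0 f) + ennreal (r n)" for n
    proof -
      have "partial_integral n i 0 f \<le> (\<Sum>m. path_integral A T m i 0 f)"
        unfolding partial_integral_def by (intro sum_le_suminf) auto
      then show ?thesis using assms(1)[of i n] by (meson add_right_mono order.trans)
    qed
    moreover have "(\<lambda>n. (\<Sum>m. path_integral A T m i 0 f) + ennreal (r n))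
        \<longlonglongrightarrow> (\<Sum>m. path_integral A T m i 0 f) + ennreal 0"
      by (intro tendsto_intros assms(4))
    ultimately show ?thesis
      using LIMSEQ_le_const[of _ _ "ennreal (c i)"] by fastforce
  qed
  have "ennreal (\<Sum>i\<in>UNIV. p i * c i) = (\<Sum>i\<in>UNIV. ennreal (p i) * ennreal (c i))"
    using assms(2,3) by (simp add: sum_ennreal[symmetric] ennreal_mult)
  also have "\<dots> \<le> path_expectation p f"
    unfolding path_expectation_def by (intro sum_mono mult_left_mono *) simp
  finally show ?thesis .
qed

context
  assumes T_nonneg: "0 \<le> T"
begin

lemma zero_in_T: "0 \<in> {0..T}" using T_nonneg by simp

lemma path_expectation_add:
  assumes "f \<in> borel_measurable path_algebra" "g \<in> borel_measurable path_algebra"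
  shows "path_expectation p (\<lambda>l. f l + g l) = path_expectation p f + path_expectation p g"
  by (simp add: path_expectation_def path_integral_add[OF assms zero_in_T] suminf_add[symmetric]
      distrib_left sum.distrib)

lemma path_expectation_cmult:
  assumes "f \<in> borel_measurable path_algebra"
  shows "path_expectation p (\<lambda>l. c * f l) = c * path_expectation p f"
  by (simp add: path_expectation_def path_integral_cmult[OF assms zero_in_T] sum_distrib_left ac_simps)

lemma path_expectation_sum:
  assumes "\<And>k. k \<in> I \<Longrightarrow> f k \<in> borel_measurable path_algebra"
  shows "path_expectation p (\<lambda>l. \<Sum>k\<in>I. f k l) = (\<Sum>k\<in>I. path_expectation p (f k))"
  using assms
proof (induction I rule: infinite_finite_induct)
  case (insert k I)
  then show ?case by (simp add: path_expectation_add)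
qed (simp_all add: path_expectation_def path_integral_zero)

lemma path_expectation_SUP:
  assumes f: "\<And>n. f n \<in> borel_measurable path_algebra" "incseq f"
  shows "path_expectation p (\<lambda>l. SUP n. f n l) = (SUP n. path_expectation p (f n))"
proof -
  have inc: "incseq (\<lambda>n. path_integral A T m i s (f n))" for m i s
    by (intro monoI path_integral_mono le_funD[OF incseqD[OF f(2)]])
  have "(\<Sum>m. path_integral A T m i 0 (\<lambda>l. SUP n. f n l)) = (SUP n. \<Sum>m. path_integral A T m i 0 (f n))" for i
    unfolding path_integral_SUP[OF f zero_in_T] by (rule ennreal_suminf_SUP_eq[OF inc])
  then show ?thesis
    unfolding path_expectation_def
    by (subst ennreal_SUP_sum)
       (auto simp: SUP_mult_left_ennreal intro!: monoI mult_left_mono suminf_le incseqD[OF inc])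
qed

text \<open>The set function given to \<open>measure_of\<close> is the value of the measure once it
  is countably additive. For that, the indicator of a disjoint union is an increasing supremum of
  finite sums, and \<open>path_expectation_SUP\<close> applies.\<close>

lemma emeasure_realization_law:
  assumes "X \<in> sets path_algebra"
  shows "emeasure (realization_law p A T) X = path_expectation p (indicator X)"
  unfolding path_expectation_def
proof (rule emeasure_measure_of[OF realization_law_def])
  show "positive (sets (realization_law p A T))
     (\<lambda>S. \<Sum>i\<in>UNIV. ennreal (p i) * (\<Sum>m. path_integral A T m i 0 (indicator S)))"
    using path_integral_zero by (simp add: positive_def indicator_def[abs_def])
  show "countably_additive (sets (realization_law p A T))
     (\<lambda>S. \<Sum>i\<in>UNIV. ennreal (p i) * (\<Sum>m. path_integral A T m i 0 (indicator S)))"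
    unfolding path_expectation_def[symmetric]
  proof (rule countably_additiveI)
    fix F :: "nat \<Rightarrow> ('q \<times> real) list set"
    assume F: "range F \<subseteq> sets (realization_law p A T)" "disjoint_family F"
    then have [measurable]: "F n \<in> sets path_algebra" for n
      by (auto simp: sets_realization_law)
    have "(\<Sum>n. path_expectation p (indicator (F n))) = (SUP n. path_expectation p (\<lambda>l. \<Sum>k<n. indicator (F k) l))"
      unfolding suminf_eq_SUP by (subst path_expectation_sum) auto
    also have "\<dots> = path_expectation p (\<lambda>l. SUP n. \<Sum>k<n. indicator (F k) l)"
      by (rule path_expectation_SUP[symmetric])
         (auto intro!: monoI le_funI sum_mono2)
    also have "(\<lambda>l. SUP n. \<Sum>k<n. indicator (F k) l :: ennreal) = indicator (\<Union>n. F n)"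
      unfolding suminf_eq_SUP[symmetric] by (rule ext) (rule suminf_indicator[OF F(2)])
    finally show "(\<Sum>n. path_expectation p (indicator (F n))) = path_expectation p (indicator (\<Union>n. F n))" .
  qed
qed (use assms sets_realization_law in auto)

lemma nn_integral_realization_law:
  assumes "f \<in> borel_measurable path_algebra"
  shows "(\<integral>\<^sup>+ l. f l \<partial>realization_law p A T) = path_expectation p f"
proof -
  have meas: "g \<in> borel_measurable (realization_law p A T) \<longleftrightarrow> g \<in> borel_measurable path_algebra" for g :: "_ \<Rightarrow> ennreal"
    by (simp add: sets_realization_law cong: measurable_cong_sets)
  show ?thesis
    using assms
  proof (induction rule: borel_measurable_induct)
    case (cong f g)
    then show ?case by (simp add: ext[of f g])
  next
    case (set X)
    then show ?case
      by (simp add: emeasure_realization_law nn_integral_indicator sets_realization_law)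
  next
    case (mult u c)
    then show ?case by (simp add: nn_integral_cmult meas path_expectation_cmult)
  next
    case (add u v)
    then show ?case by (simp add: nn_integral_add meas path_expectation_add)
  next
    case (seq U)
    then show ?case
      by (simp add: nn_integral_monotone_convergence_SUP meas path_expectation_SUP[symmetric] SUP_apply[abs_def])
  qed
qed

end

end

section \<open>Linear differential equations with non-continuous coefficients\<close>

text \<open>The mean value inequality with a varying majorant. The error bounds below integrate a
  rate through it; derivatives are relative to \<open>S\<close> because the data live only on a
  closed interval.\<close>

lemma norm_diff_le_of_vector_derivative:
  fixes f :: "real \<Rightarrow> 'a::real_normed_vector"
  assumes "a \<le> b" and S: "{a..b} \<subseteq> S"
    and f': "\<And>x. x \<in> {a..b} \<Longrightarrow> (f has_vector_derivative f' x) (at x within S)"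
    and \<phi>': "\<And>x. x \<in> {a..b} \<Longrightarrow> (\<phi> has_real_derivative \<phi>' x) (at x within S)"
    and le: "\<And>x. x \<in> {a..b} \<Longrightarrow> norm (f' x) \<le> \<phi>' x"
  shows "norm (f b - f a) \<le> \<phi> b - \<phi> a"
proof (cases "a = b")
  case False
  have f: "(f has_vector_derivative f' x) (at x within {a..b})" if "x \<in> {a..b}" for x
    using f'[OF that] S by (rule has_vector_derivative_within_subset)
  have \<phi>: "(\<phi> has_vector_derivative \<phi>' x) (at x within {a..b})" if "x \<in> {a..b}" for x
    using has_vector_derivative_within_subset[OF \<phi>'[OF that, unfolded has_real_derivative_iff_has_vector_derivative] S] .
  show ?thesis
  proof (rule differentiable_bound_general)
    show "a < b" using False assms(1) by simp
    show "continuous_on {a..b} f" "continuous_on {a..b} \<phi>"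
      using f \<phi> by (meson continuous_on_vector_derivative)+
    fix x assume x: "a < x" "x < b"
    then have at: "at x within {a..b} = at x" by (simp add: at_within_Icc_at)
    show "(f has_vector_derivative f' x) (at x)" "(\<phi> has_vector_derivative \<phi>' x) (at x)"
      using f[of x] \<phi>[of x] x unfolding at by auto
    show "norm (f' x) \<le> \<phi>' x" using le x by simp
  qed
qed simp

text \<open>The terms \<open>f n\<close> are the Picard iterates' increments; the hypotheses cover the Dyson series
  as well as the exponential series.\<close>

lemma linear_ode_series:
  fixes f :: "nat \<Rightarrow> real \<Rightarrow> 'v::banach" and N :: "real \<Rightarrow> 'v \<Rightarrow> 'v"
  assumes T: "0 \<le> T" and M: "0 \<le> M"
    and lin: "\<And>t. t \<in> {0..T} \<Longrightarrow> linear (N t)"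
    and bound: "\<And>t y. t \<in> {0..T} \<Longrightarrow> norm (N t y) \<le> M * norm y"
    and f_0: "\<And>t. t \<in> {0..T} \<Longrightarrow> f 0 t = x"
    and f_Suc_0: "\<And>n. f (Suc n) 0 = 0"
    and f_Suc: "\<And>n t. t \<in> {0..T} \<Longrightarrow> (f (Suc n) has_vector_derivative N t (f n t)) (at t within {0..T})"
  shows "t \<in> {0..T} \<Longrightarrow> (\<lambda>n. f n t) sums (\<Sum>n. f n t)"
    and "(\<Sum>n. f n 0) = x"
    and "t \<in> {0..T} \<Longrightarrow> ((\<lambda>t. \<Sum>n. f n t) has_vector_derivative N t (\<Sum>n. f n t)) (at t within {0..T})"
proof -
  \<comment> \<open>Integrating the bound on one term gives the bound on the next, as in the
    exponential series.\<close>
  have le: "norm (f n t) \<le> norm x * (M * t) ^ n / fact n" if "t \<in> {0..T}" for n t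
    using that
  proof (induction n arbitrary: t)
    case 0
    then show ?case using f_0 by simp
  next
    case (Suc n)
    have "norm (f (Suc n) t - f (Suc n) 0) \<le> norm x * (M * t) ^ Suc n / fact (Suc n) - norm x * (M * 0) ^ Suc n / fact (Suc n)"
    proof (rule norm_diff_le_of_vector_derivative)
      fix s assume s: "s \<in> {0..t}"
      with Suc.prems have sT: "s \<in> {0..T}" by auto
      show "(f (Suc n) has_vector_derivative N s (f n s)) (at s within {0..T})"
        by (rule f_Suc[OF sT])
      show "((\<lambda>t. norm x * (M * t) ^ Suc n / fact (Suc n)) has_real_derivative
          M * (norm x * (M * s) ^ n / fact n)) (at s within {0..T})"
        by (rule derivative_eq_intros refl | simp)+
      show "norm (N s (f n s)) \<le> M * (norm x * (M * s) ^ n / fact n)"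
        using bound[OF sT, of "f n s"] mult_left_mono[OF Suc.IH[OF sT] M] by linarith
    qed (use Suc.prems in auto)
    then show ?case using f_Suc_0 by simp
  qed
  have le': "norm (f n t) \<le> norm x * ((M * T) ^ n / fact n)" if "t \<in> {0..T}" for n t
  proof -
    have "norm (f n t) \<le> norm x * (M * t) ^ n / fact n" by (rule le[OF that])
    also have "\<dots> \<le> norm x * (M * T) ^ n / fact n"
      using that M by (intro divide_right_mono mult_left_mono power_mono) auto
    finally show ?thesis by simp
  qed
  have sm: "summable (\<lambda>n. norm x * ((M * T) ^ n / fact n))"
    using summable_exp[of "M * T"] by (intro summable_mult) (simp add: divide_inverse mult.commute)
  have smf: "summable (\<lambda>n. f n t)" if "t \<in> {0..T}" for t
    using summable_comparison_test'[OF sm, of 0 "\<lambda>n. f n t"] le'[OF that] by simp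
  show sums: "(\<lambda>n. f n t) sums (\<Sum>n. f n t)" if "t \<in> {0..T}" for t
    using smf[OF that] by (rule summable_sums)
  have 0: "(0::real) \<in> {0..T}" using T by simp
  have f00: "(\<lambda>n. f n 0) = (\<lambda>n. if n = 0 then x else 0)"
  proof
    fix n show "f n 0 = (if n = 0 then x else 0)" using f_Suc_0 f_0[OF 0] by (cases n) auto
  qed
  show "(\<Sum>n. f n 0) = x" unfolding f00 using sums_single[of 0 "\<lambda>_. x"] by (simp add: sums_iff)
  have ul: "uniform_limit {0..T} (\<lambda>n t. \<Sum>i<n. f i t) (\<lambda>t. \<Sum>n. f n t) sequentially"
    by (rule Weierstrass_m_test[OF le' sm])
  \<comment> \<open>The derivative of a term is \<open>N\<close> applied to the preceding term, and
    the zeroth term is constant, so the differentiated partial sum lags by one index; hence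
    \<open>Suc n0\<close> below.\<close>
  define f' where "f' n t h = h *\<^sub>R (case n of 0 \<Rightarrow> 0 | Suc m \<Rightarrow> N t (f m t))" for n t and h :: real
  have "\<exists>g. \<forall>t\<in>{0..T}. (\<lambda>n. f n t) sums (g t) \<and>
      (g has_derivative (\<lambda>h. h *\<^sub>R N t (\<Sum>n. f n t))) (at t within {0..T})"
  proof (rule has_derivative_series[where f=f and f'=f' and x=0 and l="\<Sum>n. f n 0"])
    show "(f n has_derivative f' n t) (at t within {0..T})" if "t \<in> {0..T}" for n t
    proof (cases n)
      case 0
      have "(f 0 has_derivative (\<lambda>_. 0)) (at t within {0..T})"
        by (rule has_derivative_transform[OF that _ has_derivative_const[of x]]) (simp add: f_0)
      then show ?thesis by (simp add: 0 f'_def[abs_def])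
    next
      case (Suc m)
      then show ?thesis using f_Suc[OF that, of m] by (simp add: f'_def[abs_def] has_vector_derivative_def)
    qed
    show "(\<lambda>n. f n 0) sums (\<Sum>n. f n 0)" by (rule sums[OF 0])
    \<comment> \<open>Below, the tolerance is divided by \<open>M + 1\<close>, since
      \<open>M\<close> may be zero.\<close>
    fix e :: real assume e: "e > 0"
    have "\<forall>\<^sub>F n in sequentially. \<forall>t\<in>{0..T}. dist (\<Sum>i<n. f i t) (\<Sum>n. f n t) < e / (M + 1)"
      using ul e M unfolding uniform_limit_iff by simp
    then obtain n0 where n0: "\<And>n t. n \<ge> n0 \<Longrightarrow> t \<in> {0..T} \<Longrightarrow> dist (\<Sum>i<n. f i t) (\<Sum>n. f n t) < e / (M + 1)"
      unfolding eventually_sequentially by blast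
    show "\<forall>\<^sub>F n in sequentially. \<forall>t\<in>{0..T}. \<forall>h. norm (sum (\<lambda>i. f' i t h) {..<n} - h *\<^sub>R N t (\<Sum>n. f n t)) \<le> e * norm h"
      unfolding eventually_sequentially
    proof (intro exI[of _ "Suc n0"] allI impI ballI)
      fix n t and h :: real assume n: "n \<ge> Suc n0" and t: "t \<in> {0..T}"
      then obtain m where m: "n = Suc m" "m \<ge> n0" by (cases n) auto
      have "sum (\<lambda>i. f' i t h) {..<n} = h *\<^sub>R N t (\<Sum>i<m. f i t)"
        unfolding m(1) sum.lessThan_Suc_shift f'_def
        by (simp add: scaleR_sum_right linear_sum[OF lin[OF t]])
      then have "sum (\<lambda>i. f' i t h) {..<n} - h *\<^sub>R N t (\<Sum>n. f n t) = h *\<^sub>R N t ((\<Sum>i<m. f i t) - (\<Sum>n. f n t))"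
        by (simp add: linear_diff[OF lin[OF t]] scaleR_diff_right)
      also have "norm \<dots> \<le> norm h * (M * (e / (M + 1)))"
        unfolding norm_scaleR real_norm_def
        by (intro mult_left_mono order.trans[OF bound[OF t] mult_left_mono[OF less_imp_le M]])
           (use n0[OF m(2) t] in \<open>simp_all add: dist_norm\<close>)
      also have "\<dots> \<le> norm h * e"
        using M e by (intro mult_left_mono) (auto simp: field_simps)
      finally show "norm (sum (\<lambda>i. f' i t h) {..<n} - h *\<^sub>R N t (\<Sum>n. f n t)) \<le> e * norm h"
        by (simp add: mult.commute)
    qed
  qed (use 0 in auto)
  then obtain g where g: "\<And>t. t \<in> {0..T} \<Longrightarrow> (\<lambda>n. f n t) sums (g t)"
    "\<And>t. t \<in> {0..T} \<Longrightarrow> (g has_derivative (\<lambda>h. h *\<^sub>R N t (\<Sum>n. f n t))) (at t within {0..T})" by blast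
  show "((\<lambda>t. \<Sum>n. f n t) has_vector_derivative N t (\<Sum>n. f n t)) (at t within {0..T})" if "t \<in> {0..T}" for t
    unfolding has_vector_derivative_def
    by (rule has_derivative_transform[OF that _ g(2)[OF that]]) (use g(1) in \<open>simp add: sums_iff\<close>)
qed

text \<open>The factor \<open>c\<close> need not be continuous, so the fundamental theorem for continuous integrands
  does not apply; it is a derivative, which makes the integral differentiable at every point.\<close>

lemma integral_derivative_times_continuous:
  fixes c W :: "real \<Rightarrow> real" and g :: "real \<Rightarrow> 'v::euclidean_space"
  assumes W: "\<And>t. t \<in> {0..T} \<Longrightarrow> (W has_real_derivative c t) (at t within {0..T})"
    and B: "\<And>t. t \<in> {0..T} \<Longrightarrow> \<bar>c t\<bar> \<le> B"
    and g: "continuous_on {0..T} g" and t: "t \<in> {0..T}"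
  shows "(\<lambda>s. c s *\<^sub>R g s) integrable_on {0..T}"
    and "((\<lambda>t. integral {0..t} (\<lambda>s. c s *\<^sub>R g s)) has_vector_derivative c t *\<^sub>R g t) (at t within {0..T})"
proof -
  have B0: "0 \<le> B" using B[OF t] by linarith
  have cint: "(c has_integral (W b - W a)) {a..b}" if "a \<le> b" "{a..b} \<subseteq> {0..T}" for a b
  proof (rule fundamental_theorem_of_calculus[OF that(1)])
    fix x assume "x \<in> {a..b}"
    then show "(W has_vector_derivative c x) (at x within {a..b})"
      using has_vector_derivative_within_subset[OF W[unfolded has_real_derivative_iff_has_vector_derivative] that(2)]
        that(2) by auto
  qed
  \<comment> \<open>Being a derivative, \<open>c\<close> is gauge integrable and so measurable;
    boundedness then makes its product with a continuous function absolutely integrable.\<close>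
  have c_meas: "c \<in> borel_measurable (lebesgue_on {0..T})"
    using cint[of 0 T] t by (intro integrable_imp_measurable) auto
  have int: "(\<lambda>s. c s *\<^sub>R h s) integrable_on {0..T}" if "continuous_on {0..T} h" for h :: "real \<Rightarrow> 'v"
  proof -
    have "(\<lambda>s. c s *\<^sub>R h s) absolutely_integrable_on {0..T}"
    proof (rule absolutely_integrable_bounded_measurable_product[OF _ c_meas, where h="\<lambda>a y. a *\<^sub>R y"])
      show "bilinear (\<lambda>(a::real) (y::'v). a *\<^sub>R y)"
        by (simp add: bilinear_conv_bounded_bilinear bounded_bilinear_scaleR)
      show "bounded (c ` {0..T})" by (auto simp: bounded_iff B intro!: exI[of _ B])
      show "h absolutely_integrable_on {0..T}" by (rule absolutely_integrable_continuous_real[OF that])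
    qed simp
    then show ?thesis by (rule set_lebesgue_integral_eq_integral(1))
  qed
  show "(\<lambda>s. c s *\<^sub>R g s) integrable_on {0..T}" by (rule int[OF g])
  define K where "K s = integral {0..s} (\<lambda>r. c r *\<^sub>R (g r - g t))" for s
  have int': "(\<lambda>r. c r *\<^sub>R (g r - g t)) integrable_on {0..T}"
    using g by (intro int continuous_intros)
  have K0: "(K has_derivative (\<lambda>_. 0)) (at t within {0..T})"
    unfolding has_derivative_within_alt
  proof (intro conjI allI impI)
    fix e :: real assume "e > 0"
    then obtain d where d: "d > 0" "\<And>r. r \<in> {0..T} \<Longrightarrow> dist r t < d \<Longrightarrow> dist (g r) (g t) < e / (B + 1)"
      using g t B0 unfolding continuous_on_iff by (metis divide_pos_pos add_nonneg_pos zero_less_one)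
    have *: "norm (K b - K a) \<le> e * (b - a)"
      if ab: "a \<le> b" "a \<in> {0..T}" "b \<in> {0..T}" and near: "\<And>r. r \<in> {a..b} \<Longrightarrow> dist r t < d" for a b
    proof -
      have "(\<lambda>r. c r *\<^sub>R (g r - g t)) integrable_on {0..b}" 
        using integrable_subinterval_real[OF int'] ab by auto
      then have eq: "K b - K a = integral {a..b} (\<lambda>r. c r *\<^sub>R (g r - g t))"
        unfolding K_def using Henstock_Kurzweil_Integration.integral_combine[of 0 a b "\<lambda>r. c r *\<^sub>R (g r - g t)"] ab by (auto simp: algebra_simps)
      have "norm (integral {a..b} (\<lambda>r. c r *\<^sub>R (g r - g t))) \<le> B * (e / (B + 1)) * measure lborel (cbox a b)"
      proof (rule has_integral_bound)
        show "0 \<le> B * (e / (B + 1))" using B0 \<open>e > 0\<close> by simp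
        show "((\<lambda>r. c r *\<^sub>R (g r - g t)) has_integral integral {a..b} (\<lambda>r. c r *\<^sub>R (g r - g t))) (cbox a b)"
          using integrable_subinterval_real[OF int', of a b] ab by (auto simp: integrable_integral)
        fix r assume "r \<in> cbox a b"
        then have 1: "\<bar>c r\<bar> \<le> B" and 2: "norm (g r - g t) \<le> e / (B + 1)"
          using B[of r] d(2)[of r] near[of r] ab by (auto simp: dist_norm less_imp_le)
        show "norm (c r *\<^sub>R (g r - g t)) \<le> B * (e / (B + 1))"
          unfolding norm_scaleR by (rule mult_mono[OF 1 2 B0 norm_ge_zero])
      qed
      also have "\<dots> \<le> e * (b - a)"
        using B0 \<open>e > 0\<close> ab by (auto intro!: mult_right_mono simp: field_simps)
      finally show ?thesis unfolding eq .
    qed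
    show "\<exists>d>0. \<forall>y\<in>{0..T}. norm (y - t) < d \<longrightarrow> norm (K y - K t - 0) \<le> e * norm (y - t)"
    proof (intro exI[of _ d] conjI ballI impI d(1))
      fix y assume y: "y \<in> {0..T}" "norm (y - t) < d"
      show "norm (K y - K t - 0) \<le> e * norm (y - t)"
      proof (cases "y \<le> t")
        case True
        then show ?thesis using *[of y t] y t by (auto simp: dist_real_def norm_minus_commute)
      next
        case False
        then show ?thesis using *[of t y] y t by (auto simp: dist_real_def)
      qed
    qed
  qed simp
  have eq: "integral {0..s} (\<lambda>r. c r *\<^sub>R g r) = K s + (W s - W 0) *\<^sub>R g t" if "s \<in> {0..T}" for s
  proof -
    have "((\<lambda>r. c r *\<^sub>R g t) has_integral (W s - W 0) *\<^sub>R g t) {0..s}"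
      using cint[of 0 s] that by (intro has_integral_scaleR_left) auto
    moreover have "((\<lambda>r. c r *\<^sub>R (g r - g t)) has_integral K s) {0..s}"
      unfolding K_def using integrable_subinterval_real[OF int', of 0 s] that by (auto simp: integrable_integral)
    ultimately have "((\<lambda>r. c r *\<^sub>R (g r - g t) + c r *\<^sub>R g t) has_integral K s + (W s - W 0) *\<^sub>R g t) {0..s}"
      by (rule has_integral_add[rotated])
    then show ?thesis by (simp add: scaleR_diff_right integral_unique)
  qed
  have "((\<lambda>s. W s - W 0) has_vector_derivative c t) (at t within {0..T})"
    using W[OF t] by (simp add: has_real_derivative_iff_has_vector_derivative has_vector_derivative_diff_const)
  from bounded_linear.has_vector_derivative[OF bounded_linear_scaleR_left this]
  have W': "((\<lambda>s. (W s - W 0) *\<^sub>R g t) has_vector_derivative c t *\<^sub>R g t) (at t within {0..T})" .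
  have "(K has_vector_derivative 0) (at t within {0..T})"
    using K0 by (simp add: has_vector_derivative_def)
  from has_vector_derivative_add[OF this W']
  have "((\<lambda>s. K s + (W s - W 0) *\<^sub>R g t) has_vector_derivative c t *\<^sub>R g t) (at t within {0..T})" by simp
  then show "((\<lambda>t. integral {0..t} (\<lambda>s. c s *\<^sub>R g s)) has_vector_derivative c t *\<^sub>R g t) (at t within {0..T})"
    by (rule has_vector_derivative_transform[OF t, rotated]) (simp add: eq)
qed

text \<open>Picard iteration for scalar coefficients that are merely bounded derivatives. With
  constant linear maps \<open>K k\<close> and all time dependence in \<open>c k\<close>, each
  iterate falls under \<open>integral_derivative_times_continuous\<close>.\<close>

lemma linear_ode_exists:
  fixes K :: "'k \<Rightarrow> 'v \<Rightarrow> 'v::euclidean_space" and c W :: "'k \<Rightarrow> real \<Rightarrow> real"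
  assumes T: "0 \<le> T" and fin: "finite I" and lin: "\<And>k. k \<in> I \<Longrightarrow> linear (K k)"
    and W: "\<And>k t. k \<in> I \<Longrightarrow> t \<in> {0..T} \<Longrightarrow> (W k has_real_derivative c k t) (at t within {0..T})"
    and B: "\<And>k t. k \<in> I \<Longrightarrow> t \<in> {0..T} \<Longrightarrow> \<bar>c k t\<bar> \<le> B"
  shows "\<exists>F. F 0 = x \<and>
    (\<forall>t\<in>{0..T}. (F has_vector_derivative (\<Sum>k\<in>I. c k t *\<^sub>R K k (F t))) (at t within {0..T}))"
proof -
  define N where "N t y = (\<Sum>k\<in>I. c k t *\<^sub>R K k y)" for t y
  define f where "f = rec_nat (\<lambda>_. x) (\<lambda>_ g t. integral {0..t} (\<lambda>s. N s (g s)))"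
  have f_simps: "f 0 = (\<lambda>_. x)" "f (Suc n) = (\<lambda>t. integral {0..t} (\<lambda>s. N s (f n s)))" for n
    by (simp_all add: f_def)
  have deriv: "((\<lambda>t. integral {0..t} (\<lambda>s. N s (g s))) has_vector_derivative N t (g t)) (at t within {0..T})"
    if g: "continuous_on {0..T} g" and t: "t \<in> {0..T}" for g t
  proof -
    have cK: "continuous_on {0..T} (\<lambda>s. K k (g s))" if "k \<in> I" for k
      using linear_continuous_on_compose[OF g lin[OF that]] .
    have int: "(\<lambda>s. c k s *\<^sub>R K k (g s)) integrable_on {0..s}" if "k \<in> I" "s \<in> {0..T}" for k s
      using integrable_subinterval_real[OF integral_derivative_times_continuous(1)[OF W B cK t]] that by auto
    have "((\<lambda>t. \<Sum>k\<in>I. integral {0..t} (\<lambda>s. c k s *\<^sub>R K k (g s))) has_vector_derivative N t (g t)) (at t within {0..T})"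
      unfolding N_def
      by (intro has_vector_derivative_sum integral_derivative_times_continuous(2)[OF W B cK t]) auto
    then show ?thesis
      by (rule has_vector_derivative_transform[OF t, rotated]) (simp add: N_def int fin integral_sum)
  qed
  have cont: "continuous_on {0..T} (f n)" for n
  proof (induction n)
    case (Suc n)
    show ?case
      unfolding f_simps by (rule continuous_on_vector_derivative[OF deriv[OF Suc]])
  qed (simp add: f_simps)
  have "\<exists>M\<ge>0. \<forall>y. norm (K k y) \<le> M * norm y" if "k \<in> I" for k
    using bounded_linear.nonneg_bounded[of "K k"] lin[OF that] by (auto simp: linear_conv_bounded_linear mult.commute)
  then obtain M where M: "\<And>k. k \<in> I \<Longrightarrow> 0 \<le> M k" "\<And>k y. k \<in> I \<Longrightarrow> norm (K k y) \<le> M k * norm y"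
    by metis
  have B0: "0 \<le> B" if "k \<in> I" for k using B[OF that, of 0] T by auto
  have N_bound: "norm (N t y) \<le> (\<Sum>k\<in>I. B * M k) * norm y" if "t \<in> {0..T}" for t y
  proof -
    have "norm (N t y) \<le> (\<Sum>k\<in>I. norm (c k t *\<^sub>R K k y))" unfolding N_def by (rule norm_sum)
    also have "\<dots> \<le> (\<Sum>k\<in>I. B * (M k * norm y))"
      using B that M B0 by (intro sum_mono) (auto intro!: mult_mono)
    finally show ?thesis by (simp add: sum_distrib_right mult.assoc)
  qed
  have N_lin: "linear (N t)" for t
    unfolding N_def[abs_def] using lin
    by (intro linear_compose_sum ballI linear_compose_scale_right) auto
  note series = linear_ode_series[of T "\<Sum>k\<in>I. B * M k" N f x, OF T _ N_lin N_bound]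
  have "0 \<le> (\<Sum>k\<in>I. B * M k)" using B0 M by (intro sum_nonneg) auto
  note series = series[OF this]
  show ?thesis
    unfolding N_def[symmetric]
    by (rule exI[of _ "\<lambda>t. \<Sum>n. f n t"], intro conjI ballI; rule series)
       (auto simp: f_simps deriv cont)
qed

section \<open>Unitary evolutions and circuits\<close>

lemma bounded_bilinear_matrix_matrix_mult:
  "bounded_bilinear ((**) :: complex^'n^'n \<Rightarrow> complex^'n^'n \<Rightarrow> complex^'n^'n)"
  unfolding bilinear_conv_bounded_bilinear[symmetric] bilinear_def linear_iff
  by (auto simp: matrix_matrix_mult_def vec_eq_iff sum.distrib algebra_simps scaleR_sum_right)

lemma bounded_bilinear_matrix_vector_mult:
  "bounded_bilinear ((*v) :: complex^'n^'n \<Rightarrow> complex^'n \<Rightarrow> complex^'n)"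
  unfolding bilinear_conv_bounded_bilinear[symmetric] bilinear_def linear_iff
  by (auto simp: matrix_vector_mult_def vec_eq_iff sum.distrib algebra_simps scaleR_sum_right)

lemmas matrix_mult_left_linear = bounded_bilinear.bounded_linear_right[OF bounded_bilinear_matrix_matrix_mult]
lemmas matrix_vector_linear = bounded_bilinear.bounded_linear_right[OF bounded_bilinear_matrix_vector_mult]

lemma cscale_vector_mult: "cscale c A *v x = c *s (A *v x)"
  by (simp add: cscale_def matrix_vector_mult_def vec_eq_iff sum_distrib_left mult.assoc)

lemma cscale_of_real: "cscale (c * of_real r) A = r *\<^sub>R cscale c A"
  by (simp add: cscale_def vec_eq_iff scaleR_conv_of_real[where x="_ * _"] mult_ac)

lemma norm_vector_smult: "norm (c *s x) = cmod c * norm (x :: complex^'n)"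
  by (simp add: norm_vec_def norm_mult L2_set_right_distrib)

text \<open>The real inner product on \<open>complex^'n\<close> is the real part of the Hermitian
  one, so adjoints and overlaps can be handled in real terms.\<close>

lemma Re_cinner: "Re (cinner x y) = inner x y"
  by (simp add: cinner_def inner_vec_def inner_complex_def Re_sum sum.distrib)

lemma inner_matrix_vector: "inner x (A *v y) = inner (dagger A *v x) (y :: complex^'n)"
proof -
  have "cinner x (A *v y) = (\<Sum>i\<in>UNIV. \<Sum>j\<in>UNIV. cnj (x $ i) * (A $ i $ j * y $ j))"
    by (simp add: cinner_def matrix_vector_mult_def sum_distrib_left)
  also have "\<dots> = (\<Sum>j\<in>UNIV. \<Sum>i\<in>UNIV. cnj (x $ i) * (A $ i $ j * y $ j))"
    by (rule sum.swap)
  also have "\<dots> = cinner (dagger A *v x) y"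
    by (simp add: cinner_def matrix_vector_mult_def dagger_def sum_distrib_right sum_distrib_left mult_ac)
  finally show ?thesis by (simp flip: Re_cinner)
qed

text \<open>The adjoint of \<open>- \<i> A\<close> is \<open>\<i> A\<close> for Hermitian
  \<open>A\<close>. This skewness is what makes the flows preserve norms.\<close>

lemma hermitian_skew:
  assumes "hermitian A"
  shows "inner (cscale (- \<i>) A *v x) y = - inner x (cscale (- \<i>) A *v (y :: complex^'n))"
proof -
  have "dagger (cscale (- \<i>) A) = - cscale (- \<i>) A"
    using assms by (auto simp: hermitian_def dagger_def cscale_def vec_eq_iff)
  then show ?thesis
    unfolding inner_matrix_vector by (simp add: bounded_bilinear.minus_left[OF bounded_bilinear_matrix_vector_mult])
qed

lemma skew_flow_norm:
  fixes u :: "real \<Rightarrow> 'v::real_inner"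
  assumes u: "\<And>t. t \<in> {0..T} \<Longrightarrow> (u has_vector_derivative L t (u t)) (at t within {0..T})"
    and skew: "\<And>t y. t \<in> {0..T} \<Longrightarrow> inner y (L t y) = 0" and t: "t \<in> {0..T}"
  shows "norm (u t) = norm (u 0)"
proof -
  have "norm (inner (u t) (u t) - inner (u 0) (u 0)) \<le> 0 - (0::real)"
  proof (rule norm_diff_le_of_vector_derivative[where f="\<lambda>s. inner (u s) (u s)" and \<phi>="\<lambda>_. 0"
        and f'="\<lambda>_. 0" and \<phi>'="\<lambda>_. 0" and S="{0..T}"])
    fix s assume "s \<in> {0..t}"
    with t have s: "s \<in> {0..T}" by auto
    show "((\<lambda>s. inner (u s) (u s)) has_vector_derivative 0) (at s within {0..T})"
      using bounded_bilinear.has_vector_derivative[OF bounded_bilinear_inner u[OF s] u[OF s]] skew[OF s]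
      by (simp add: inner_commute)
  qed (use t in auto)
  then show ?thesis by (simp add: norm_eq_sqrt_inner)
qed

lemma matpow_scaleR: "matpow (r *\<^sub>R A) n = r ^ n *\<^sub>R matpow (A :: complex^'n^'n) n"
proof (induction n)
  case (Suc n)
  then show ?case
    by (simp add: bounded_bilinear.scaleR_left[OF bounded_bilinear_matrix_matrix_mult]
      bounded_bilinear.scaleR_right[OF bounded_bilinear_matrix_matrix_mult] mult.commute)
qed simp

text \<open>The exponential series of \<open>t *\<^sub>R A\<close>, term by term, is an instance of
  \<open>linear_ode_series\<close> with a constant generator.\<close>

lemma mexp_flow:
  fixes A :: "complex^'n^'n"
  shows "(\<lambda>n. (1 / fact n) *\<^sub>R matpow A n) sums mexp A"
    and "mexp (0 *\<^sub>R A) = mat 1"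
    and "t \<in> {0..T} \<Longrightarrow> ((\<lambda>t. mexp (t *\<^sub>R A)) has_vector_derivative A ** mexp (t *\<^sub>R A)) (at t within {0..T})"
proof -
  define f where "f n t = (t ^ n / fact n) *\<^sub>R matpow A n" for n and t :: real
  have mexp: "mexp (t *\<^sub>R A) = (\<Sum>n. f n t)" for t
    by (simp add: mexp_def f_def matpow_scaleR)
  obtain M where M: "M \<ge> 0" "\<And>y :: complex^'n^'n. norm (A ** y) \<le> norm y * M"
    using bounded_linear.nonneg_bounded[OF matrix_mult_left_linear[of A]] by metis
  have deriv: "(f (Suc n) has_vector_derivative A ** f n t) (at t within S)" for n t S
  proof -
    have "((\<lambda>t. t ^ Suc n / fact (Suc n)) has_real_derivative real (Suc n) * t ^ n / fact (Suc n)) (at t within S)"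
      using DERIV_pow[of "Suc n" t S] by (intro DERIV_cdivide) simp
    then have "((\<lambda>t. t ^ Suc n / fact (Suc n)) has_real_derivative t ^ n / fact n) (at t within S)"
      by (simp add: fact_Suc del: of_nat_Suc)
    from has_vector_derivative_scaleR[OF this has_vector_derivative_const[of "matpow A (Suc n)"]]
    show ?thesis
      unfolding f_def bounded_bilinear.scaleR_right[OF bounded_bilinear_matrix_matrix_mult] matpow.simps(2)[symmetric]
        scaleR_zero_right add_0_left .
  qed
  have lin: "linear (\<lambda>y :: complex^'n^'n. A ** y)" by (rule bounded_linear.linear[OF matrix_mult_left_linear])
  have bound: "norm (A ** y) \<le> M * norm y" for y :: "complex^'n^'n" using M(2)[of y] by (simp add: mult.commute)
  have f_0: "f 0 t = mat 1" and f_Suc_0: "f (Suc n) 0 = 0" for n t by (simp_all add: f_def)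
  note series = linear_ode_series[where N="\<lambda>_ y. A ** y" and f=f and M=M and x="mat 1"]
  have flow1: "(\<lambda>n. f n 1) sums (\<Sum>n. f n 1)"
    by (rule series(1)[of 1]) (simp_all add: M(1) lin bound f_0 f_Suc_0 deriv)
  have flow2: "(\<Sum>n. f n 0) = mat 1"
    by (rule series(2)[of 0]) (simp_all add: M(1) lin bound f_0 f_Suc_0 deriv)
  have flow3: "((\<lambda>t. \<Sum>n. f n t) has_vector_derivative A ** (\<Sum>n. f n t)) (at t within {0..T})" if "t \<in> {0..T}" for t T
    by (rule series(3)[of T]) (use that in \<open>simp_all add: M(1) lin bound f_0 f_Suc_0 deriv\<close>)
  show "(\<lambda>n. (1 / fact n) *\<^sub>R matpow A n) sums mexp A"
    using flow1 mexp[of 1] by (simp add: f_def)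
  show "mexp (0 *\<^sub>R A) = mat 1" unfolding mexp by (rule flow2)
  show "t \<in> {0..T} \<Longrightarrow> ((\<lambda>t. mexp (t *\<^sub>R A)) has_vector_derivative A ** mexp (t *\<^sub>R A)) (at t within {0..T})"
    unfolding mexp by (rule flow3)
qed

text \<open>For a continuous generator the ordinary fundamental theorem differentiates each Dyson
  term. The exact evolution is of this kind, since its generator contains the weights but not their
  derivatives.\<close>

lemma time_ordered_exp_flow:
  fixes A :: "real \<Rightarrow> complex^'n^'n"
  assumes A: "continuous_on {0..T} A" and T: "0 \<le> T"
  shows "time_ordered_exp A 0 = mat 1"
    and "t \<in> {0..T} \<Longrightarrow> (time_ordered_exp A has_vector_derivative A t ** time_ordered_exp A t) (at t within {0..T})"
proof -
  have cont: "continuous_on {0..T} (dyson A n)" for n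
  proof (induction n)
    case (Suc n)
    have "continuous_on {0..T} (\<lambda>s. A s ** dyson A n s)"
      by (rule bounded_bilinear.continuous_on[OF bounded_bilinear_matrix_matrix_mult A Suc])
    then show ?case
      by (simp add: indefinite_integral_continuous_1 integrable_continuous_real)
  qed simp
  have "\<exists>B. \<forall>t\<in>{0..T}. norm (A t) \<le> B"
    using compact_imp_bounded[OF compact_continuous_image[OF A]] by (auto simp: bounded_iff)
  then obtain B where B: "\<And>t. t \<in> {0..T} \<Longrightarrow> norm (A t) \<le> B" by blast
  obtain K where K: "0 \<le> K" "\<And>(a :: complex^'n^'n) (b :: complex^'n^'n). norm (a ** b) \<le> norm a * norm b * K"
    using bounded_bilinear.nonneg_bounded[OF bounded_bilinear_matrix_matrix_mult] by metis
  have B0: "0 \<le> B" using order.trans[OF norm_ge_zero B[of 0]] T by simp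
  have bound: "norm (A t ** y) \<le> B * K * norm y" if "t \<in> {0..T}" for t and y :: "complex^'n^'n"
  proof -
    have "norm (A t ** y) \<le> norm (A t) * norm y * K" by (rule K)
    also have "\<dots> \<le> B * norm y * K" using B[OF that] K by (intro mult_right_mono) auto
    finally show ?thesis by (simp add: mult_ac)
  qed
  have deriv: "(dyson A (Suc n) has_vector_derivative A t ** dyson A n t) (at t within {0..T})" if "t \<in> {0..T}" for n t
    unfolding dyson.simps
    by (rule integral_has_vector_derivative[OF bounded_bilinear.continuous_on[OF bounded_bilinear_matrix_matrix_mult A cont] that])
  have BK: "0 \<le> B * K" using B0 K by simp
  have lin: "linear (\<lambda>y :: complex^'n^'n. A t ** y)" for t
    by (rule bounded_linear.linear[OF matrix_mult_left_linear])
  have dyson_0: "dyson A 0 t = mat 1" "dyson A (Suc n) 0 = 0" for t n by simp_all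
  note series = linear_ode_series[where T=T and M="B * K" and N="\<lambda>t y. A t ** y" and f="dyson A" and x="mat 1"]
  show "time_ordered_exp A 0 = mat 1"
    unfolding time_ordered_exp_def by (rule series(2)) (simp_all only: T BK lin bound dyson_0 deriv)
  show "t \<in> {0..T} \<Longrightarrow> (time_ordered_exp A has_vector_derivative A t ** time_ordered_exp A t) (at t within {0..T})"
    unfolding time_ordered_exp_def[abs_def]
    by (rule series(3)) (simp_all only: T BK lin bound dyson_0 deriv)
qed

lemma flow_vector:
  fixes U :: "real \<Rightarrow> complex^'n^'n"
  assumes "(U has_vector_derivative A ** U t) (at t within S)"
  shows "((\<lambda>t. U t *v x) has_vector_derivative A *v (U t *v x)) (at t within S)"
  using bounded_linear.has_vector_derivative[OF
      bounded_bilinear.bounded_linear_left[OF bounded_bilinear_matrix_vector_mult] assms, of x]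
  by (simp add: matrix_vector_mul_assoc)

text \<open>The norm is constant along the flow with skew generator. Negative durations are reduced
  to positive ones by passing to \<open>- A\<close>; they occur because circuits are evaluated on
  all lists of pairs.\<close>

lemma norm_mexp_hermitian:
  fixes A :: "complex^'n^'n"
  assumes A: "hermitian A"
  shows "norm (mexp (cscale (- \<i> * of_real \<tau>) A) *v x) = norm x"
proof -
  have *: "norm (mexp (cscale (- \<i> * of_real t) B) *v x) = norm x" if t: "0 \<le> t" and B: "hermitian B" 
    for t and B :: "complex^'n^'n"
  proof -
    have "norm (mexp (t *\<^sub>R cscale (- \<i>) B) *v x) = norm (mexp (0 *\<^sub>R cscale (- \<i>) B) *v x)"
    proof (rule skew_flow_norm[where T=t and L="\<lambda>_ y. cscale (- \<i>) B *v y"])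
      show "((\<lambda>t. mexp (t *\<^sub>R cscale (- \<i>) B) *v x) has_vector_derivative
          cscale (- \<i>) B *v (mexp (s *\<^sub>R cscale (- \<i>) B) *v x)) (at s within {0..t})" if "s \<in> {0..t}" for s
        by (rule flow_vector[OF mexp_flow(3)[OF that]])
      show "inner y (cscale (- \<i>) B *v y) = 0" for y
        using hermitian_skew[OF B, of y y] by (simp add: inner_commute)
    qed (use t in auto)
    then show ?thesis unfolding mexp_flow(2) cscale_of_real by simp
  qed
  show ?thesis
  proof (cases "0 \<le> \<tau>")
    case True
    then show ?thesis using * A by blast
  next
    case False
    have "hermitian (- A)" using A by (simp add: hermitian_def dagger_def vec_eq_iff)
    moreover have "cscale (- \<i> * of_real \<tau>) A = cscale (- \<i> * of_real (- \<tau>)) (- A)"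
      by (simp add: cscale_def vec_eq_iff)
    ultimately show ?thesis using *[of "- \<tau>" "- A"] False by simp
  qed
qed

lemma norm_circuit:
  assumes "\<And>i. hermitian (H i)"
  shows "norm (circuit H l *v x) = norm x"
  by (induction l arbitrary: x) (simp_all add: matrix_vector_mul_assoc[symmetric] norm_mexp_hermitian[simplified] assms)

lemma measurable_mexp:
  fixes A :: "complex^'n^'n"
  shows "(\<lambda>r. mexp (r *\<^sub>R A)) \<in> borel_measurable borel"
proof (rule borel_measurable_LIMSEQ_metric)
  show "(\<lambda>r. \<Sum>k<n. (1 / fact k) *\<^sub>R matpow (r *\<^sub>R A) k) \<in> borel_measurable borel" for n
    unfolding matpow_scaleR by measurable
  show "(\<lambda>n. \<Sum>k<n. (1 / fact k) *\<^sub>R matpow (r *\<^sub>R A) k) \<longlonglongrightarrow> mexp (r *\<^sub>R A)" for r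
    using mexp_flow(1) by (simp add: sums_def)
qed

lemma measurable_circuit:
  fixes H :: "'q::finite \<Rightarrow> complex^'n^'n"
  shows "circuit H \<in> borel_measurable path_algebra"
proof (rule measurable_list_rec[OF space_node_time])
  show "circuit H (x # l) = (\<lambda>(x, X). X ** mexp (snd x *\<^sub>R cscale (- \<i>) (H (fst x)))) (x, circuit H l)" for x l
    using cscale_of_real[of "- \<i>" "snd x" "H (fst x)"] by simp
  note [measurable] = measurable_mexp
  have "(\<lambda>y :: ('q \<times> real) \<times> (complex^'n^'n). snd y ** mexp (snd (fst y) *\<^sub>R cscale (- \<i>) (H (fst (fst y)))))
    \<in> borel_measurable ((count_space UNIV \<Otimes>\<^sub>M borel) \<Otimes>\<^sub>M borel)"
  proof (rule measurable_compose_countable'[where I=UNIV and g="\<lambda>y. fst (fst y)" and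
        f="\<lambda>k y. snd y ** mexp (snd (fst y) *\<^sub>R cscale (- \<i>) (H k))"])
    fix k
    show "(\<lambda>y :: ('q \<times> real) \<times> (complex^'n^'n). snd y ** mexp (snd (fst y) *\<^sub>R cscale (- \<i>) (H k)))
      \<in> borel_measurable ((count_space UNIV \<Otimes>\<^sub>M borel) \<Otimes>\<^sub>M borel)"
    proof (rule borel_measurable_continuous_Pair[where H="(**)"])
      show "continuous_on UNIV (\<lambda>x :: (complex^'n^'n) \<times> (complex^'n^'n). fst x ** snd x)"
        by (rule bounded_bilinear.continuous_on[OF bounded_bilinear_matrix_matrix_mult]) (intro continuous_intros)+
    qed measurable
  qed (auto intro: countableI_type)
  then show "(\<lambda>(x, X :: complex^'n^'n). X ** mexp (snd x *\<^sub>R cscale (- \<i>) (H (fst x))))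
      \<in> borel_measurable ((count_space UNIV \<Otimes>\<^sub>M borel) \<Otimes>\<^sub>M borel)"
    by (simp add: case_prod_beta)
qed

section \<open>Pure states and fidelity\<close>

lemma unitary_channel_pure_state: "unitary_channel X (pure_state \<psi>) = pure_state (X *v \<psi>)"
proof -
  have "(X ** pure_state \<psi> ** dagger X) $ i $ j = pure_state (X *v \<psi>) $ i $ j" for i j
  proof -
    have "(X ** pure_state \<psi> ** dagger X) $ i $ j =
        (\<Sum>k\<in>UNIV. \<Sum>l\<in>UNIV. (X $ i $ l * \<psi> $ l) * (cnj (X $ j $ k) * cnj (\<psi> $ k)))"
      by (simp add: matrix_matrix_mult_def pure_state_def dagger_def sum_distrib_right sum_distrib_left mult_ac)
    also have "\<dots> = pure_state (X *v \<psi>) $ i $ j"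
      by (simp add: pure_state_def matrix_vector_mult_def sum_distrib_left sum_distrib_right mult_ac)
    finally show ?thesis .
  qed
  then show ?thesis by (simp add: unitary_channel_def vec_eq_iff)
qed

text \<open>In this form fidelity is visibly linear in \<open>\<rho>\<close> and depends on
  \<open>\<phi>\<close> only through \<open>pure_state \<phi>\<close>, hence not on its
  phase.\<close>

lemma fidelity_eq: "fidelity \<phi> \<rho> = (\<Sum>i\<in>UNIV. \<Sum>j\<in>UNIV. Re (\<rho> $ i $ j * pure_state \<phi> $ j $ i))"
  by (simp add: fidelity_def cinner_def matrix_vector_mult_def pure_state_def sum_distrib_left Re_sum mult_ac
      del: Re_complex_of_real times_complex.sel)

lemma bounded_linear_fidelity: "bounded_linear (fidelity \<phi>)"
  unfolding linear_conv_bounded_linear[symmetric]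
  by (rule linearI) (simp_all add: fidelity_eq algebra_simps sum.distrib sum_subtractf sum_distrib_left)

lemma fidelity_pure_state: "fidelity \<phi> (pure_state x) = (cmod (cinner \<phi> x))\<^sup>2"
proof -
  have "cinner \<phi> (pure_state x *v \<phi>) = cinner \<phi> x * cnj (cinner \<phi> x)"
    by (simp add: cinner_def matrix_vector_mult_def pure_state_def sum_distrib_left sum_distrib_right mult_ac)
  then show ?thesis by (simp add: fidelity_def complex_norm_square[symmetric] flip: of_real_power)
qed

text \<open>With \<open>z\<close> the overlap,
  \<open>\<bar>z\<bar>\<^sup>2 \<ge> (Re z)\<^sup>2\<close> and
  \<open>(Re z - 1)\<^sup>2 \<ge> 0\<close>. The lower bound is affine in \<open>x\<close>, so it
  can be averaged over circuits.\<close>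

lemma fidelity_pure_state_ge: "2 * inner \<phi> x - 1 \<le> fidelity \<phi> (pure_state x)"
proof -
  have "(inner \<phi> x)\<^sup>2 \<le> (cmod (cinner \<phi> x))\<^sup>2"
    unfolding Re_cinner[symmetric] using abs_Re_le_cmod by (metis abs_le_square_iff abs_norm_cancel)
  moreover have "0 \<le> (inner \<phi> x - 1)\<^sup>2" by simp
  ultimately show ?thesis by (simp add: fidelity_pure_state power2_eq_square algebra_simps)
qed

lemma norm_pure_state: "norm (pure_state x) = (norm x)\<^sup>2"
  by (simp add: pure_state_def norm_vec_def norm_mult L2_set_right_distrib[symmetric] L2_set_left_distrib[symmetric] power2_eq_square)

section \<open>The jump chain of the compiler\<close>

text \<open>As \<open>g\<close> may be discontinuous, the fundamental theorem is that of the gauge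
  integral; nonnegativity turns the result into a Lebesgue integral.\<close>

lemma nn_integral_neg_derivative:
  fixes G g :: "real \<Rightarrow> real"
  assumes "s \<le> T"
    and "\<And>t. t \<in> {s..T} \<Longrightarrow> (G has_real_derivative - g t) (at t within {s..T})"
    and "\<And>t. t \<in> {s..T} \<Longrightarrow> 0 \<le> g t"
  shows "(\<integral>\<^sup>+ t. indicator {s..T} t * ennreal (g t) \<partial>lborel) = ennreal (G s - G T)"
proof -
  have "((\<lambda>t. - g t) has_integral (G T - G s)) {s..T}"
    using assms(1,2) by (intro fundamental_theorem_of_calculus) (auto simp: has_real_derivative_iff_has_vector_derivative)
  then have "(g has_integral (G s - G T)) {s..T}"
    using has_integral_neg[of "\<lambda>t. - g t" "G T - G s" "{s..T}"] by simp
  then have "(\<integral>\<^sup>+ t. ennreal (indicator {s..T} t * g t) \<partial>lborel) = ennreal (G s - G T)"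
    using assms(3) by (intro nn_integral_has_integral_lebesgue)
  then show ?thesis by (simp add: ennreal_mult' ennreal_indicator)
qed

lemma measurable_gate_count: "gate_count \<alpha> \<beta> C \<in> borel_measurable path_algebra"
proof (rule measurable_list_rec[OF space_node_time])
  show "gate_count \<alpha> \<beta> C (x # l) = (\<lambda>y. \<alpha> + \<beta> * C * snd (fst y) + snd y) (x, gate_count \<alpha> \<beta> C l)" for x l
    by (simp add: gate_count_def case_prod_beta)
qed measurable

text \<open>With free gates the gate-count estimate turns into a bound on total mass; see
  \<open>emeasure_compiler_law_le\<close>.\<close>

lemma gate_count_free: "gate_count 0 0 C l = 0"
  by (induction l) (auto simp: gate_count_def)

lemma ennreal_add_le: "ennreal (a + b) \<le> ennreal a + ennreal b"
proof -
  have "ennreal (a + b) \<le> ennreal (max 0 a + max 0 b)" by (intro ennreal_leI) simp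
  then show ?thesis by (simp add: ennreal_plus)
qed

text \<open>Measurability on the whole line and a vanishing sum of the \<open>dw j\<close> are built
  in; \<open>compiler_bounds\<close> supplies both, adjusting the data where the law does not see
  it.\<close>

locale markov_compiler =
  fixes w dw :: "'q::finite \<Rightarrow> real \<Rightarrow> real" and lam T :: real
  assumes T_nonneg: "0 \<le> T" and lam_nonneg: "0 \<le> lam"
    and w_deriv: "t \<in> {0..T} \<Longrightarrow> (w j has_real_derivative dw j t) (at t within {0..T})"
    and w_nonneg: "t \<in> {0..T} \<Longrightarrow> 0 \<le> w j t"
    and w_sum: "t \<in> {0..T} \<Longrightarrow> (\<Sum>j\<in>UNIV. w j t) = 1"
    and dw_sum: "t \<in> {0..T} \<Longrightarrow> (\<Sum>j\<in>UNIV. dw j t) = 0"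
    and rate_nonneg: "t \<in> {0..T} \<Longrightarrow> 0 \<le> dw j t + lam * w j t"
    and w_measurable [measurable]: "w j \<in> borel_measurable borel"
    and dw_measurable [measurable]: "dw j \<in> borel_measurable borel"
begin

definition rate :: "'q \<Rightarrow> real \<Rightarrow> real" where
  "rate j t = dw j t + lam * w j t"

text \<open>An antiderivative of \<open>rate j\<close>: the \<open>dw\<close> part integrates to
  \<open>w j\<close>, so only the continuous weight appears under an integral.\<close>

definition rate_integral :: "'q \<Rightarrow> real \<Rightarrow> real" where
  "rate_integral j t = w j t + lam * integral {0..t} (w j)"

text \<open>An antiderivative of the exit rate \<open>lam - rate i\<close> on \<open>{0..T}\<close>;
  the value zero elsewhere makes it Borel on the whole line.\<close>

definition exponent :: "'q \<Rightarrow> real \<Rightarrow> real" where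
  "exponent i t = (if t \<in> {0..T} then lam * t - rate_integral i t else 0)"

lemma compiler_rate_eq: "compiler_rate w dw lam i j t = rate j t"
  by (simp add: compiler_rate_def rate_def)

lemma rate_nonneg': "t \<in> {0..T} \<Longrightarrow> 0 \<le> rate j t"
  using rate_nonneg by (simp add: rate_def)

lemma rate_sum: "t \<in> {0..T} \<Longrightarrow> (\<Sum>j\<in>UNIV. rate j t) = lam"
  by (simp add: rate_def sum.distrib dw_sum w_sum sum_distrib_left[symmetric])

lemma rate_sum_other: "t \<in> {0..T} \<Longrightarrow> (\<Sum>j\<in>-{i}. rate j t) = lam - rate i t"
  using rate_sum[of t] sum.remove[of UNIV i "\<lambda>j. rate j t"] by (simp add: Compl_eq_Diff_UNIV)

lemma rate_le: "t \<in> {0..T} \<Longrightarrow> rate j t \<le> lam"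
  using rate_sum_other[of t j] sum_nonneg[of "-{j}" "\<lambda>j. rate j t"] rate_nonneg'[of t] by auto

lemma exit_rate_eq: "t \<in> {0..T} \<Longrightarrow> exit_rate (compiler_rate w dw lam) i t = lam - rate i t"
  using rate_sum_other[of t i] by (simp add: exit_rate_def compiler_rate_def rate_def)

lemma w_continuous: "continuous_on {0..T} (w j)"
  using w_deriv by (intro DERIV_continuous_on)

lemma rate_integral_deriv:
  assumes "t \<in> {0..T}"
  shows "(rate_integral j has_real_derivative rate j t) (at t within {0..T})"
proof -
  have "((\<lambda>t. integral {0..t} (w j)) has_real_derivative w j t) (at t within {0..T})"
    unfolding has_real_derivative_iff_has_vector_derivative
    by (rule integral_has_vector_derivative[OF w_continuous assms])
  from DERIV_add[OF w_deriv[OF assms] DERIV_cmult[OF this, of lam]]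
  show ?thesis by (simp add: rate_integral_def[abs_def] rate_def)
qed

lemma exponent_deriv:
  assumes t: "t \<in> {0..T}"
  shows "(exponent i has_real_derivative lam - rate i t) (at t within {0..T})"
proof -
  have "((\<lambda>t. lam * t - rate_integral i t) has_real_derivative lam - rate i t) (at t within {0..T})"
    using DERIV_diff[OF DERIV_cmult_Id rate_integral_deriv[OF t]] .
  then show ?thesis
    by (rule has_field_derivative_transform_within[OF _ zero_less_one t]) (simp add: exponent_def)
qed

lemma exponent_deriv':
  assumes "s \<in> {0..T}" "t \<in> {s..T}"
  shows "(exponent i has_real_derivative lam - rate i t) (at t within {s..T})"
  by (rule DERIV_subset[OF exponent_deriv]) (use assms in auto)

text \<open>The exit rate lies between \<open>0\<close> and \<open>lam\<close>, that is, within
  \<open>lam / 2\<close> of \<open>lam / 2\<close>. Subtracting the linear function of slope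
  \<open>lam / 2\<close> yields both bounds from one norm estimate.\<close>

lemma exponent_diff:
  assumes "0 \<le> s" "s \<le> t" "t \<le> T"
  shows "exponent i s \<le> exponent i t" "exponent i t - exponent i s \<le> lam * (t - s)"
proof -
  have *: "0 \<le> x \<and> x \<le> 2 * y" if "norm (x - y) \<le> y" for x y :: real
    using that by auto
  have "norm (exponent i t - exponent i s - (lam / 2 * t - lam / 2 * s)) \<le> lam / 2 * t - lam / 2 * s"
  proof -
    have "norm ((exponent i t - lam / 2 * t) - (exponent i s - lam / 2 * s)) \<le> lam / 2 * t - lam / 2 * s"
    proof (rule norm_diff_le_of_vector_derivative[where S="{0..T}"])
      fix x assume "x \<in> {s..t}"
      then have x: "x \<in> {0..T}" using assms by auto
      show "((\<lambda>t. exponent i t - lam / 2 * t) has_vector_derivative lam - rate i x - lam / 2) (at x within {0..T})"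
        unfolding has_real_derivative_iff_has_vector_derivative[symmetric]
        by (rule DERIV_diff[OF exponent_deriv[OF x] DERIV_cmult_Id])
      show "((\<lambda>t. lam / 2 * t) has_real_derivative lam / 2) (at x within {0..T})"
        by (rule DERIV_cmult_Id)
      show "norm (lam - rate i x - lam / 2) \<le> lam / 2"
        using rate_nonneg'[OF x, of i] rate_le[OF x, of i] by (simp add: abs_le_iff field_simps)
    qed (use assms in auto)
    then show ?thesis by (simp add: algebra_simps)
  qed
  then have "0 \<le> exponent i t - exponent i s" "exponent i t - exponent i s \<le> 2 * (lam / 2 * t - lam / 2 * s)"
    using * by simp_all
  then show "exponent i s \<le> exponent i t" "exponent i t - exponent i s \<le> lam * (t - s)"
    by (simp_all add: right_diff_distrib)
qed

sublocale jump_rates "compiler_rate w dw lam" T exponent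
proof
  show "compiler_rate w dw lam i j \<in> borel_measurable borel" for i j
    unfolding compiler_rate_def[abs_def] by measurable
  show "exponent i \<in> borel_measurable borel" for i
  proof -
    have "continuous_on {0..T} (exponent i)" using exponent_deriv by (intro DERIV_continuous_on)
    then have "(\<lambda>t. indicator {0..T} t *\<^sub>R exponent i t) \<in> borel_measurable borel"
      by (intro borel_measurable_continuous_on_indicator) auto
    also have "(\<lambda>t. indicator {0..T} t *\<^sub>R exponent i t) = exponent i"
      by (auto simp: exponent_def indicator_def)
    finally show ?thesis .
  qed
  fix s t i assume st: "0 \<le> s" "s \<le> t" "t \<le> T"
  have "((\<lambda>t. lam - rate i t) has_integral exponent i t - exponent i s) {s..t}"
  proof (rule fundamental_theorem_of_calculus[OF st(2)])
    fix x assume "x \<in> {s..t}"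
    then show "(exponent i has_vector_derivative lam - rate i x) (at x within {s..t})"
      unfolding has_real_derivative_iff_has_vector_derivative[symmetric]
      by (intro DERIV_subset[OF exponent_deriv]) (use st in auto)
  qed
  then have "(exit_rate (compiler_rate w dw lam) i has_integral exponent i t - exponent i s) {s..t}"
    by (rule has_integral_eq[rotated]) (use st exit_rate_eq in auto)
  then show "survival (compiler_rate w dw lam) i s t = exp (exponent i s - exponent i t)"
    by (simp add: survival_def integral_unique)
qed

section \<open>Survival probabilities and the expected gate count\<close>

definition surv :: "'q \<Rightarrow> real \<Rightarrow> real \<Rightarrow> real" where
  "surv i s t = exp (exponent i s - exponent i t)"

lemma surv_pos: "0 < surv i s t" by (simp add: surv_def)
lemma surv_self [simp]: "surv i s s = 1" by (simp add: surv_def)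
lemma surv_le_1: "0 \<le> s \<Longrightarrow> s \<le> t \<Longrightarrow> t \<le> T \<Longrightarrow> surv i s t \<le> 1"
  using exponent_diff(1)[of s t i] by (simp add: surv_def)
lemma surv_ge: "0 \<le> s \<Longrightarrow> s \<le> T \<Longrightarrow> exp (- (lam * T)) \<le> surv i s T"
  using exponent_diff(2)[of s T i] mult_nonneg_nonneg[OF lam_nonneg, of s] by (simp add: surv_def algebra_simps)

lemma surv_deriv:
  assumes "s \<in> {0..T}" "t \<in> {s..T}"
  shows "(surv i s has_real_derivative - (surv i s t * (lam - rate i t))) (at t within {s..T})"
  unfolding surv_def[abs_def]
  by (rule derivative_eq_intros exponent_deriv'[OF assms] refl)+ (simp add: algebra_simps)

text \<open>One gate is paid at once, further gates come with jumps at rate at most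
  \<open>lam\<close>, and the durations add up to \<open>T - s\<close>. The constant
  \<open>c\<close> carries the cost already incurred, so that prepending a gate stays within the
  induction hypothesis.\<close>

lemma partial_integral_gate_count:
  assumes nonneg: "0 \<le> \<alpha>" "0 \<le> \<beta>" "0 \<le> C" and c: "0 \<le> c" and s: "s \<in> {0..T}"
  shows "partial_integral m i s (\<lambda>l. ennreal c + ennreal (gate_count \<alpha> \<beta> C l))
    \<le> ennreal (c + \<alpha> * (1 + lam * (T - s)) + \<beta> * C * (T - s))"
  using c s
proof (induction m arbitrary: i s c)
  case 0
  have "surv i s T * (c + (\<alpha> + \<beta> * C * (T - s))) \<le> 1 * (c + (\<alpha> + \<beta> * C * (T - s)))"
    using 0 nonneg surv_le_1[of s T i] by (intro mult_right_mono) auto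
  also have "\<dots> \<le> c + \<alpha> * (1 + lam * (T - s)) + \<beta> * C * (T - s)"
    using mult_nonneg_nonneg[OF nonneg(1) mult_nonneg_nonneg[OF lam_nonneg, of "T - s"]] 0
    by (simp add: algebra_simps)
  finally have le: "surv i s T * (c + (\<alpha> + \<beta> * C * (T - s))) \<le> c + \<alpha> * (1 + lam * (T - s)) + \<beta> * C * (T - s)" .
  have "partial_integral 0 i s (\<lambda>l. ennreal c + ennreal (gate_count \<alpha> \<beta> C l)) =
    ennreal (surv i s T) * (ennreal c + ennreal (\<alpha> + \<beta> * C * (T - s)))"
    using survival_eq[of s T i] 0 by (simp add: partial_integral_0 surv_def gate_count_def)
  also have "\<dots> = ennreal (surv i s T * (c + (\<alpha> + \<beta> * C * (T - s))))"
    using 0 nonneg surv_pos[of i s T] by (subst ennreal_plus[symmetric]) (auto simp: ennreal_mult')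
  finally show ?case using ennreal_leI[OF le] by simp
next
  case (Suc m)
  let ?c' = "c + \<alpha> + \<beta> * C * (T - s)"
  \<comment> \<open>A supersolution: \<open>g = - \<Psi>'\<close> dominates the first-jump
    integrand, as a new gate costs \<open>\<alpha>\<close> at rate
    \<open>lam - rate i t \<le> lam\<close>. The no-jump term \<open>surv i s T * ?c'\<close> equals
    \<open>\<Psi> T\<close>, so the total telescopes to \<open>\<Psi> s\<close>.\<close>
  define \<Psi> where "\<Psi> t = surv i s t * (?c' + \<alpha> * lam * (T - t))" for t
  define g where "g t = surv i s t * (lam - rate i t) * (?c' + \<alpha> * lam * (T - t)) + surv i s t * (\<alpha> * lam)" for t
  have c': "0 \<le> ?c'" using Suc.prems nonneg by simp
  have meas: "(\<lambda>l. ennreal c + ennreal (gate_count \<alpha> \<beta> C l)) \<in> borel_measurable path_algebra"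
    using measurable_gate_count[of \<alpha> \<beta> C] by measurable
  have \<Psi>: "(\<Psi> has_real_derivative - g t) (at t within {s..T})" if "t \<in> {s..T}" for t
    unfolding \<Psi>_def[abs_def] g_def
    by (rule derivative_eq_intros surv_deriv[OF Suc.prems(2) that] refl)+ (simp add: algebra_simps)
  have g_nonneg: "0 \<le> g t" if "t \<in> {s..T}" for t
    unfolding g_def using that Suc.prems c' nonneg lam_nonneg surv_pos[of i s t] rate_le[of t i]
    by (intro add_nonneg_nonneg mult_nonneg_nonneg) auto
  have bound: "ennreal (surv i s t) * (\<Sum>j\<in>-{i}. ennreal (compiler_rate w dw lam i j t) *
      partial_integral m j t (\<lambda>l. ennreal c + ennreal (gate_count \<alpha> \<beta> C ((i, t - s) # l)))) \<le> ennreal (g t)"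
    if t: "t \<in> {s..T}" for t
  proof -
    have t': "t \<in> {0..T}" using t Suc.prems by auto
    have *: "partial_integral m j t (\<lambda>l. ennreal c + ennreal (gate_count \<alpha> \<beta> C ((i, t - s) # l)))
      \<le> ennreal (?c' + \<alpha> + \<alpha> * lam * (T - t))" for j
    proof -
      have "ennreal c + ennreal (gate_count \<alpha> \<beta> C ((i, t - s) # l)) \<le>
        ennreal (c + (\<alpha> + \<beta> * C * (t - s))) + ennreal (gate_count \<alpha> \<beta> C l)" for l
        using ennreal_add_le[of "\<alpha> + \<beta> * C * (t - s)" "gate_count \<alpha> \<beta> C l"] Suc.prems nonneg t
        by (simp add: gate_count_def ennreal_plus add.assoc add_left_mono)
      then have "partial_integral m j t (\<lambda>l. ennreal c + ennreal (gate_count \<alpha> \<beta> C ((i, t - s) # l)))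
        \<le> partial_integral m j t (\<lambda>l. ennreal (c + (\<alpha> + \<beta> * C * (t - s))) + ennreal (gate_count \<alpha> \<beta> C l))"
        unfolding partial_integral_def by (intro sum_mono path_integral_mono)
      also have "\<dots> \<le> ennreal (c + (\<alpha> + \<beta> * C * (t - s)) + \<alpha> * (1 + lam * (T - t)) + \<beta> * C * (T - t))"
        using Suc.prems nonneg t t' by (intro Suc.IH) auto
      finally show ?thesis by (simp add: algebra_simps)
    qed
    have "ennreal (surv i s t) * (\<Sum>j\<in>-{i}. ennreal (compiler_rate w dw lam i j t) *
      partial_integral m j t (\<lambda>l. ennreal c + ennreal (gate_count \<alpha> \<beta> C ((i, t - s) # l))))
      \<le> ennreal (surv i s t) * (\<Sum>j\<in>-{i}. ennreal (rate j t) * ennreal (?c' + \<alpha> + \<alpha> * lam * (T - t)))"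
    proof (intro mult_left_mono sum_mono)
      fix j
      show "ennreal (compiler_rate w dw lam i j t) *
        partial_integral m j t (\<lambda>l. ennreal c + ennreal (gate_count \<alpha> \<beta> C ((i, t - s) # l)))
        \<le> ennreal (rate j t) * ennreal (?c' + \<alpha> + \<alpha> * lam * (T - t))"
        unfolding compiler_rate_eq[of i j t] by (intro mult_left_mono *) simp
    qed simp
    also have "\<dots> = ennreal (surv i s t * ((lam - rate i t) * (?c' + \<alpha> + \<alpha> * lam * (T - t))))"
      using rate_nonneg'[OF t'] rate_le[OF t', of i] surv_pos[of i s t]
      by (simp add: sum_distrib_right[symmetric] sum_ennreal rate_sum_other[OF t'] ennreal_mult')
    also have "\<dots> \<le> ennreal (g t)"
    proof (rule ennreal_leI)
      have "(lam - rate i t) * \<alpha> \<le> lam * \<alpha>" using rate_nonneg'[OF t', of i] nonneg by (intro mult_right_mono) auto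
      then have "surv i s t * ((lam - rate i t) * \<alpha>) \<le> surv i s t * (\<alpha> * lam)"
        using surv_pos[of i s t] by (intro mult_left_mono) (auto simp: mult.commute)
      then show "surv i s t * ((lam - rate i t) * (?c' + \<alpha> + \<alpha> * lam * (T - t))) \<le> g t"
        by (simp add: g_def algebra_simps)
    qed
    finally show ?thesis .
  qed
  have "partial_integral (Suc m) i s (\<lambda>l. ennreal c + ennreal (gate_count \<alpha> \<beta> C l))
    \<le> ennreal (surv i s T * ?c') + (\<integral>\<^sup>+ t. indicator {s..T} t * ennreal (g t) \<partial>lborel)"
    unfolding partial_integral_Suc[OF meas Suc.prems(2)]
  proof (intro add_mono nn_integral_mono)
    show "ennreal (survival (compiler_rate w dw lam) i s T) * (ennreal c + ennreal (gate_count \<alpha> \<beta> C [(i, T - s)]))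
      \<le> ennreal (surv i s T * ?c')"
      using Suc.prems nonneg c' surv_pos[of i s T] survival_eq[of s T i]
      by (simp add: surv_def gate_count_def ennreal_mult' add.assoc)
  next
    fix t
    show "indicator {s..T} t * (ennreal (exp (exponent i s - exponent i t)) *
      (\<Sum>j\<in>-{i}. ennreal (compiler_rate w dw lam i j t) *
      partial_integral m j t (\<lambda>l. ennreal c + ennreal (gate_count \<alpha> \<beta> C ((i, t - s) # l)))))
      \<le> indicator {s..T} t * ennreal (g t)"
      using bound[of t] by (cases "t \<in> {s..T}") (simp_all add: surv_def)
  qed
  also have "(\<integral>\<^sup>+ t. indicator {s..T} t * ennreal (g t) \<partial>lborel) = ennreal (\<Psi> s - \<Psi> T)"
    using Suc.prems(2) by (intro nn_integral_neg_derivative \<Psi> g_nonneg) auto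
  also have "ennreal (surv i s T * ?c') + ennreal (\<Psi> s - \<Psi> T) = ennreal (surv i s T * ?c' + (\<Psi> s - \<Psi> T))"
  proof (rule ennreal_plus[symmetric])
    show "0 \<le> surv i s T * ?c'" using c' surv_pos[of i s T] by simp
    have "surv i s T * ?c' \<le> 1 * ?c'" using c' surv_le_1[of s T i] Suc.prems by (intro mult_right_mono) auto
    moreover have "0 \<le> \<alpha> * lam * (T - s)" using nonneg lam_nonneg Suc.prems by simp
    ultimately show "0 \<le> \<Psi> s - \<Psi> T" by (simp add: \<Psi>_def)
  qed
  also have "surv i s T * ?c' + (\<Psi> s - \<Psi> T) = c + \<alpha> * (1 + lam * (T - s)) + \<beta> * C * (T - s)"
    by (simp add: \<Psi>_def algebra_simps)
  finally show ?case .
qed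

lemma emeasure_compiler_law_le: "emeasure (compiler_law w dw lam T) UNIV \<le> 1"
proof -
  have "emeasure (compiler_law w dw lam T) UNIV = path_expectation (\<lambda>i. w i 0) (indicator UNIV)"
    unfolding compiler_law_def using sets.top[of path_algebra] by (intro emeasure_realization_law T_nonneg) simp
  also have "\<dots> \<le> 1"
  proof (rule path_expectation_le)
    show "partial_integral m i 0 (indicator UNIV) \<le> 1" for i m
      using partial_integral_gate_count[of 0 0 0 1 0 m i] T_nonneg
      by (simp add: gate_count_free indicator_def[abs_def])
  qed (use T_nonneg w_nonneg w_sum in auto)
  finally show ?thesis .
qed

lemma expected_gates_le:
  assumes "0 \<le> \<alpha>" "0 \<le> \<beta>" "0 \<le> C"
  shows "expected_gates \<alpha> \<beta> C w dw lam T \<le> ennreal (\<alpha> * (1 + lam * T) + \<beta> * C * T)"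
proof -
  have "expected_gates \<alpha> \<beta> C w dw lam T = path_expectation (\<lambda>i. w i 0) (\<lambda>l. ennreal (gate_count \<alpha> \<beta> C l))"
    unfolding expected_gates_def compiler_law_def
    using measurable_gate_count[of \<alpha> \<beta> C] by (intro nn_integral_realization_law T_nonneg) measurable
  also have "\<dots> \<le> ennreal (\<alpha> * (1 + lam * T) + \<beta> * C * T)"
  proof (rule path_expectation_le)
    show "partial_integral m i 0 (\<lambda>l. ennreal (gate_count \<alpha> \<beta> C l)) \<le> ennreal (\<alpha> * (1 + lam * T) + \<beta> * C * T)" for i m
      using partial_integral_gate_count[OF assms, of 0 0 m i] T_nonneg by simp
  qed (use T_nonneg w_nonneg w_sum in auto)
  finally show ?thesis .
qed

end

section \<open>The backward equation\<close>

text \<open>The solutions are \<open>(1 - exp (- lam * r)) / lam\<close> and its integral, with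
  limits \<open>r\<close> and \<open>r\<^sup>2 / 2\<close> at \<open>lam = 0\<close>. For
  \<open>lam > 0\<close> and \<open>x = lam * T\<close> the last bound amounts to
  \<open>(1 + x) * exp (- x) \<le> 1\<close>.\<close>

lemma relaxation_functions:
  fixes lam :: real
  assumes "0 \<le> lam"
  obtains \<mu> J :: "real \<Rightarrow> real" where "\<mu> 0 = 0" "J 0 = 0"
    "\<And>r. (\<mu> has_real_derivative 1 - lam * \<mu> r) (at r)" "\<And>r. (J has_real_derivative \<mu> r) (at r)"
    "\<And>T. 0 \<le> T \<Longrightarrow> J T * (1 + lam * T) \<le> T\<^sup>2"
proof (cases "lam = 0")
  case True
  show ?thesis
  proof (rule that[of "\<lambda>r. r" "\<lambda>r. r\<^sup>2 / 2"])
    show "((\<lambda>r. r) has_real_derivative 1 - lam * r) (at r)" for r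
      using True by simp
    show "((\<lambda>r. r\<^sup>2 / 2) has_real_derivative r) (at r)" for r :: real
      by (rule derivative_eq_intros refl | simp)+
  qed (use True in auto)
next
  case False
  then have lam: "0 < lam" using assms by simp
  show ?thesis
  proof (rule that[of "\<lambda>r. (1 - exp (- lam * r)) / lam" "\<lambda>r. (r - (1 - exp (- lam * r)) / lam) / lam"])
    show "((\<lambda>r. (1 - exp (- lam * r)) / lam) has_real_derivative 1 - lam * ((1 - exp (- lam * r)) / lam)) (at r)" for r
      using lam by (auto intro!: derivative_eq_intros)
    show "((\<lambda>r. (r - (1 - exp (- lam * r)) / lam) / lam) has_real_derivative (1 - exp (- lam * r)) / lam) (at r)" for r
      using lam by (auto intro!: derivative_eq_intros simp: field_simps)
    fix T :: real assume "0 \<le> T"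
    define x where "x = lam * T"
    have "(1 + x) * exp (- x) \<le> exp x * exp (- x)"
      using exp_ge_add_one_self[of x] by (intro mult_right_mono) auto
    then have "(1 + x) * exp (- x) \<le> 1" by (simp add: exp_minus)
    then have "(x - (1 - exp (- x))) * (1 + x) \<le> x\<^sup>2"
      by (simp add: algebra_simps power2_eq_square)
    then have "(x - (1 - exp (- x))) * (1 + x) / lam\<^sup>2 \<le> x\<^sup>2 / lam\<^sup>2"
      by (intro divide_right_mono) auto
    moreover have "x\<^sup>2 / lam\<^sup>2 = T\<^sup>2" using lam by (simp add: x_def power_mult_distrib)
    moreover have "(x - (1 - exp (- x))) * (1 + x) / lam\<^sup>2 = (T - (1 - exp (- lam * T)) / lam) / lam * (1 + lam * T)"
      using lam by (simp add: x_def field_simps power2_eq_square)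
    ultimately show "(T - (1 - exp (- lam * T)) / lam) / lam * (1 + lam * T) \<le> T\<^sup>2" by simp
  qed (use lam in auto)
qed

locale hamiltonian_compiler = markov_compiler w dw lam T
  for w dw :: "'q::finite \<Rightarrow> real \<Rightarrow> real" and lam T :: real +
  fixes H :: "'q \<Rightarrow> complex^'n^'n" and C :: real
  assumes herm: "hermitian (H i)" and H_bound: "norm (H i *v x) \<le> C * norm x" and C_nonneg: "0 \<le> C"
begin

definition gen :: "'q \<Rightarrow> complex^'n^'n" where "gen i = cscale (- \<i>) (H i)"

definition gate :: "'q \<Rightarrow> real \<Rightarrow> complex^'n^'n" where "gate i \<tau> = mexp (\<tau> *\<^sub>R gen i)"

lemma gen_bound: "norm (gen i *v x) \<le> C * norm x"
  using H_bound[of i x] by (simp add: gen_def cscale_vector_mult norm_vector_smult)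

lemma gen_skew: "inner (gen i *v x) y = - inner x (gen i *v y)"
  unfolding gen_def by (rule hermitian_skew[OF herm])

lemma gate_0: "gate i 0 *v x = x"
  using mexp_flow(2)[of "gen i"] by (simp add: gate_def)

lemma mexp_eq_gate: "mexp (cscale (- \<i> * of_real \<tau>) (H i)) = gate i \<tau>"
  unfolding cscale_of_real gate_def gen_def ..

lemma norm_gate: "norm (gate i \<tau> *v x) = norm x"
  using norm_mexp_hermitian[OF herm, of \<tau> i x] unfolding mexp_eq_gate .

lemma circuit_Cons: "circuit H ((i, \<tau>) # l) *v x = circuit H l *v (gate i \<tau> *v x)"
  unfolding circuit.simps fst_conv snd_conv mexp_eq_gate by (simp add: matrix_vector_mul_assoc)

lemma gate_deriv:
  assumes "t \<in> {s..T}"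
  shows "((\<lambda>t. gate i (t - s) *v x) has_vector_derivative gen i *v (gate i (t - s) *v x)) (at t within {s..T})"
proof -
  have "((\<lambda>\<tau>. gate i \<tau> *v x) has_vector_derivative gen i *v (gate i (t - s) *v x)) (at (t - s) within {0..T - s})"
    unfolding gate_def using assms by (intro flow_vector mexp_flow(3)) auto
  moreover have "(\<lambda>t. t - s) ` {s..T} \<subseteq> {0..T - s}" by auto
  ultimately have "((\<lambda>\<tau>. gate i \<tau> *v x) has_vector_derivative gen i *v (gate i (t - s) *v x)) (at (t - s) within (\<lambda>t. t - s) ` {s..T})"
    by (rule has_vector_derivative_within_subset)
  moreover have "((\<lambda>t. t - s) has_vector_derivative 1) (at t within {s..T})"
    by (auto intro!: derivative_eq_intros)
  ultimately show ?thesis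
    using vector_diff_chain_within[of "\<lambda>t. t - s" 1 t "{s..T}" "\<lambda>\<tau>. gate i \<tau> *v x"] by (simp add: o_def)
qed

lemma gen_linear: "linear (\<lambda>x. gen i *v x)"
  by (rule bounded_linear.linear[OF matrix_vector_linear])

text \<open>Reversing time gives one linear initial value problem on vectors indexed by the nodes.
  Its coefficients involve \<open>dw\<close> and may be discontinuous, hence the use of
  \<open>linear_ode_exists\<close>.\<close>

lemma backward_solution:
  "\<exists>y. \<forall>i. y i T = \<phi> \<and> (\<forall>t\<in>{0..T}. (y i has_vector_derivative
     gen i *v y i t + lam *\<^sub>R y i t - (\<Sum>j\<in>UNIV. rate j t *\<^sub>R y j t)) (at t within {0..T}))"
proof -
  \<comment> \<open>\<open>None\<close> labels the part with constant coefficient;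
    \<open>Some j\<close> copies component \<open>j\<close> to every component, with the rate of
    jumping to \<open>j\<close> as coefficient.\<close>
  define K where "K k y = (\<chi> i. case k of None \<Rightarrow> - (gen i *v (y $ i) + lam *\<^sub>R (y $ i)) | Some j \<Rightarrow> y $ j)"
    for k and y :: "(complex^'n)^'q"
  define c where "c k t = (case k of None \<Rightarrow> 1 | Some j \<Rightarrow> rate j (T - t))" for k t
  \<comment> \<open>Primitives of the coefficients in reversed time; the inner derivative
    \<open>-1\<close> accounts for the sign.\<close>
  define W where "W k t = (case k of None \<Rightarrow> t | Some j \<Rightarrow> - rate_integral j (T - t))" for k t
  have refl': "((\<lambda>t. T - t) has_real_derivative -1) (at t within {0..T})" for t
    by (auto intro!: derivative_eq_intros)
  have img: "(\<lambda>t. T - t) ` {0..T} = {0..T}"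
    by (auto simp: image_iff intro!: bexI[of _ "T - _"])
  have "\<exists>F. F 0 = (\<chi> i. \<phi>) \<and> (\<forall>t\<in>{0..T}. (F has_vector_derivative (\<Sum>k\<in>UNIV. c k t *\<^sub>R K k (F t))) (at t within {0..T}))"
  proof (rule linear_ode_exists[where W=W and B="max 1 lam"])
    show "linear (K k)" for k
    proof (cases k)
      case None
      show ?thesis unfolding None
        by (rule linearI) (simp_all add: K_def vec_eq_iff linear_add[OF gen_linear] linear_scale[OF gen_linear] algebra_simps)
    next
      case (Some j)
      show ?thesis unfolding Some by (rule linearI) (simp_all add: K_def vec_eq_iff)
    qed
    fix k t assume t: "t \<in> {0..T}"
    then have t': "T - t \<in> {0..T}" by auto
    show "(W k has_real_derivative c k t) (at t within {0..T})"
    proof (cases k)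
      case None
      then show ?thesis by (simp add: W_def[abs_def] c_def)
    next
      case (Some j)
      have "(rate_integral j has_real_derivative rate j (T - t)) (at (T - t) within (\<lambda>t. T - t) ` {0..T})"
        unfolding img by (rule rate_integral_deriv[OF t'])
      from DERIV_minus[OF DERIV_image_chain[OF this refl']]
      show ?thesis by (simp add: W_def[abs_def] c_def Some o_def)
    qed
    show "\<bar>c k t\<bar> \<le> max 1 lam"
      using rate_nonneg'[OF t'] rate_le[OF t'] by (auto simp: c_def split: option.split intro: le_max_iff_disj[THEN iffD2])
  qed (use T_nonneg in auto)
  then obtain F where F: "F 0 = (\<chi> i. \<phi>)"
    "\<And>t. t \<in> {0..T} \<Longrightarrow> (F has_vector_derivative (\<Sum>k\<in>UNIV. c k t *\<^sub>R K k (F t))) (at t within {0..T})" by blast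
  define y where "y i t = F (T - t) $ i" for i t
  show ?thesis
  proof (intro exI[of _ y] allI conjI ballI)
    show "y i T = \<phi>" for i by (simp add: y_def F)
    fix i t assume t: "t \<in> {0..T}"
    then have t': "T - t \<in> {0..T}" by auto
    have "(F has_vector_derivative (\<Sum>k\<in>UNIV. c k (T - t) *\<^sub>R K k (F (T - t)))) (at (T - t) within (\<lambda>t. T - t) ` {0..T})"
      unfolding img by (rule F(2)[OF t'])
    from vector_diff_chain_within[OF refl'[unfolded has_real_derivative_iff_has_vector_derivative] this]
    have "((\<lambda>t. F (T - t)) has_vector_derivative - (\<Sum>k\<in>UNIV. c k (T - t) *\<^sub>R K k (F (T - t)))) (at t within {0..T})"
      by (simp add: o_def)
    from bounded_linear.has_vector_derivative[OF bounded_linear_vec_nth[of i] this]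
    have "(y i has_vector_derivative - (\<Sum>k\<in>UNIV. c k (T - t) *\<^sub>R K k (F (T - t))) $ i) (at t within {0..T})"
      by (simp add: y_def[abs_def])
    moreover have "- (\<Sum>k\<in>UNIV. c k (T - t) *\<^sub>R K k (F (T - t))) $ i =
      gen i *v y i t + lam *\<^sub>R y i t - (\<Sum>j\<in>UNIV. rate j t *\<^sub>R y j t)"
    proof -
      have "(\<Sum>k\<in>UNIV. c k (T - t) *\<^sub>R K k (F (T - t))) $ i = (\<Sum>k\<in>UNIV. c k (T - t) *\<^sub>R K k (F (T - t)) $ i)"
        by simp
      also have "\<dots> = c None (T - t) *\<^sub>R K None (F (T - t)) $ i + (\<Sum>j\<in>UNIV. c (Some j) (T - t) *\<^sub>R K (Some j) (F (T - t)) $ i)"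
        unfolding UNIV_option_conv by (subst sum.insert) (auto simp: sum.reindex)
      finally show ?thesis by (simp add: c_def K_def y_def)
    qed
    ultimately show "(y i has_vector_derivative gen i *v y i t + lam *\<^sub>R y i t - (\<Sum>j\<in>UNIV. rate j t *\<^sub>R y j t)) (at t within {0..T})"
      by simp
  qed
qed

end

text \<open>\<open>y i s\<close> is the adjoint of the expected circuit of the chain started at node \<open>i\<close> at time \<open>s\<close>,
  applied to \<open>\<phi>\<close>.\<close>

locale backward_equation = hamiltonian_compiler w dw lam T H C
  for w dw :: "'q::finite \<Rightarrow> real \<Rightarrow> real" and lam T :: real and H :: "'q \<Rightarrow> complex^'n^'n" and C :: real +
  fixes y :: "'q \<Rightarrow> real \<Rightarrow> complex^'n" and \<phi> :: "complex^'n"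
  assumes y_T: "y i T = \<phi>" and norm_\<phi>: "norm \<phi> = 1"
    and y_deriv: "t \<in> {0..T} \<Longrightarrow> (y i has_vector_derivative
     gen i *v y i t + lam *\<^sub>R y i t - (\<Sum>j\<in>UNIV. rate j t *\<^sub>R y j t)) (at t within {0..T})"
begin

text \<open>The skew generator cancels against the gate, \<open>lam\<close> against the decay of
  \<open>surv\<close>, and the term of node \<open>i\<close> in the sum against
  \<open>rate i\<close> in that decay. What remains describes jumps to other nodes.\<close>

lemma overlap_deriv:
  assumes s: "s \<in> {0..T}" and t: "t \<in> {s..T}"
  shows "((\<lambda>t. surv i s t * inner (y i t) (gate i (t - s) *v x)) has_real_derivative
    - (surv i s t * (\<Sum>j\<in>-{i}. rate j t * inner (y j t) (gate i (t - s) *v x)))) (at t within {s..T})"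
proof -
  have "(y i has_vector_derivative gen i *v y i t + lam *\<^sub>R y i t - (\<Sum>j\<in>UNIV. rate j t *\<^sub>R y j t)) (at t within {s..T})"
    by (rule has_vector_derivative_within_subset[OF y_deriv]) (use s t in auto)
  from bounded_bilinear.has_vector_derivative[OF bounded_bilinear_inner this gate_deriv[OF t, of i x]]
  have "((\<lambda>t. inner (y i t) (gate i (t - s) *v x)) has_real_derivative
    lam * inner (y i t) (gate i (t - s) *v x) - (\<Sum>j\<in>UNIV. rate j t * inner (y j t) (gate i (t - s) *v x))) (at t within {s..T})"
    unfolding has_real_derivative_iff_has_vector_derivative
    by (simp add: inner_diff_left inner_add_left inner_sum_left gen_skew[of i "y i t"])
  from DERIV_mult[OF surv_deriv[OF s t, of i] this]
  show ?thesis
    by (rule DERIV_cong)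
       (simp add: sum.remove[of UNIV i "\<lambda>j. rate j t * inner (y j t) (gate i (t - s) *v x)"] Compl_eq_Diff_UNIV algebra_simps)
qed

text \<open>A maximum principle. Let \<open>m\<close> be the largest norm over nodes and times,
  attained at node \<open>k\<close>. From there the chain either stays at \<open>k\<close> until
  \<open>T\<close>, with probability \<open>p\<close> and contribution at most \<open>p\<close>, or
  jumps and contributes at most \<open>m * (1 - p)\<close>. So
  \<open>m \<le> p + m * (1 - p)\<close>, and \<open>p > 0\<close> forces
  \<open>m \<le> 1\<close>.\<close>

lemma norm_y_le: "s \<in> {0..T} \<Longrightarrow> norm (y i s) \<le> 1"
proof -
  have "\<exists>s\<in>{0..T}. \<forall>t\<in>{0..T}. norm (y i t) \<le> norm (y i s)" for i
    by (intro continuous_attains_sup continuous_on_norm continuous_on_vector_derivative[OF y_deriv])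
       (use T_nonneg in auto)
  then obtain \<sigma> where \<sigma>: "\<And>i. \<sigma> i \<in> {0..T}" "\<And>i t. t \<in> {0..T} \<Longrightarrow> norm (y i t) \<le> norm (y i (\<sigma> i))"
    by metis
  have "Max (range (\<lambda>i. norm (y i (\<sigma> i)))) \<in> range (\<lambda>i. norm (y i (\<sigma> i)))" by (intro Max_in) auto
  then obtain k where k: "Max (range (\<lambda>i. norm (y i (\<sigma> i)))) = norm (y k (\<sigma> k))"
    by (elim imageE) blast
  define m where "m = norm (y k (\<sigma> k))"
  have m: "norm (y i t) \<le> m" if "t \<in> {0..T}" for i t
  proof -
    have "norm (y i (\<sigma> i)) \<le> Max (range (\<lambda>i. norm (y i (\<sigma> i))))" by (intro Max_ge) auto
    then show ?thesis using \<sigma>(2)[OF that, of i] k by (simp add: m_def)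
  qed
  have "m \<le> 1"
  proof (rule ccontr)
    assume "\<not> m \<le> 1"
    then have m1: "1 < m" by simp
    \<comment> \<open>The normalized maximizer serves as test vector, so that the overlap at the
      starting time is exactly \<open>m\<close>.\<close>
    define x where "x = y k (\<sigma> k) /\<^sub>R m"
    define s where "s = \<sigma> k"
    have s: "s \<in> {0..T}" using \<sigma>(1) by (simp add: s_def)
    have nx: "norm x = 1"
      using m1 unfolding x_def norm_scaleR m_def[symmetric] by simp
    have inner_le: "\<bar>inner v (gate k \<tau> *v x)\<bar> \<le> norm v" for v \<tau>
      using Cauchy_Schwarz_ineq2[of v "gate k \<tau> *v x"] by (simp add: norm_gate nx)
    have "norm (surv k s T * inner (y k T) (gate k (T - s) *v x) - surv k s s * inner (y k s) (gate k (s - s) *v x))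
      \<le> - (m * surv k s T) - - (m * surv k s s)"
    proof (rule norm_diff_le_of_vector_derivative[where S="{s..T}"])
      fix t assume t: "t \<in> {s..T}"
      then have t': "t \<in> {0..T}" using s by auto
      show "((\<lambda>t. surv k s t * inner (y k t) (gate k (t - s) *v x)) has_vector_derivative
        - (surv k s t * (\<Sum>j\<in>-{k}. rate j t * inner (y j t) (gate k (t - s) *v x)))) (at t within {s..T})"
        using overlap_deriv[OF s t] unfolding has_real_derivative_iff_has_vector_derivative .
      show "((\<lambda>t. - (m * surv k s t)) has_real_derivative m * (surv k s t * (lam - rate k t))) (at t within {s..T})"
        using DERIV_minus[OF DERIV_cmult[OF surv_deriv[OF s t, of k], of m]] by simp
      have "\<bar>\<Sum>j\<in>-{k}. rate j t * inner (y j t) (gate k (t - s) *v x)\<bar> \<le> (\<Sum>j\<in>-{k}. rate j t * m)"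
        using rate_nonneg'[OF t'] order.trans[OF inner_le m[OF t']]
        by (intro order.trans[OF sum_abs] sum_mono) (auto simp: abs_mult intro!: mult_left_mono)
      also have "\<dots> = m * (lam - rate k t)" by (simp add: sum_distrib_right[symmetric] rate_sum_other[OF t'])
      finally show "norm (- (surv k s t * (\<Sum>j\<in>-{k}. rate j t * inner (y j t) (gate k (t - s) *v x))))
        \<le> m * (surv k s t * (lam - rate k t))"
        using surv_pos[of k s t] by (simp add: abs_mult)
    qed (use s in auto)
    moreover have "inner (y k s) (gate k (s - s) *v x) = m"
    proof -
      have "inner (y k s) (y k s) = m * m"
        by (simp add: s_def m_def power2_norm_eq_inner[symmetric] power2_eq_square)
      then show ?thesis using m1 by (simp add: gate_0 x_def s_def[symmetric])
    qed
    moreover have "surv k s T * inner (y k T) (gate k (T - s) *v x) \<le> surv k s T * 1"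
      using inner_le[of \<phi> "T - s"] surv_pos[of k s T] by (intro mult_left_mono) (auto simp: y_T norm_\<phi>)
    ultimately have "m * surv k s T \<le> 1 * surv k s T" by (simp add: algebra_simps)
    then show False using surv_pos[of k s T] m1 by simp
  qed
  then show "s \<in> {0..T} \<Longrightarrow> norm (y i s) \<le> 1" using m[of s i] by linarith
qed

text \<open>Adding one makes the overlap nonnegative, as path integrals of \<open>ennreal\<close>
  functions require; the upper bound \<open>2\<close> starts the remainder estimate.\<close>

lemma overlap_bounds:
  assumes "t \<in> {0..T}" "norm x = 1"
  shows "0 \<le> 1 + inner (y i t) x" "1 + inner (y i t) x \<le> 2"
  using Cauchy_Schwarz_ineq2[of "y i t" x] norm_y_le[OF assms(1), of i] assms(2) by (auto simp: abs_le_iff)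

text \<open>One jump of the chain multiplies the remainder \<open>r\<close> by the probability of jumping before \<open>T\<close>.\<close>

lemma overlap_step:
  assumes s: "s \<in> {0..T}" and x: "norm x = 1" and r: "0 \<le> r"
    and G: "\<And>j t. t \<in> {s..T} \<Longrightarrow> ennreal (1 + inner (y j t) (gate i (t - s) *v x)) \<le> G j t + ennreal r"
    and G_meas: "\<And>j. (\<lambda>t. indicator {0..T} t * G j t) \<in> borel_measurable borel"
  shows "ennreal (1 + inner (y i s) x) \<le> ennreal (surv i s T) * ennreal (1 + inner \<phi> (gate i (T - s) *v x)) +
    (\<integral>\<^sup>+ t. indicator {s..T} t * (ennreal (exp (exponent i s - exponent i t)) *
        (\<Sum>j\<in>-{i}. ennreal (compiler_rate w dw lam i j t) * G j t)) \<partial>lborel) + ennreal (r * (1 - exp (- (lam * T))))"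
proof -
  define q where "q j t = 1 + inner (y j t) (gate i (t - s) *v x)" for j t
  have sT: "s \<le> T" using s by simp
  have in_T: "t \<in> {0..T}" if "t \<in> {s..T}" for t using that s by auto
  have q_nonneg: "0 \<le> q j t" if "t \<in> {s..T}" for j t
    unfolding q_def using overlap_bounds(1)[OF in_T[OF that]] x by (simp add: norm_gate)
  have deriv: "((\<lambda>t. surv i s t * q i t) has_real_derivative - (surv i s t * (\<Sum>j\<in>-{i}. rate j t * q j t))) (at t within {s..T})"
    if t: "t \<in> {s..T}" for t
  proof -
    have "(\<Sum>j\<in>-{i}. rate j t * q j t) = (lam - rate i t) + (\<Sum>j\<in>-{i}. rate j t * inner (y j t) (gate i (t - s) *v x))"
      by (simp add: q_def distrib_left sum.distrib rate_sum_other[OF in_T[OF t]])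
    then show ?thesis
      using DERIV_add[OF surv_deriv[OF s t, of i] overlap_deriv[OF s t, of i x]]
      by (simp add: q_def[abs_def] distrib_left)
  qed
  have g_nonneg: "0 \<le> surv i s t * (\<Sum>j\<in>-{i}. rate j t * q j t)" if t: "t \<in> {s..T}" for t
    using surv_pos[of i s t] q_nonneg[OF t] rate_nonneg'[OF in_T[OF t]]
    by (intro mult_nonneg_nonneg sum_nonneg) auto
  have int: "(\<integral>\<^sup>+ t. indicator {s..T} t * ennreal (surv i s t * (\<Sum>j\<in>-{i}. rate j t * q j t)) \<partial>lborel) =
      ennreal (q i s - surv i s T * q i T)"
    using nn_integral_neg_derivative[OF sT deriv g_nonneg] by simp
  have exit_int: "(\<integral>\<^sup>+ t. indicator {s..T} t * ennreal (surv i s t * (lam - rate i t) * r) \<partial>lborel) = ennreal (r * (1 - surv i s T))"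
  proof -
    have "((\<lambda>t. r * surv i s t) has_real_derivative - (surv i s t * (lam - rate i t) * r)) (at t within {s..T})" if t: "t \<in> {s..T}" for t
      by (rule DERIV_cong[OF DERIV_cmult[OF surv_deriv[OF s t, of i]]]) (simp add: algebra_simps)
    moreover have "0 \<le> surv i s t * (lam - rate i t) * r" if t: "t \<in> {s..T}" for t
      using surv_pos[of i s t] rate_le[OF in_T[OF t], of i] r by simp
    ultimately show ?thesis
      using nn_integral_neg_derivative[OF sT, of "\<lambda>t. r * surv i s t" "\<lambda>t. surv i s t * (lam - rate i t) * r"] 
      by (simp add: algebra_simps)
  qed
  define I where "I t = indicator {s..T} t * (ennreal (exp (exponent i s - exponent i t)) *
        (\<Sum>j\<in>-{i}. ennreal (compiler_rate w dw lam i j t) * G j t))" for t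
  \<comment> \<open>\<open>G\<close> is assumed measurable after cut-off to \<open>{0..T}\<close>,
    which contains \<open>{s..T}\<close>.\<close>
  have I_eq: "I = (\<lambda>t. indicator {s..T} t * (ennreal (exp (exponent i s - exponent i t)) *
        (\<Sum>j\<in>-{i}. ennreal (compiler_rate w dw lam i j t) * (indicator {0..T} t * G j t))))"
    using in_T by (auto simp: I_def indicator_def fun_eq_iff)
  note [measurable] = G_meas
  have I_meas: "I \<in> borel_measurable borel" unfolding I_eq by measurable
  have exit_meas: "(\<lambda>t. indicator {s..T} t * ennreal (surv i s t * (lam - rate i t) * r)) \<in> borel_measurable lborel"
    unfolding surv_def rate_def by measurable
  have le: "indicator {s..T} t * ennreal (surv i s t * (\<Sum>j\<in>-{i}. rate j t * q j t)) \<le>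
      I t + indicator {s..T} t * ennreal (surv i s t * (lam - rate i t) * r)" for t
  proof (cases "t \<in> {s..T}")
    case True
    have "ennreal (\<Sum>j\<in>-{i}. rate j t * q j t) = (\<Sum>j\<in>-{i}. ennreal (rate j t) * ennreal (q j t))"
      using q_nonneg[OF True] rate_nonneg'[OF in_T[OF True]] by (simp add: sum_ennreal[symmetric] ennreal_mult)
    also have "\<dots> \<le> (\<Sum>j\<in>-{i}. ennreal (rate j t) * (G j t + ennreal r))"
      unfolding q_def by (intro sum_mono mult_left_mono G True) auto
    also have "\<dots> = (\<Sum>j\<in>-{i}. ennreal (rate j t) * G j t) + ennreal (\<Sum>j\<in>-{i}. rate j t) * ennreal r"
      using rate_nonneg'[OF in_T[OF True]] by (simp add: distrib_left sum.distrib sum_distrib_right[symmetric] sum_ennreal)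
    also have "\<dots> = (\<Sum>j\<in>-{i}. ennreal (compiler_rate w dw lam i j t) * G j t) + ennreal ((lam - rate i t) * r)"
      unfolding rate_sum_other[OF in_T[OF True]] compiler_rate_eq[of i _ t]
      using r rate_le[OF in_T[OF True], of i] by (simp add: ennreal_mult)
    finally have "ennreal (surv i s t) * ennreal (\<Sum>j\<in>-{i}. rate j t * q j t) \<le> ennreal (surv i s t) * \<dots>"
      by (intro mult_left_mono) auto
    then show ?thesis
      using True surv_pos[of i s t] by (simp add: I_def surv_def[symmetric] ennreal_mult' distrib_left mult.assoc)
  qed simp
  have "ennreal (q i s) = ennreal (surv i s T * q i T + (q i s - surv i s T * q i T))" by simp
  also have "\<dots> \<le> ennreal (surv i s T * q i T) + ennreal (q i s - surv i s T * q i T)" by (rule ennreal_add_le)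
  also have "ennreal (q i s - surv i s T * q i T) \<le>
      (\<integral>\<^sup>+ t. I t + indicator {s..T} t * ennreal (surv i s t * (lam - rate i t) * r) \<partial>lborel)"
    unfolding int[symmetric] by (intro nn_integral_mono le)
  also have "\<dots> = (\<integral>\<^sup>+ t. I t \<partial>lborel) + ennreal (r * (1 - surv i s T))"
    unfolding exit_int[symmetric] using I_meas exit_meas by (intro nn_integral_add) auto
  \<comment> \<open>Survival until \<open>T\<close> has probability at least
    \<open>exp (- (lam * T))\<close> from every start, so the contraction factor is uniform in
    \<open>i\<close> and \<open>s\<close>.\<close>
  also have "ennreal (r * (1 - surv i s T)) \<le> ennreal (r * (1 - exp (- (lam * T))))"
    using surv_ge[of s i] s r by (intro ennreal_leI mult_left_mono) auto
  finally show ?thesis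
    using surv_pos[of i s T] by (simp add: q_def gate_0 y_T I_def ennreal_mult' add.assoc add_left_mono add_right_mono)
qed

end

section \<open>From the backward equation to the expected overlap\<close>

context backward_equation
begin

text \<open>Iterating \<open>overlap_step\<close>, each jump contributes a factor below one. The
  base case takes \<open>G = 0\<close> and remainder \<open>2\<close>, the trivial bound on the
  shifted overlap.\<close>

lemma partial_integral_overlap:
  assumes "s \<in> {0..T}" "norm x = 1"
  shows "ennreal (1 + inner (y i s) x) \<le>
    partial_integral m i s (\<lambda>l. ennreal (1 + inner \<phi> (circuit H l *v x))) +
    ennreal (2 * (1 - exp (- (lam * T))) ^ Suc m)"
  using assms
proof (induction m arbitrary: i s x)
  case 0
  have "ennreal (1 + inner (y i s) x) \<le> ennreal (surv i s T) * ennreal (1 + inner \<phi> (gate i (T - s) *v x)) +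
    (\<integral>\<^sup>+ t. indicator {s..T} t * (ennreal (exp (exponent i s - exponent i t)) *
        (\<Sum>j\<in>-{i}. ennreal (compiler_rate w dw lam i j t) * 0)) \<partial>lborel) + ennreal (2 * (1 - exp (- (lam * T))))"
  proof (rule overlap_step[OF 0])
    fix j t assume "t \<in> {s..T}"
    then have "t \<in> {0..T}" using 0 by auto
    from overlap_bounds(2)[OF this, of "gate i (t - s) *v x" j] 0
    show "ennreal (1 + inner (y j t) (gate i (t - s) *v x)) \<le> 0 + ennreal 2"
      using norm_gate[of i "t - s" x] by (simp only: add_0_left) (rule ennreal_leI, simp)
  qed auto
  then show ?case
    using 0 survival_eq[of s T i] unfolding partial_integral_0 circuit_Cons by (simp add: surv_def)
next
  case (Suc m)
  let ?f = "\<lambda>x l. ennreal (1 + inner \<phi> (circuit H l *v x))"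
  have meas: "?f x \<in> borel_measurable path_algebra" for x
  proof -
    have "(\<lambda>l. circuit H l *v x) \<in> borel_measurable path_algebra"
      by (rule measurable_compose[OF measurable_circuit[of H]], rule borel_measurable_continuous_onI,
          rule linear_continuous_on, rule bounded_bilinear.bounded_linear_left[OF bounded_bilinear_matrix_vector_mult])
    note [measurable] = this
    show ?thesis by measurable
  qed
  \<comment> \<open>The first gate is moved onto the input vector, which is why the induction ranges
    over \<open>x\<close>.\<close>
  have f_Cons: "?f x ((i, t - s) # l) = ?f (gate i (t - s) *v x) l" for t l
    unfolding circuit_Cons ..
  have "ennreal (1 + inner (y i s) x) \<le> ennreal (surv i s T) * ennreal (1 + inner \<phi> (gate i (T - s) *v x)) +
    (\<integral>\<^sup>+ t. indicator {s..T} t * (ennreal (exp (exponent i s - exponent i t)) *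
        (\<Sum>j\<in>-{i}. ennreal (compiler_rate w dw lam i j t) * partial_integral m j t (\<lambda>l. ?f x ((i, t - s) # l)))) \<partial>lborel)
    + ennreal ((2 * (1 - exp (- (lam * T))) ^ Suc m) * (1 - exp (- (lam * T))))"
  proof (rule overlap_step[OF Suc.prems])
    show "0 \<le> 2 * (1 - exp (- (lam * T))) ^ Suc m"
      using lam_nonneg T_nonneg by (intro mult_nonneg_nonneg zero_le_power) auto
    show "(\<lambda>t. indicator {0..T} t * partial_integral m j t (\<lambda>l. ?f x ((i, t - s) # l))) \<in> borel_measurable borel" for j
      by (rule measurable_partial_integral_Cons[OF meas])
    fix j t assume "t \<in> {s..T}"
    then have t: "t \<in> {0..T}" using Suc.prems by auto
    show "ennreal (1 + inner (y j t) (gate i (t - s) *v x))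
      \<le> partial_integral m j t (\<lambda>l. ?f x ((i, t - s) # l)) + ennreal (2 * (1 - exp (- (lam * T))) ^ Suc m)"
      unfolding f_Cons by (rule Suc.IH[OF t]) (simp add: norm_gate Suc.prems)
  qed
  also have "(2 * (1 - exp (- (lam * T))) ^ Suc m) * (1 - exp (- (lam * T))) = 2 * (1 - exp (- (lam * T))) ^ Suc (Suc m)"
    by (simp add: mult_ac)
  finally show ?case
    using Suc.prems survival_eq[of s T i] circuit_Cons[of i "T - s" "[]" x]
    unfolding partial_integral_Suc[OF meas Suc.prems(1)] by (simp add: surv_def)
qed

lemma expectation_overlap:
  assumes "norm x = 1"
  shows "ennreal (1 + inner (\<Sum>i\<in>UNIV. w i 0 *\<^sub>R y i 0) x) \<le>
    path_expectation (\<lambda>i. w i 0) (\<lambda>l. ennreal (1 + inner \<phi> (circuit H l *v x)))"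
proof -
  have 0: "0 \<in> {0..T}" using T_nonneg by simp
  have "ennreal (\<Sum>i\<in>UNIV. w i 0 * (1 + inner (y i 0) x)) \<le>
    path_expectation (\<lambda>i. w i 0) (\<lambda>l. ennreal (1 + inner \<phi> (circuit H l *v x)))"
  proof (rule path_expectation_ge[where r="\<lambda>m. 2 * (1 - exp (- (lam * T))) ^ Suc m"])
    show "(\<lambda>m. 2 * (1 - exp (- (lam * T))) ^ Suc m) \<longlonglongrightarrow> 0"
      by (rule tendsto_mult_right_zero, rule LIMSEQ_Suc, rule LIMSEQ_power_zero)
         (use lam_nonneg T_nonneg in auto)
    show "0 \<le> 1 + inner (y i 0) x" for i using overlap_bounds(1)[OF 0 assms] .
  qed (use partial_integral_overlap[OF 0 assms] w_nonneg[OF 0] in auto)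
  also have "(\<Sum>i\<in>UNIV. w i 0 * (1 + inner (y i 0) x)) = 1 + inner (\<Sum>i\<in>UNIV. w i 0 *\<^sub>R y i 0) x"
    by (simp add: distrib_left sum.distrib w_sum[OF 0] inner_sum_left)
  finally show ?thesis .
qed

section \<open>The mean backward solution against the exact evolution\<close>

definition mean :: "real \<Rightarrow> complex^'n" where "mean t = (\<Sum>i\<in>UNIV. w i t *\<^sub>R y i t)"

text \<open>The derivative of the weights cancels in the mean, because the jump rates \<open>dw j + lam * w j\<close>
  transport the weights.\<close>

lemma mean_deriv:
  assumes t: "t \<in> {0..T}"
  shows "(mean has_vector_derivative (\<Sum>i\<in>UNIV. w i t *\<^sub>R (gen i *v y i t))) (at t within {0..T})"
proof -
  let ?Y = "\<Sum>j\<in>UNIV. rate j t *\<^sub>R y j t"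
  have "(mean has_vector_derivative (\<Sum>i\<in>UNIV. w i t *\<^sub>R (gen i *v y i t + lam *\<^sub>R y i t - ?Y) + dw i t *\<^sub>R y i t)) (at t within {0..T})"
    unfolding mean_def[abs_def]
    by (intro has_vector_derivative_sum has_vector_derivative_scaleR w_deriv y_deriv t)
  also have "(\<Sum>i\<in>UNIV. w i t *\<^sub>R (gen i *v y i t + lam *\<^sub>R y i t - ?Y) + dw i t *\<^sub>R y i t) =
     (\<Sum>i\<in>UNIV. w i t *\<^sub>R (gen i *v y i t)) + ?Y - (\<Sum>i\<in>UNIV. w i t) *\<^sub>R ?Y"
    by (simp add: rate_def algebra_simps sum.distrib sum_subtractf scaleR_sum_left)
  finally show ?thesis by (simp add: w_sum[OF t])
qed

context
  fixes \<mu> :: "real \<Rightarrow> real"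
  assumes \<mu>_0: "\<mu> 0 = 0" and \<mu>_deriv: "\<And>r. (\<mu> has_real_derivative 1 - lam * \<mu> r) (at r)"
begin

text \<open>The jump term is common to all nodes and drops out of the difference. The factor
  \<open>exp (- lam * t)\<close> removes the \<open>lam\<close> term, leaving two generator terms of
  norm at most \<open>C\<close> each; the majorant in \<open>\<mu>\<close> has precisely this rate
  \<open>2 * C\<close> after the same scaling.\<close>

lemma norm_y_diff_le:
  assumes s: "s \<in> {0..T}"
  shows "norm (y i s - y j s) \<le> 2 * C * \<mu> (T - s)"
proof -
  have "norm (exp (- lam * T) *\<^sub>R (y i T - y j T) - exp (- lam * s) *\<^sub>R (y i s - y j s)) \<le>
    - (2 * C) * (exp (- lam * T) * \<mu> (T - T)) - - (2 * C) * (exp (- lam * s) * \<mu> (T - s))"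
  proof (rule norm_diff_le_of_vector_derivative[where S="{0..T}"])
    fix t assume "t \<in> {s..T}"
    then have t: "t \<in> {0..T}" using s by auto
    have e: "((\<lambda>t. exp (- lam * t)) has_real_derivative - lam * exp (- lam * t)) (at t within {0..T})"
      by (auto intro!: derivative_eq_intros)
    have "((\<lambda>t. exp (- lam * t) *\<^sub>R (y i t - y j t)) has_vector_derivative
       exp (- lam * t) *\<^sub>R ((gen i *v y i t + lam *\<^sub>R y i t - (\<Sum>j\<in>UNIV. rate j t *\<^sub>R y j t)) -
         (gen j *v y j t + lam *\<^sub>R y j t - (\<Sum>j\<in>UNIV. rate j t *\<^sub>R y j t))) +
       (- lam * exp (- lam * t)) *\<^sub>R (y i t - y j t)) (at t within {0..T})"
      by (intro has_vector_derivative_scaleR e has_vector_derivative_diff y_deriv t)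
    also have "exp (- lam * t) *\<^sub>R ((gen i *v y i t + lam *\<^sub>R y i t - (\<Sum>j\<in>UNIV. rate j t *\<^sub>R y j t)) -
         (gen j *v y j t + lam *\<^sub>R y j t - (\<Sum>j\<in>UNIV. rate j t *\<^sub>R y j t))) +
       (- lam * exp (- lam * t)) *\<^sub>R (y i t - y j t) = exp (- lam * t) *\<^sub>R (gen i *v y i t - gen j *v y j t)"
      by (simp add: algebra_simps)
    finally show "((\<lambda>t. exp (- lam * t) *\<^sub>R (y i t - y j t)) has_vector_derivative
       exp (- lam * t) *\<^sub>R (gen i *v y i t - gen j *v y j t)) (at t within {0..T})" .
    have "((\<lambda>t. \<mu> (T - t)) has_real_derivative (1 - lam * \<mu> (T - t)) * (- 1)) (at t within {0..T})"
      by (rule DERIV_chain2[OF \<mu>_deriv]) (auto intro!: derivative_eq_intros)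
    from DERIV_cmult[OF DERIV_mult[OF e this], of "- (2 * C)"]
    show "((\<lambda>t. - (2 * C) * (exp (- lam * t) * \<mu> (T - t))) has_real_derivative exp (- lam * t) * (2 * C)) (at t within {0..T})"
      by (rule DERIV_cong) (simp add: algebra_simps)
    have "norm (gen k *v y k t) \<le> C" for k
      using gen_bound[of k "y k t"] norm_y_le[OF t, of k] C_nonneg mult_left_mono[of "norm (y k t)" 1 C] by simp
    from norm_triangle_le_diff[OF add_mono[OF this[of i] this[of j]]]
    show "norm (exp (- lam * t) *\<^sub>R (gen i *v y i t - gen j *v y j t)) \<le> exp (- lam * t) * (2 * C)"
      by simp
  qed (use s in auto)
  then have "exp (- lam * s) * norm (y i s - y j s) \<le> exp (- lam * s) * (2 * C * \<mu> (T - s))"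
    by (simp add: y_T \<mu>_0 mult_ac)
  then show ?thesis by simp
qed

lemma norm_mean_diff_le:
  assumes t: "t \<in> {0..T}"
  shows "norm (mean t - y i t) \<le> 2 * C * \<mu> (T - t)"
proof -
  have "mean t - y i t = (\<Sum>j\<in>UNIV. w j t *\<^sub>R (y j t - y i t))"
    using w_sum[OF t] by (simp add: mean_def scaleR_diff_right sum_subtractf scaleR_sum_left[symmetric])
  also have "norm \<dots> \<le> (\<Sum>j\<in>UNIV. w j t * (2 * C * \<mu> (T - t)))"
    using norm_y_diff_le[OF t] w_nonneg[OF t] by (intro sum_norm_le) (auto intro!: mult_left_mono)
  also have "\<dots> = 2 * C * \<mu> (T - t)" by (simp add: sum_distrib_right[symmetric] w_sum[OF t])
  finally show ?thesis .
qed

text \<open>By skewness the derivative of the overlap sees only the deviations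
  \<open>mean t - y i t\<close>: one factor \<open>C\<close> comes from the generator and
  \<open>2 * C * \<mu> (T - t)\<close> from the spread. At time \<open>T\<close> all
  \<open>y i\<close> equal \<open>u T\<close>, so the overlap there is one.\<close>

lemma mean_overlap:
  assumes J_0: "J 0 = 0" and J_deriv: "\<And>r. (J has_real_derivative \<mu> r) (at r)"
    and u: "\<And>t. t \<in> {0..T} \<Longrightarrow> (u has_vector_derivative (\<Sum>i\<in>UNIV. w i t *\<^sub>R (gen i *v u t))) (at t within {0..T})"
    and norm_u: "\<And>t. t \<in> {0..T} \<Longrightarrow> norm (u t) = 1"
    and u_T: "u T = \<phi>"
  shows "1 - 2 * C\<^sup>2 * J T \<le> inner (mean 0) (u 0)"
proof -
  have "norm (inner (mean T) (u T) - inner (mean 0) (u 0)) \<le> - (2 * C\<^sup>2) * J (T - T) - - (2 * C\<^sup>2) * J (T - 0)"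
  proof (rule norm_diff_le_of_vector_derivative[where S="{0..T}"])
    fix t assume t: "t \<in> {0..T}"
    have "((\<lambda>t. inner (mean t) (u t)) has_vector_derivative
        inner (mean t) (\<Sum>i\<in>UNIV. w i t *\<^sub>R (gen i *v u t)) + inner (\<Sum>i\<in>UNIV. w i t *\<^sub>R (gen i *v y i t)) (u t)) (at t within {0..T})"
      by (rule bounded_bilinear.has_vector_derivative[OF bounded_bilinear_inner mean_deriv[OF t] u[OF t]])
    also have "inner (mean t) (\<Sum>i\<in>UNIV. w i t *\<^sub>R (gen i *v u t)) + inner (\<Sum>i\<in>UNIV. w i t *\<^sub>R (gen i *v y i t)) (u t) =
      (\<Sum>i\<in>UNIV. w i t * inner (mean t - y i t) (gen i *v u t))"
      by (simp add: inner_sum_left inner_sum_right gen_skew inner_diff_left right_diff_distrib sum_subtractf sum_negf)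
    finally show "((\<lambda>t. inner (mean t) (u t)) has_vector_derivative
        (\<Sum>i\<in>UNIV. w i t * inner (mean t - y i t) (gen i *v u t))) (at t within {0..T})" .
    have "((\<lambda>t. J (T - t)) has_real_derivative \<mu> (T - t) * (- 1)) (at t within {0..T})"
      by (rule DERIV_chain2[OF J_deriv]) (auto intro!: derivative_eq_intros)
    from DERIV_cmult[OF this, of "- (2 * C\<^sup>2)"]
    show "((\<lambda>t. - (2 * C\<^sup>2) * J (T - t)) has_real_derivative 2 * C\<^sup>2 * \<mu> (T - t)) (at t within {0..T})"
      by (rule DERIV_cong) simp
    have "norm (\<Sum>i\<in>UNIV. w i t * inner (mean t - y i t) (gen i *v u t)) \<le> (\<Sum>i\<in>UNIV. w i t * (2 * C * \<mu> (T - t) * C))"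
    proof (rule sum_norm_le)
      fix i
      have "\<bar>inner (mean t - y i t) (gen i *v u t)\<bar> \<le> norm (mean t - y i t) * norm (gen i *v u t)"
        by (rule Cauchy_Schwarz_ineq2)
      also have "\<dots> \<le> 2 * C * \<mu> (T - t) * C"
        using norm_mean_diff_le[OF t, of i] gen_bound[of i "u t"] norm_u[OF t]
          order.trans[OF norm_ge_zero norm_mean_diff_le[OF t, of i]]
        by (intro mult_mono) auto
      finally show "norm (w i t * inner (mean t - y i t) (gen i *v u t)) \<le> w i t * (2 * C * \<mu> (T - t) * C)"
        using w_nonneg[OF t, of i] by (simp add: abs_mult mult_left_mono)
    qed
    also have "\<dots> = 2 * C\<^sup>2 * \<mu> (T - t)"
      by (simp add: sum_distrib_right[symmetric] w_sum[OF t] power2_eq_square)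
    finally show "norm (\<Sum>i\<in>UNIV. w i t * inner (mean t - y i t) (gen i *v u t)) \<le> 2 * C\<^sup>2 * \<mu> (T - t)" .
  qed (use T_nonneg in auto)
  moreover have "inner (mean T) (u T) = 1"
    using T_nonneg w_sum[of T]
    by (simp add: mean_def y_T u_T scaleR_sum_left[symmetric] norm_\<phi> power2_norm_eq_inner[symmetric])
  ultimately show ?thesis using J_0 by simp
qed

end

end

section \<open>Fidelity between the compiler and the exact evolution\<close>

context hamiltonian_compiler
begin

lemma total_hamiltonian_gen: "cscale (- \<i>) (total_hamiltonian H w t) = (\<Sum>i\<in>UNIV. w i t *\<^sub>R gen i)"
  by (simp add: total_hamiltonian_def gen_def cscale_def vec_eq_iff sum_distrib_left sum_negf)

lemma total_hamiltonian_mult: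
  "cscale (- \<i>) (total_hamiltonian H w t) *v x = (\<Sum>i\<in>UNIV. w i t *\<^sub>R (gen i *v x))"
  unfolding total_hamiltonian_gen
  by (simp add: bounded_bilinear.sum_left[OF bounded_bilinear_matrix_vector_mult]
      bounded_bilinear.scaleR_left[OF bounded_bilinear_matrix_vector_mult])

lemma exact_evolution:
  fixes \<psi> :: "complex^'n"
  defines "u \<equiv> \<lambda>t. time_ordered_exp (\<lambda>t. cscale (- \<i>) (total_hamiltonian H w t)) t *v \<psi>"
  shows "u 0 = \<psi>"
    and "t \<in> {0..T} \<Longrightarrow> (u has_vector_derivative (\<Sum>i\<in>UNIV. w i t *\<^sub>R (gen i *v u t))) (at t within {0..T})"
    and "t \<in> {0..T} \<Longrightarrow> norm (u t) = norm \<psi>"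
    and "exact_channel H w T (pure_state \<psi>) = pure_state (u T)"
proof -
  let ?A = "\<lambda>t. cscale (- \<i>) (total_hamiltonian H w t)"
  have cont: "continuous_on {0..T} ?A"
    unfolding total_hamiltonian_gen by (intro continuous_intros w_continuous)
  show u0: "u 0 = \<psi>" unfolding u_def time_ordered_exp_flow(1)[OF cont T_nonneg] by simp
  show deriv: "(u has_vector_derivative (\<Sum>i\<in>UNIV. w i t *\<^sub>R (gen i *v u t))) (at t within {0..T})" if "t \<in> {0..T}" for t
    using flow_vector[OF time_ordered_exp_flow(2)[OF cont T_nonneg that], of \<psi>]
    unfolding u_def total_hamiltonian_mult .
  have skew: "inner y (\<Sum>i\<in>UNIV. w i t *\<^sub>R (gen i *v y)) = 0" for y t
  proof -
    have "inner y (gen i *v y) = 0" for i using gen_skew[of i y y] by (simp add: inner_commute)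
    then show ?thesis by (simp add: inner_sum_right)
  qed
  show "norm (u t) = norm \<psi>" if "t \<in> {0..T}"
    using skew_flow_norm[where L="\<lambda>t y. \<Sum>i\<in>UNIV. w i t *\<^sub>R (gen i *v y)", OF deriv skew that] u0 by simp
  show "exact_channel H w T (pure_state \<psi>) = pure_state (u T)"
    unfolding exact_channel_def unitary_channel_pure_state u_def ..
qed

text \<open>The fidelity of the averaged circuit is bounded below through
  \<open>\<bar>z\<bar>\<^sup>2 \<ge> 2 Re z - 1\<close>, which leaves an expectation that is linear in the circuit.\<close>

lemma fidelity_compiler_ge:
  assumes \<psi>: "norm \<psi> = 1" and \<phi>: "norm \<phi> = 1" and r: "-1 \<le> r"
    and le: "ennreal (1 + r) \<le> path_expectation (\<lambda>i. w i 0) (\<lambda>l. ennreal (1 + inner \<phi> (circuit H l *v \<psi>)))"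
  shows "2 * r - 1 \<le> fidelity \<phi> (compiler_channel H w dw lam T (pure_state \<psi>))"
proof -
  let ?P = "compiler_law w dw lam T"
  have sets_P: "sets ?P = sets path_algebra" and space_P: "space ?P = UNIV"
    by (simp_all add: compiler_law_def sets_realization_law)
  interpret P: finite_measure ?P
    using emeasure_compiler_law_le by (intro finite_measureI) (auto simp: space_P top_unique)
  have vec_meas: "(\<lambda>l. circuit H l *v \<psi>) \<in> borel_measurable path_algebra"
    by (rule measurable_compose[OF measurable_circuit[of H]], rule borel_measurable_continuous_onI,
        rule linear_continuous_on, rule bounded_bilinear.bounded_linear_left[OF bounded_bilinear_matrix_vector_mult])
  have vec_meas_P [measurable]: "(\<lambda>l. circuit H l *v \<psi>) \<in> borel_measurable ?P"
    using vec_meas by (simp add: sets_P cong: measurable_cong_sets)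
  have state_meas: "(\<lambda>l. pure_state (circuit H l *v \<psi>)) \<in> borel_measurable ?P"
  proof (rule measurable_compose[OF vec_meas_P])
    have "continuous_on UNIV (pure_state :: complex^'n \<Rightarrow> _)"
      unfolding pure_state_def[abs_def] by (intro continuous_intros)
    then show "(pure_state :: complex^'n \<Rightarrow> _) \<in> borel_measurable borel" by (rule borel_measurable_continuous_onI)
  qed
  have int_state: "integrable ?P (\<lambda>l. pure_state (circuit H l *v \<psi>))"
    by (rule P.integrable_const_bound[of _ 1]) (auto simp: norm_pure_state norm_circuit[OF herm] \<psi> state_meas)
  define f where "f l = 1 + inner \<phi> (circuit H l *v \<psi>)" for l
  have f_bounds: "0 \<le> f l" "f l \<le> 2" for l
    using Cauchy_Schwarz_ineq2[of \<phi> "circuit H l *v \<psi>"] norm_circuit[OF herm, where l=l and x=\<psi>] \<psi> \<phi>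
    by (auto simp: f_def abs_le_iff)
  have f_meas [measurable]: "f \<in> borel_measurable ?P" unfolding f_def[abs_def] by measurable
  have int_f: "integrable ?P f"
    by (rule P.integrable_const_bound[of _ 2]) (use f_bounds in auto)
  have "ennreal (1 + r) \<le> (\<integral>\<^sup>+ l. ennreal (f l) \<partial>?P)"
    unfolding compiler_law_def
    by (subst nn_integral_realization_law[OF T_nonneg]) (use le vec_meas in \<open>auto simp: f_def\<close>)
  also have "\<dots> = ennreal (\<integral>l. f l \<partial>?P)"
    by (rule nn_integral_eq_integral[OF int_f]) (use f_bounds in auto)
  finally have "1 + r \<le> (\<integral>l. f l \<partial>?P)"
    using f_bounds(1) by (subst (asm) ennreal_le_iff) (auto intro!: integral_nonneg)
  have mass: "measure ?P (space ?P) \<le> 1"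
    using emeasure_compiler_law_le by (simp add: space_P measure_def enn2real_leI)
  \<comment> \<open>With \<open>f = 1 + Re z\<close> the bound \<open>2 Re z - 1\<close> reads
    \<open>2 * f - 3\<close>. The constant is subtracted under the integral, so mass at most one is
    the favourable direction.\<close>
  have "2 * r - 1 \<le> 2 * (\<integral>l. f l \<partial>?P) - 3 * measure ?P (space ?P)"
    using \<open>1 + r \<le> _\<close> mass by simp
  also have "\<dots> = (\<integral>l. 2 * f l - 3 \<partial>?P)"
    using int_f by simp
  also have "\<dots> \<le> (\<integral>l. fidelity \<phi> (pure_state (circuit H l *v \<psi>)) \<partial>?P)"
  proof (rule integral_mono)
    show "integrable ?P (\<lambda>l. 2 * f l - 3)" using int_f by simp
    show "integrable ?P (\<lambda>l. fidelity \<phi> (pure_state (circuit H l *v \<psi>)))"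
      by (rule integrable_bounded_linear[OF bounded_linear_fidelity int_state])
    show "2 * f l - 3 \<le> fidelity \<phi> (pure_state (circuit H l *v \<psi>))" for l
      using fidelity_pure_state_ge[of \<phi> "circuit H l *v \<psi>"] by (simp add: f_def)
  qed
  also have "\<dots> = fidelity \<phi> (\<integral>l. pure_state (circuit H l *v \<psi>) \<partial>?P)"
    by (rule integral_bounded_linear[OF bounded_linear_fidelity int_state])
  finally show ?thesis unfolding compiler_channel_def unitary_channel_pure_state .
qed

lemma channel_fidelity_ge:
  "1 - 4 * C\<^sup>2 * T\<^sup>2 / (1 + lam * T) \<le> channel_fidelity (exact_channel H w T) (compiler_channel H w dw lam T)"
  unfolding channel_fidelity_def
proof (rule cInf_greatest)
  let ?u = "\<lambda>\<psi> t. time_ordered_exp (\<lambda>t. cscale (- \<i>) (total_hamiltonian H w t)) t *v \<psi>"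
  have TT: "T \<in> {0..T}" using T_nonneg by simp
  \<comment> \<open>The infimum of an empty set would be unspecified, so an admissible pair is
    exhibited.\<close>
  have "norm (axis undefined 1 :: complex^'n) = 1" by simp
  moreover have "norm (?u (axis undefined 1) T) = 1" using exact_evolution(3)[OF TT] by simp
  ultimately show "{fidelity \<phi> (compiler_channel H w dw lam T (pure_state \<psi>)) |\<psi> \<phi>.
      norm \<psi> = 1 \<and> norm \<phi> = 1 \<and> exact_channel H w T (pure_state \<psi>) = pure_state \<phi>} \<noteq> {}"
    using exact_evolution(4) by blast
  fix F assume "F \<in> {fidelity \<phi> (compiler_channel H w dw lam T (pure_state \<psi>)) |\<psi> \<phi>.
      norm \<psi> = 1 \<and> norm \<phi> = 1 \<and> exact_channel H w T (pure_state \<psi>) = pure_state \<phi>}"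
  then obtain \<psi> \<phi>' where \<psi>: "norm \<psi> = 1" and F: "F = fidelity \<phi>' (compiler_channel H w dw lam T (pure_state \<psi>))"
    and "exact_channel H w T (pure_state \<psi>) = pure_state \<phi>'" by blast
  define \<phi> where "\<phi> = ?u \<psi> T"
  \<comment> \<open>The given output vector may differ from the evolved one by a phase, which the
    fidelity does not see.\<close>
  have "pure_state \<phi>' = pure_state \<phi>"
    using exact_evolution(4)[of \<psi>] \<open>exact_channel H w T (pure_state \<psi>) = pure_state \<phi>'\<close> by (simp add: \<phi>_def)
  then have F: "F = fidelity \<phi> (compiler_channel H w dw lam T (pure_state \<psi>))"
    unfolding F fidelity_eq by simp
  have \<phi>: "norm \<phi> = 1" using exact_evolution(3)[OF TT, of \<psi>] \<psi> by (simp add: \<phi>_def)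
  obtain y where y: "\<And>i. y i T = \<phi>" "\<And>i t. t \<in> {0..T} \<Longrightarrow> (y i has_vector_derivative
     gen i *v y i t + lam *\<^sub>R y i t - (\<Sum>j\<in>UNIV. rate j t *\<^sub>R y j t)) (at t within {0..T})"
    using backward_solution[of \<phi>] by blast
  interpret backward_equation w dw lam T H C y \<phi>
    by unfold_locales (use y \<phi> in auto)
  obtain \<mu> J :: "real \<Rightarrow> real" where \<mu>: "\<mu> 0 = 0" "J 0 = 0"
    "\<And>r. (\<mu> has_real_derivative 1 - lam * \<mu> r) (at r)" "\<And>r. (J has_real_derivative \<mu> r) (at r)"
    "\<And>T. 0 \<le> T \<Longrightarrow> J T * (1 + lam * T) \<le> T\<^sup>2"
    using relaxation_functions[OF lam_nonneg] by blast
  have "1 - 2 * C\<^sup>2 * J T \<le> inner (mean 0) (?u \<psi> 0)"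
    by (rule mean_overlap[OF \<mu>(1,3,2,4)]) (use exact_evolution \<psi> in \<open>auto simp: \<phi>_def\<close>)
  then have ge: "1 - 2 * C\<^sup>2 * J T \<le> inner (mean 0) \<psi>" unfolding exact_evolution(1) .
  have 0: "0 \<in> {0..T}" using T_nonneg by simp
  have "norm (mean 0) \<le> (\<Sum>i\<in>UNIV. w i 0 * 1)"
    unfolding mean_def using w_nonneg[OF 0] norm_y_le[OF 0] by (intro sum_norm_le) (auto intro!: mult_left_le)
  then have "-1 \<le> inner (mean 0) \<psi>"
    using Cauchy_Schwarz_ineq2[of "mean 0" \<psi>] w_sum[OF 0] \<psi> by (simp add: abs_le_iff)
  from fidelity_compiler_ge[OF \<psi> \<phi> this expectation_overlap[OF \<psi>, folded mean_def]]
  have "2 * inner (mean 0) \<psi> - 1 \<le> F" unfolding F .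
  moreover have "J T \<le> T\<^sup>2 / (1 + lam * T)"
  proof -
    have "0 < 1 + lam * T" using lam_nonneg T_nonneg by (simp add: add_pos_nonneg)
    then show ?thesis using \<mu>(5)[OF T_nonneg] by (simp add: pos_le_divide_eq)
  qed
  then have "4 * C\<^sup>2 * J T \<le> 4 * C\<^sup>2 * (T\<^sup>2 / (1 + lam * T))" by (intro mult_left_mono) auto
  ultimately show "1 - 4 * C\<^sup>2 * T\<^sup>2 / (1 + lam * T) \<le> F" using ge by simp
qed

end

section \<open>Reduction to measurable data\<close>

lemma dyson_cong:
  assumes "\<And>s. s \<in> {0..T} \<Longrightarrow> A s = B s"
  shows "t \<in> {0..T} \<Longrightarrow> dyson A n t = dyson B n t"
proof (induction n arbitrary: t)
  case (Suc n)
  then show ?case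
    unfolding dyson.simps by (intro integral_cong arg_cong2[where f="(**)"] assms) auto
qed simp

lemma exact_channel_cong:
  assumes "0 \<le> T" "\<And>j t. t \<in> {0..T} \<Longrightarrow> w j t = v j t"
  shows "exact_channel H w T = exact_channel H v T"
proof -
  have "cscale (- \<i>) (total_hamiltonian H w t) = cscale (- \<i>) (total_hamiltonian H v t)" if "t \<in> {0..T}" for t
    using assms(2)[OF that] by (simp add: total_hamiltonian_def)
  then have "dyson (\<lambda>t. cscale (- \<i>) (total_hamiltonian H w t)) n T = dyson (\<lambda>t. cscale (- \<i>) (total_hamiltonian H v t)) n T" for n
    by (rule dyson_cong) (use assms(1) in auto)
  then show ?thesis by (simp add: exact_channel_def time_ordered_exp_def)
qed

lemma compiler_law_cong:
  assumes "\<And>j. w j 0 = v j 0" "\<And>j t. 0 \<le> t \<Longrightarrow> t < T \<Longrightarrow> w j t = v j t \<and> dw j t = dv j t"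
  shows "compiler_law w dw lam T = compiler_law v dv lam T"
proof -
  have "path_integral (compiler_rate w dw lam) T m i 0 f = path_integral (compiler_rate v dv lam) T m i 0 f" for m i f
    by (rule path_integral_cong) (use assms(2) in \<open>auto simp: compiler_rate_def\<close>)
  then show ?thesis by (simp add: compiler_law_def realization_law_def assms(1))
qed

text \<open>A limit of measurable forward difference quotients; at the right endpoint, where no
  forward quotient is available, the value is put in by hand.\<close>

lemma borel_measurable_interval_derivative:
  fixes f f' :: "real \<Rightarrow> real"
  assumes f': "\<And>t. t \<in> {0..T} \<Longrightarrow> (f has_real_derivative f' t) (at t within {0..T})"
    and f [measurable]: "(\<lambda>t. if t \<in> {0..T} then f t else 0) \<in> borel_measurable borel"
  shows "(\<lambda>t. if t \<in> {0..T} then f' t else 0) \<in> borel_measurable borel"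
proof (rule borel_measurable_LIMSEQ_metric)
  define g where "g t = (if t \<in> {0..T} then f t else 0)" for t
  have [measurable]: "g \<in> borel_measurable borel" using f by (simp add: g_def[abs_def])
  define d where "d n t = (if t = T then (if t \<in> {0..T} then f' T else 0) else if t \<in> {0..T} then
    (g (t + 1 / real (Suc n)) - g t) / (1 / real (Suc n)) else 0)" for n t
  show "d n \<in> borel_measurable borel" for n unfolding d_def[abs_def] by measurable
  fix t
  show "(\<lambda>n. d n t) \<longlonglongrightarrow> (if t \<in> {0..T} then f' t else 0)"
  proof (cases "t \<in> {0..T} \<and> t \<noteq> T")
    case True
    then have t: "t \<in> {0..T}" "t < T" by auto
    have lim: "(\<lambda>n. t + 1 / real (Suc n)) \<longlonglongrightarrow> t + 0"
      by (intro tendsto_add tendsto_const LIMSEQ_Suc lim_1_over_n)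
    have "\<forall>\<^sub>F n in sequentially. t + 1 / real (Suc n) < T"
      using order_tendstoD(2)[OF lim, of T] t by simp
    then have in_T: "\<forall>\<^sub>F n in sequentially. t + 1 / real (Suc n) \<in> {0..T}"
      by eventually_elim (use t in auto)
    have at: "filterlim (\<lambda>n. t + 1 / real (Suc n)) (at t within {0..T}) sequentially"
      unfolding filterlim_at using lim in_T by (auto elim: eventually_mono)
    have "((\<lambda>y. (f y - f t) / (y - t)) \<longlongrightarrow> f' t) (at t within {0..T})"
      using f'[OF t(1)] by (simp add: has_field_derivative_iff)
    from filterlim_compose[OF this at]
    have "(\<lambda>n. (f (t + 1 / real (Suc n)) - f t) / (t + 1 / real (Suc n) - t)) \<longlonglongrightarrow> f' t" .
    moreover have "\<forall>\<^sub>F n in sequentially. (f (t + 1 / real (Suc n)) - f t) / (t + 1 / real (Suc n) - t) = d n t"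
      using in_T by eventually_elim (use t in \<open>simp add: d_def g_def\<close>)
    ultimately show ?thesis using t by (simp add: tendsto_cong)
  next
    case False
    then have "d n t = (if t \<in> {0..T} then f' t else 0)" for n by (auto simp: d_def)
    then show ?thesis by simp
  qed
qed

text \<open>The hypotheses constrain \<open>w\<close> and \<open>dw\<close> only on
  \<open>{0..T}\<close>. Cutting both off there makes them Borel on the line, as the locale
  requires, and leaves the law and both channels unchanged.\<close>

lemma compiler_bounds:
  fixes H :: "'q::finite \<Rightarrow> complex^'n^'n" and w dw :: "'q \<Rightarrow> real \<Rightarrow> real" and C T \<alpha> \<beta> lam :: real
  assumes T: "0 \<le> T" and herm: "\<And>i. hermitian (H i)" and H: "\<And>i. onorm ((*v) (H i)) \<le> C"
    and w_deriv: "\<And>j t. t \<in> {0..T} \<Longrightarrow> (w j has_real_derivative dw j t) (at t within {0..T})"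
    and w_nonneg: "\<And>j t. t \<in> {0..T} \<Longrightarrow> 0 \<le> w j t"
    and w_sum: "\<And>t. t \<in> {0..T} \<Longrightarrow> (\<Sum>j\<in>UNIV. w j t) = 1"
    and rate: "\<And>j t. t \<in> {0..T} \<Longrightarrow> 0 \<le> dw j t + lam * w j t"
    and dw_sum: "\<And>t. 0 < T \<Longrightarrow> t \<in> {0..T} \<Longrightarrow> (\<Sum>j\<in>UNIV. dw j t) = 0"
    and \<alpha>: "0 \<le> \<alpha>" and \<beta>: "0 \<le> \<beta>" and lam: "0 \<le> lam"
  shows "1 - 4 * C\<^sup>2 * T\<^sup>2 / (1 + lam * T) \<le> channel_fidelity (exact_channel H w T) (compiler_channel H w dw lam T)"
    and "expected_gates \<alpha> \<beta> C w dw lam T \<le> ennreal (\<alpha> * (1 + lam * T) + \<beta> * C * T)"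
proof -
  have bl: "bounded_linear ((*v) (H i))" for i by (rule matrix_vector_linear)
  have C: "0 \<le> C" using onorm_pos_le[OF bl] H order.trans by blast
  have H_bound: "norm (H i *v x) \<le> C * norm x" for i x
    using onorm[OF bl, of i x] mult_right_mono[OF H[of i] norm_ge_zero[of x]] by linarith
  define v where "v j t = (if t \<in> {0..T} then w j t else 0)" for j t
  \<comment> \<open>For \<open>T = 0\<close> the derivative within \<open>{0..T}\<close> is arbitrary, so it is replaced by \<open>0\<close>.\<close>
  define dv where "dv j t = (if 0 < T \<and> t \<in> {0..T} then dw j t else 0)" for j t
  have v_deriv: "(v j has_real_derivative dv j t) (at t within {0..T})" if t: "t \<in> {0..T}" for j t
  proof (cases "0 < T")
    case True
    have "(v j has_real_derivative dw j t) (at t within {0..T})"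
      by (rule has_field_derivative_transform_within[OF w_deriv[OF t] zero_less_one t]) (simp add: v_def)
    then show ?thesis using True t by (simp add: dv_def)
  next
    case False
    then have "T = 0" using T by simp
    then have "at t within {0..T} = bot" using t by (simp add: at_within_eq_bot_iff)
    then show ?thesis by (simp add: has_field_derivative_iff)
  qed
  have v_meas: "v j \<in> borel_measurable borel" for j
  proof -
    have "(\<lambda>t. indicator {0..T} t *\<^sub>R w j t) \<in> borel_measurable borel"
      by (intro borel_measurable_continuous_on_indicator DERIV_continuous_on[OF w_deriv]) auto
    also have "(\<lambda>t. indicator {0..T} t *\<^sub>R w j t) = v j" by (auto simp: v_def indicator_def)
    finally show ?thesis .
  qed
  have dv_meas: "dv j \<in> borel_measurable borel" for j
  proof (cases "0 < T")
    case True
    then show ?thesis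
      using borel_measurable_interval_derivative[OF w_deriv v_meas[of j, unfolded v_def[abs_def]]]
      by (simp add: dv_def[abs_def])
  qed (simp add: dv_def[abs_def])
  interpret hamiltonian_compiler v dv lam T H C
  proof
    fix t assume t: "t \<in> {0..T}"
    show "(v j has_real_derivative dv j t) (at t within {0..T})" for j by (rule v_deriv[OF t])
    show "0 \<le> v j t" for j using w_nonneg t by (simp add: v_def)
    show "(\<Sum>j\<in>UNIV. v j t) = 1" using w_sum t by (simp add: v_def)
    show "(\<Sum>j\<in>UNIV. dv j t) = 0" using dw_sum t by (cases "0 < T") (simp_all add: dv_def)
    show "0 \<le> dv j t + lam * v j t" for j using rate[OF t, of j] w_nonneg[OF t, of j] lam t by (simp add: dv_def v_def)
  qed (use T lam v_meas dv_meas herm H_bound C in auto)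
  have law: "compiler_law w dw lam T = compiler_law v dv lam T"
    by (rule compiler_law_cong) (use T in \<open>auto simp: v_def dv_def\<close>)
  have channel: "compiler_channel H w dw lam T = compiler_channel H v dv lam T"
    by (simp add: compiler_channel_def[abs_def] law fun_eq_iff)
  have exact: "exact_channel H w T = exact_channel H v T"
    by (rule exact_channel_cong[OF T]) (simp add: v_def)
  show "1 - 4 * C\<^sup>2 * T\<^sup>2 / (1 + lam * T) \<le> channel_fidelity (exact_channel H w T) (compiler_channel H w dw lam T)"
    unfolding channel exact by (rule channel_fidelity_ge)
  show "expected_gates \<alpha> \<beta> C w dw lam T \<le> ennreal (\<alpha> * (1 + lam * T) + \<beta> * C * T)"
    using expected_gates_le[OF \<alpha> \<beta> C] unfolding expected_gates_def law .
qed

text \<open>\<open>K\<close> bounds the ratio \<open>- dw / w\<close> without dividing by a weight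
  that may vanish. The last hypothesis quantifies slow variation: for \<open>\<alpha> > 0\<close>
  and \<open>T > 0\<close> it says that the rate exhausting the gate budget is at least
  \<open>K\<close>, which makes the jump rates nonnegative.\<close>

theorem theorem1:
  fixes H :: "'q::finite \<Rightarrow> complex^'n^'n"
    and w dw :: "'q \<Rightarrow> real \<Rightarrow> real"
    and C T K \<alpha> \<beta> \<epsilon>\<^sub>0 :: real
  assumes "0 \<le> T"
    and "\<And>i. hermitian (H i)"
    and "\<And>i. onorm ((*v) (H i)) \<le> C"
    and "\<And>j t. t \<in> {0..T} \<Longrightarrow> (w j has_real_derivative dw j t) (at t within {0..T})"
    and "\<And>j t. t \<in> {0..T} \<Longrightarrow> 0 \<le> w j t"
    and "\<And>t. t \<in> {0..T} \<Longrightarrow> (\<Sum>j\<in>UNIV. w j t) = 1"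
    and "\<And>j t. t \<in> {0..T} \<Longrightarrow> - dw j t \<le> K * w j t"
    and "0 \<le> \<alpha>" and "0 \<le> \<beta>" and "0 < \<epsilon>\<^sub>0"
    and "\<alpha> * (1 + K * T) \<le> \<alpha> * (4 * C\<^sup>2 * T\<^sup>2 / \<epsilon>\<^sub>0 + 2 * C * T)"
  shows "\<exists>lam\<ge>0.
      (\<forall>i j t. j \<noteq> i \<longrightarrow> t \<in> {0..T} \<longrightarrow> 0 \<le> compiler_rate w dw lam i j t) \<and>
      channel_fidelity (exact_channel H w T) (compiler_channel H w dw lam T) \<ge> 1 - \<epsilon>\<^sub>0 \<and>
      expected_gates \<alpha> \<beta> C w dw lam T \<le> ennreal (4 * \<alpha> * C\<^sup>2 * T\<^sup>2 / \<epsilon>\<^sub>0 + (2 * \<alpha> + \<beta>) * C * T)"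
proof -
  note w_deriv = assms(4) and w_nonneg = assms(5) and w_sum = assms(6) and dw_ge = assms(7)
  have C: "0 \<le> C"
    using onorm_pos_le[OF matrix_vector_linear, of "H undefined"] assms(3)[of undefined] by linarith
  have dw_sum: "(\<Sum>j\<in>UNIV. dw j t) = 0" if "0 < T" and t: "t \<in> {0..T}" for t
  proof (rule vector_derivative_unique_within_closed_interval[OF \<open>0 < T\<close>, of t "\<lambda>t. \<Sum>j\<in>UNIV. w j t"])
    show "((\<lambda>t. \<Sum>j\<in>UNIV. w j t) has_vector_derivative (\<Sum>j\<in>UNIV. dw j t)) (at t within cbox 0 T)"
      using w_deriv[OF t] unfolding has_real_derivative_iff_has_vector_derivative
      by (intro has_vector_derivative_sum) auto
    show "((\<lambda>t. \<Sum>j\<in>UNIV. w j t) has_vector_derivative 0) (at t within cbox 0 T)"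
      by (rule has_vector_derivative_transform[OF _ _ has_vector_derivative_const[of 1]]) (use t w_sum in auto)
  qed (use t in auto)
  \<comment> \<open>Summed over the nodes at time \<open>0\<close>, the bound on \<open>- dw\<close>
    reads \<open>0 \<le> K\<close>.\<close>
  have K: "0 \<le> K" if "0 < T"
  proof -
    have "(\<Sum>j\<in>UNIV. - dw j 0) \<le> (\<Sum>j\<in>UNIV. K * w j 0)"
      using dw_ge[of 0] assms(1) by (intro sum_mono) auto
    then show ?thesis
      using dw_sum[OF that, of 0] w_sum[of 0] assms(1) by (simp add: sum_negf sum_distrib_left[symmetric])
  qed
  have suffices: ?thesis
    if lam: "0 \<le> lam" "K \<le> lam" and err: "4 * C\<^sup>2 * T\<^sup>2 \<le> \<epsilon>\<^sub>0 * (1 + lam * T)"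
      and gates: "\<alpha> * (1 + lam * T) + \<beta> * C * T \<le> 4 * \<alpha> * C\<^sup>2 * T\<^sup>2 / \<epsilon>\<^sub>0 + (2 * \<alpha> + \<beta>) * C * T" for lam
  proof -
    have rate: "0 \<le> dw j t + lam * w j t" if "t \<in> {0..T}" for j t
      using dw_ge[OF that, of j] mult_right_mono[OF lam(2) w_nonneg[OF that, of j]] by linarith
    have fidelity: "1 - 4 * C\<^sup>2 * T\<^sup>2 / (1 + lam * T)
        \<le> channel_fidelity (exact_channel H w T) (compiler_channel H w dw lam T)"
      by (rule compiler_bounds(1)[where \<alpha>=\<alpha> and \<beta>=\<beta>]) (assumption | rule assms rate dw_sum lam)+
    have gates': "expected_gates \<alpha> \<beta> C w dw lam T \<le> ennreal (\<alpha> * (1 + lam * T) + \<beta> * C * T)"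
      by (rule compiler_bounds(2)[where H=H]) (assumption | rule assms rate dw_sum lam)+
    have "0 < 1 + lam * T" using lam(1) assms(1) by (simp add: add_pos_nonneg)
    then have "4 * C\<^sup>2 * T\<^sup>2 / (1 + lam * T) \<le> \<epsilon>\<^sub>0" using err by (simp add: pos_divide_le_eq)
    with fidelity have "1 - \<epsilon>\<^sub>0 \<le> channel_fidelity (exact_channel H w T) (compiler_channel H w dw lam T)"
      by linarith
    moreover have "expected_gates \<alpha> \<beta> C w dw lam T \<le> ennreal (4 * \<alpha> * C\<^sup>2 * T\<^sup>2 / \<epsilon>\<^sub>0 + (2 * \<alpha> + \<beta>) * C * T)"
      using gates' ennreal_leI[OF gates] by (rule order.trans)
    ultimately show ?thesis using lam(1) rate by (auto simp: compiler_rate_def)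
  qed
  show ?thesis
  proof (cases "\<alpha> = 0")
    case True
    \<comment> \<open>Without a cost per gate the cost bound is independent of \<open>lam\<close>,
      which only has to be nonnegative, at least \<open>K\<close>, and large enough for the
      error.\<close>
    let ?lam = "max (max K 0) (4 * C\<^sup>2 * T / \<epsilon>\<^sub>0)"
    show ?thesis
    proof (rule suffices[of ?lam])
      have "4 * C\<^sup>2 * T\<^sup>2 = \<epsilon>\<^sub>0 * (4 * C\<^sup>2 * T / \<epsilon>\<^sub>0 * T)"
        using assms(10) by (simp add: power2_eq_square)
      also have "\<dots> \<le> \<epsilon>\<^sub>0 * (?lam * T)"
        using assms(1,10) by (intro mult_left_mono mult_right_mono) auto
      also have "\<dots> \<le> \<epsilon>\<^sub>0 * (1 + ?lam * T)"
        using assms(10) by (intro mult_left_mono) auto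
      finally show "4 * C\<^sup>2 * T\<^sup>2 \<le> \<epsilon>\<^sub>0 * (1 + ?lam * T)" .
    qed (use True in auto)
  next
    case False
    then have \<alpha>: "0 < \<alpha>" using assms(8) by simp
    define X where "X = 4 * C\<^sup>2 * T\<^sup>2 / \<epsilon>\<^sub>0 + 2 * C * T"
    have X: "1 + K * T \<le> X" using assms(11) \<alpha> by (simp add: X_def)
    \<comment> \<open>At \<open>T = 0\<close> the budget \<open>X\<close> vanishes, while a single
      gate already requires \<open>X \<ge> 1\<close>.\<close>
    have T: "0 < T"
    proof (rule ccontr)
      assume "\<not> 0 < T"
      then have "T = 0" using assms(1) by simp
      then show False using X by (simp add: X_def)
    qed
    \<comment> \<open>This solves \<open>1 + lam * T = X\<close>: the gate budget is spent in full,
      and the term \<open>2 * C * T\<close> of \<open>X\<close> only improves the error.\<close>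
    let ?lam = "(X - 1) / T"
    have lamT: "1 + ?lam * T = X" using T by simp
    show ?thesis
    proof (rule suffices[of ?lam])
      show lam: "K \<le> ?lam" using X T by (simp add: pos_le_divide_eq)
      show "0 \<le> ?lam" using K[OF T] lam by linarith
      have "\<epsilon>\<^sub>0 * X = 4 * C\<^sup>2 * T\<^sup>2 + \<epsilon>\<^sub>0 * (2 * C * T)"
        using assms(10) by (simp add: X_def distrib_left)
      then show "4 * C\<^sup>2 * T\<^sup>2 \<le> \<epsilon>\<^sub>0 * (1 + ?lam * T)"
        unfolding lamT using assms(10) C T by simp
      have "\<alpha> * X + \<beta> * C * T \<le> 4 * \<alpha> * C\<^sup>2 * T\<^sup>2 / \<epsilon>\<^sub>0 + (2 * \<alpha> + \<beta>) * C * T"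
        by (simp add: X_def algebra_simps)
      then show "\<alpha> * (1 + ?lam * T) + \<beta> * C * T \<le> 4 * \<alpha> * C\<^sup>2 * T\<^sup>2 / \<epsilon>\<^sub>0 + (2 * \<alpha> + \<beta>) * C * T"
        unfolding lamT .
    qed
  qed
qed

end
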